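(* Let $R$ be a right perfect, left automorphism-invariant ring. Then $R$ is left self-injective.
   Context: Rings are associative with identity and modules are unital. A ring $R$ is right perfect if every right $R$-module has a projective cover. A module $M$ is automorphism-invariant if $\varphi(M)\subseteq M$ for every automorphism $\varphi$ of its injective envelope $E(M)$. A ring $R$ is left automorphism-invariant if the left module ${}_RR$ is automorphism-invariant. A ring $R$ is left self-injective if ${}_RR$ is an injective left $R$-module. *)

theory Defs
  imports "HOL-Algebra.AbelCoset" "HOL-Algebra.Module"
begin

text \<open>
  The library locale \<^locale>\<open>module\<close> requires a commutative ring of scalars; the locale below has
  the same axioms over an arbitrary ring. The fields \<open>mult\<close> and \<open>one\<close> of a module record play no role.
\<close>

locale left_module = R?: ring R + M?: abelian_group M
  for R :: "('a, 'm) ring_scheme" (structure) and M :: "('a, 'b, 'n) module_scheme" (structure) +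
  assumes smult_closed [simp, intro]:
      "\<lbrakk>a \<in> carrier R; x \<in> carrier M\<rbrakk> \<Longrightarrow> a \<odot>\<^bsub>M\<^esub> x \<in> carrier M"
    and smult_l_distr:
      "\<lbrakk>a \<in> carrier R; b \<in> carrier R; x \<in> carrier M\<rbrakk> \<Longrightarrow>
      (a \<oplus> b) \<odot>\<^bsub>M\<^esub> x = a \<odot>\<^bsub>M\<^esub> x \<oplus>\<^bsub>M\<^esub> b \<odot>\<^bsub>M\<^esub> x"
    and smult_r_distr:
      "\<lbrakk>a \<in> carrier R; x \<in> carrier M; y \<in> carrier M\<rbrakk> \<Longrightarrow>
      a \<odot>\<^bsub>M\<^esub> (x \<oplus>\<^bsub>M\<^esub> y) = a \<odot>\<^bsub>M\<^esub> x \<oplus>\<^bsub>M\<^esub> a \<odot>\<^bsub>M\<^esub> y"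
    and smult_assoc1:
      "\<lbrakk>a \<in> carrier R; b \<in> carrier R; x \<in> carrier M\<rbrakk> \<Longrightarrow>
      (a \<otimes> b) \<odot>\<^bsub>M\<^esub> x = a \<odot>\<^bsub>M\<^esub> (b \<odot>\<^bsub>M\<^esub> x)"
    and smult_one [simp]:
      "x \<in> carrier M \<Longrightarrow> \<one> \<odot>\<^bsub>M\<^esub> x = x"

definition opposite_ring :: "('a, 'm) ring_scheme \<Rightarrow> ('a, 'm) ring_scheme" where
  "opposite_ring R = R\<lparr>monoid.mult := \<lambda>x y. y \<otimes>\<^bsub>R\<^esub> x\<rparr>"

lemma opposite_ring_simps [simp]:
  "carrier (opposite_ring R) = carrier R"
  "x \<otimes>\<^bsub>opposite_ring R\<^esub> y = y \<otimes>\<^bsub>R\<^esub> x"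
  "\<one>\<^bsub>opposite_ring R\<^esub> = \<one>\<^bsub>R\<^esub>"
  "\<zero>\<^bsub>opposite_ring R\<^esub> = \<zero>\<^bsub>R\<^esub>"
  "x \<oplus>\<^bsub>opposite_ring R\<^esub> y = x \<oplus>\<^bsub>R\<^esub> y"
  by (simp_all add: opposite_ring_def)

lemma (in ring) ring_opposite_ring: "ring (opposite_ring R)"
proof (rule ringI)
  show "abelian_group (opposite_ring R)"
    by (rule abelian_groupI) (auto simp: a_ac intro: l_neg)
  show "Group.monoid (opposite_ring R)"
    by (rule monoidI) (auto simp: m_assoc)
qed (auto simp: l_distr r_distr)

text \<open>
  A right \<open>R\<close>-module is a left module over the opposite ring, \<open>x r\<close> being written \<open>r \<odot> x\<close>.
\<close>

abbreviation right_module :: "('a, 'm) ring_scheme \<Rightarrow> ('a, 'b, 'n) module_scheme \<Rightarrow> bool" where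
  "right_module R M \<equiv> left_module (opposite_ring R) M"

definition regular_module :: "('a, 'm) ring_scheme \<Rightarrow> ('a, 'a) module" where
  "regular_module R = \<lparr>carrier = carrier R, monoid.mult = (\<otimes>\<^bsub>R\<^esub>), one = \<one>\<^bsub>R\<^esub>,
     ring.zero = \<zero>\<^bsub>R\<^esub>, add = (\<oplus>\<^bsub>R\<^esub>), smult = (\<otimes>\<^bsub>R\<^esub>)\<rparr>"

lemma regular_module_simps [simp]:
  "carrier (regular_module R) = carrier R"
  "\<zero>\<^bsub>regular_module R\<^esub> = \<zero>\<^bsub>R\<^esub>"
  "x \<oplus>\<^bsub>regular_module R\<^esub> y = x \<oplus>\<^bsub>R\<^esub> y"
  "x \<odot>\<^bsub>regular_module R\<^esub> y = x \<otimes>\<^bsub>R\<^esub> y"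
  by (simp_all add: regular_module_def)

lemma (in ring) left_module_regular_module: "left_module R (regular_module R)"
proof -
  have "abelian_group (regular_module R)"
    by (rule abelian_groupI) (auto simp: a_ac intro: l_neg)
  then show ?thesis
    by (intro left_module.intro left_module_axioms.intro ring_axioms)
       (auto simp: l_distr r_distr m_assoc)
qed

definition module_hom ::
    "('a, 'm) ring_scheme \<Rightarrow> ('a, 'b, 'n) module_scheme \<Rightarrow> ('a, 'c, 'o) module_scheme \<Rightarrow> ('b \<Rightarrow> 'c) set" where
  "module_hom R M N = {f \<in> carrier M \<rightarrow> carrier N.
     (\<forall>x\<in>carrier M. \<forall>y\<in>carrier M. f (x \<oplus>\<^bsub>M\<^esub> y) = f x \<oplus>\<^bsub>N\<^esub> f y) \<and>
     (\<forall>a\<in>carrier R. \<forall>x\<in>carrier M. f (a \<odot>\<^bsub>M\<^esub> x) = a \<odot>\<^bsub>N\<^esub> f x)}"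

definition module_automorphism ::
    "('a, 'm) ring_scheme \<Rightarrow> ('a, 'b, 'n) module_scheme \<Rightarrow> ('b \<Rightarrow> 'b) \<Rightarrow> bool" where
  "module_automorphism R M f \<longleftrightarrow> f \<in> module_hom R M M \<and> bij_betw f (carrier M) (carrier M)"

definition essential_submodule ::
    "'b set \<Rightarrow> ('a, 'm) ring_scheme \<Rightarrow> ('a, 'b, 'n) module_scheme \<Rightarrow> bool" where
  "essential_submodule N R M \<longleftrightarrow> submodule N R M \<and>
     (\<forall>L. submodule L R M \<and> N \<inter> L = {\<zero>\<^bsub>M\<^esub>} \<longrightarrow> L = {\<zero>\<^bsub>M\<^esub>})"

definition superfluous_submodule ::
    "'b set \<Rightarrow> ('a, 'm) ring_scheme \<Rightarrow> ('a, 'b, 'n) module_scheme \<Rightarrow> bool" where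
  "superfluous_submodule N R M \<longleftrightarrow> submodule N R M \<and>
     (\<forall>L. submodule L R M \<and> N <+>\<^bsub>M\<^esub> L = carrier M \<longrightarrow> L = carrier M)"

text \<open>
  A HOL definition cannot quantify over all types. The notions below that quantify over all modules
  therefore take a type argument \<open>TYPE('u)\<close>, and the modules quantified over are those whose carrier
  is a set of elements of \<open>'u\<close>. For modules with carrier in an infinite type \<open>'u\<close> into which the type
  of scalars embeds, injectivity (by Baer's criterion), projectivity (lift the identity along a free
  presentation) and perfectness of the ring (by Bass's theorem, countably generated modules suffice)
  do not depend on \<open>'u\<close>.
\<close>

definition injective_module ::
    "'u itself \<Rightarrow> ('a, 'm) ring_scheme \<Rightarrow> ('a, 'b, 'n) module_scheme \<Rightarrow> bool" where
  "injective_module (_ :: 'u itself) R E \<longleftrightarrow> left_module R E \<and>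
     (\<forall>(A :: ('a, 'u) module) (B :: ('a, 'u) module) f g.
        left_module R A \<and> left_module R B \<and>
        f \<in> module_hom R A B \<and> inj_on f (carrier A) \<and> g \<in> module_hom R A E \<longrightarrow>
        (\<exists>h \<in> module_hom R B E. \<forall>x\<in>carrier A. h (f x) = g x))"

definition projective_module ::
    "'u itself \<Rightarrow> ('a, 'm) ring_scheme \<Rightarrow> ('a, 'b, 'n) module_scheme \<Rightarrow> bool" where
  "projective_module (_ :: 'u itself) R P \<longleftrightarrow> left_module R P \<and>
     (\<forall>(A :: ('a, 'u) module) (B :: ('a, 'u) module) f g.
        left_module R A \<and> left_module R B \<and>
        f \<in> module_hom R A B \<and> f ` carrier A = carrier B \<and> g \<in> module_hom R P B \<longrightarrow>
        (\<exists>h \<in> module_hom R P A. \<forall>x\<in>carrier P. f (h x) = g x))"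

definition projective_cover ::
    "'u itself \<Rightarrow> ('a, 'm) ring_scheme \<Rightarrow> ('a, 'b, 'n) module_scheme \<Rightarrow>
     ('a, 'c, 'o) module_scheme \<Rightarrow> ('c \<Rightarrow> 'b) \<Rightarrow> bool" where
  "projective_cover U R M P p \<longleftrightarrow> projective_module U R P \<and>
     p \<in> module_hom R P M \<and> p ` carrier P = carrier M \<and>
     superfluous_submodule {x \<in> carrier P. p x = \<zero>\<^bsub>M\<^esub>} R P"

definition injective_envelope ::
    "'u itself \<Rightarrow> ('a, 'm) ring_scheme \<Rightarrow> ('a, 'b, 'n) module_scheme \<Rightarrow>
     ('a, 'c, 'o) module_scheme \<Rightarrow> ('b \<Rightarrow> 'c) \<Rightarrow> bool" where
  "injective_envelope U R M E i \<longleftrightarrow> injective_module U R E \<and>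
     i \<in> module_hom R M E \<and> inj_on i (carrier M) \<and>
     essential_submodule (i ` carrier M) R E"

definition right_perfect :: "'u itself \<Rightarrow> ('a, 'm) ring_scheme \<Rightarrow> bool" where
  "right_perfect (U :: 'u itself) R \<longleftrightarrow> ring R \<and>
     (\<forall>M :: ('a, 'u) module. right_module R M \<longrightarrow>
        (\<exists>(P :: ('a, 'u) module) p. projective_cover U (opposite_ring R) M P p))"

text \<open>
  Injective envelopes are unique only up to isomorphism over \<open>M\<close>, so all envelopes \<open>i : M \<rightarrow> E\<close> with
  \<open>E\<close> in \<open>'u\<close> are considered. For small \<open>'u\<close> there may be none. For \<open>M\<close> the regular module of a ring
  \<open>R\<close> with elements in \<open>'a\<close>, an embedding of \<open>(nat + 'a) set\<close> into \<open>'u\<close> guarantees one: the envelope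
  embeds into the group of additive maps from \<open>R\<close> to a divisible hull of \<open>(R, +)\<close>.
\<close>

definition automorphism_invariant_module ::
    "'u itself \<Rightarrow> ('a, 'm) ring_scheme \<Rightarrow> ('a, 'b, 'n) module_scheme \<Rightarrow> bool" where
  "automorphism_invariant_module (U :: 'u itself) R M \<longleftrightarrow> left_module R M \<and>
     (\<forall>(E :: ('a, 'u) module) i. injective_envelope U R M E i \<longrightarrow>
        (\<forall>\<phi>. module_automorphism R E \<phi> \<longrightarrow> \<phi> ` (i ` carrier M) \<subseteq> i ` carrier M))"

definition left_automorphism_invariant :: "'u itself \<Rightarrow> ('a, 'm) ring_scheme \<Rightarrow> bool" where
  "left_automorphism_invariant U R \<longleftrightarrow> automorphism_invariant_module U R (regular_module R)"

definition left_self_injective :: "'u itself \<Rightarrow> ('a, 'm) ring_scheme \<Rightarrow> bool" where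
  "left_self_injective U R \<longleftrightarrow> injective_module U R (regular_module R)"

end

theory Submission
  imports Complex_Main "HOL-Library.Countable" Defs
begin

text \<open>
  Let \<open>E = E(R)\<close>. Every automorphism of \<open>E\<close>, hence every sum of automorphisms, maps \<open>R\<close> into itself; so does every
  endomorphism of square zero. Bass's argument, applied to one sequential colimit, gives the minimum condition on
  principal left ideals, so that minimal left ideals abound and \<open>1\<close> is a sum of finitely many orthogonal primitive idempotents \<open>e\<close>.
  If a minimal left ideal \<open>T = R t \<subseteq> R e\<close> has a second copy in \<open>R\<close> or an endomorphism other than \<open>0\<close> and \<open>1\<close>, that is,
  if \<open>t\<close> is not the only element of \<open>R\<close> with its left annihilator, then the projection of \<open>E\<close> onto \<open>E(T)\<close> is a combination of
  automorphisms, and \<open>R e\<close> is uniform. In the remaining case the minimal left ideals in \<open>R e\<close> are two-sided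
  with endomorphism ring of order two, and still \<open>e R e\<close> is local. Thus every simple left ideal is a quotient of exactly one \<open>R e\<close>
  up to the relevant equivalence, and comparing the tops with the socles of the \<open>R e\<close> by counting shows that
  each \<open>R e\<close> contains a single minimal left ideal, i.e. is uniform, in all cases. For uniform \<open>R e\<close> the projection onto
  \<open>E(R e)\<close> maps \<open>R\<close> into \<open>R\<close>, which forces \<open>E(R e) \<subseteq> R\<close>. Summing over \<open>e\<close> gives \<open>E = R\<close>.
\<close>

section \<open>Minimal left ideals and idempotents\<close>

text \<open>The obstacle is a minimal left ideal whose endomorphism ring has order two. Writing the
  projection \<open>\<pi>\<close> onto a summand through automorphisms, as
  \<open>k - (k - \<pi>)\<close>, needs a \<open>k\<close> for which \<open>k\<close> and
  \<open>k - \<pi>\<close> are both invertible on the summand, and over a field with two elements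
  there is none. A second element with the annihilator of \<open>t\<close> repairs this: if it lies
  in the summand it supplies such a \<open>k\<close>; if not, it supplies two square-zero maps whose
  composite is invertible on the summand. Without a second element nothing of the kind is available
  and uniformity has to be won by counting. The count needs only that \<open>e R e\<close> is local,
  and this follows from the rigidity of the bad case, where all ring elements act on a minimal left
  ideal of \<open>R e\<close> as \<open>0\<close> or \<open>1\<close>. Ideals are handled through
  generators: \<open>t \<mapsto> t'\<close> induces an isomorphism
  \<open>R t \<rightarrow> R t'\<close> exactly if the left annihilators agree. The hull is
  constructed concretely, as a summand of a product of character groups of \<open>R\<close>, so that
  a single module is injective for every type argument that occurs.\<close>

context ring
begin

lemma minus_distr_l: "\<lbrakk>a \<in> carrier R; b \<in> carrier R; c \<in> carrier R\<rbrakk> \<Longrightarrow> (a \<ominus> b) \<otimes> c = a \<otimes> c \<ominus> b \<otimes> c"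
  by (simp add: a_minus_def l_distr l_minus)

lemma minus_distr_r: "\<lbrakk>a \<in> carrier R; b \<in> carrier R; c \<in> carrier R\<rbrakk> \<Longrightarrow> a \<otimes> (b \<ominus> c) = a \<otimes> b \<ominus> a \<otimes> c"
  by (simp add: a_minus_def r_distr r_minus)

lemma minus_eq_zero_iff: "\<lbrakk>a \<in> carrier R; b \<in> carrier R\<rbrakk> \<Longrightarrow> a \<ominus> b = \<zero> \<longleftrightarrow> a = b"
  by (metis a_minus_def add.inv_closed minus_equality minus_minus r_neg)

text \<open>Equality of two such sets encodes an isomorphism of cyclic left ideals that matches the
  generators, so that no maps between ideals are needed.\<close>

definition left_ann :: "'a \<Rightarrow> 'a set" where
  "left_ann t = {r \<in> carrier R. r \<otimes> t = \<zero>}"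

definition minimal_gen :: "'a \<Rightarrow> bool" where
  "minimal_gen t \<longleftrightarrow> t \<in> carrier R \<and> t \<noteq> \<zero> \<and>
     (\<forall>r\<in>carrier R. r \<otimes> t \<noteq> \<zero> \<longrightarrow> (\<exists>s\<in>carrier R. s \<otimes> (r \<otimes> t) = t))"

definition idem :: "'a \<Rightarrow> bool" where
  "idem e \<longleftrightarrow> e \<in> carrier R \<and> e \<otimes> e = e"

definition primitive :: "'a \<Rightarrow> bool" where
  "primitive e \<longleftrightarrow> idem e \<and> e \<noteq> \<zero> \<and> (\<forall>g. idem g \<and> e \<otimes> g = g \<and> g \<otimes> e = g \<longrightarrow> g = \<zero> \<or> g = e)"

definition uniform_idem :: "'a \<Rightarrow> bool" where
  "uniform_idem e \<longleftrightarrow> idem e \<and>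
     (\<forall>x\<in>carrier R. \<forall>y\<in>carrier R. x \<otimes> e = x \<and> y \<otimes> e = y \<and> x \<noteq> \<zero> \<and> y \<noteq> \<zero> \<longrightarrow>
        (\<exists>r\<in>carrier R. \<exists>s\<in>carrier R. r \<otimes> x = s \<otimes> y \<and> r \<otimes> x \<noteq> \<zero>))"

text \<open>For an idempotent \<open>e\<close>, the one-sided form of locality of the ring
  \<open>e R e\<close>. The witness may be moved into \<open>e R e\<close>, as
  \<open>e c e r = e c r = e\<close>.\<close>

definition local_idem :: "'a \<Rightarrow> bool" where
  "local_idem e \<longleftrightarrow> (\<forall>r\<in>carrier R. \<forall>s\<in>carrier R.
     r \<otimes> e = r \<and> e \<otimes> r = r \<and> s \<otimes> e = s \<and> e \<otimes> s = s \<and> r \<oplus> s = e \<longrightarrow>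
     (\<exists>c\<in>carrier R. c \<otimes> r = e) \<or> (\<exists>c\<in>carrier R. c \<otimes> s = e))"

text \<open>For generators of minimal left ideals this says that the ideals are isomorphic.\<close>

definition sim :: "'a \<Rightarrow> 'a \<Rightarrow> bool" where
  "sim t t' \<longleftrightarrow> (\<exists>r\<in>carrier R. left_ann (r \<otimes> t') = left_ann t)"

section \<open>Simple left ideals up to isomorphism\<close>

lemma minimal_gen_multiple:
  assumes t: "minimal_gen t" and r: "r \<in> carrier R" "r \<otimes> t \<noteq> \<zero>"
  shows "minimal_gen (r \<otimes> t)"
proof -
  have tc: "t \<in> carrier R" using t by (simp add: minimal_gen_def)
  obtain s where s: "s \<in> carrier R" "s \<otimes> (r \<otimes> t) = t"
    using t r by (auto simp: minimal_gen_def)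
  show ?thesis
    unfolding minimal_gen_def
  proof (intro conjI ballI impI)
    show "r \<otimes> t \<in> carrier R" using r tc by simp
    fix a assume a: "a \<in> carrier R" "a \<otimes> (r \<otimes> t) \<noteq> \<zero>"
    then have "(a \<otimes> r) \<otimes> t \<noteq> \<zero>" using r tc by (simp add: m_assoc)
    then obtain b where b: "b \<in> carrier R" "b \<otimes> ((a \<otimes> r) \<otimes> t) = t"
      using t a r by (auto simp: minimal_gen_def)
    then have "(r \<otimes> b) \<otimes> (a \<otimes> (r \<otimes> t)) = r \<otimes> t"
      using a r tc by (simp add: m_assoc)
    then show "\<exists>s\<in>carrier R. s \<otimes> (a \<otimes> (r \<otimes> t)) = r \<otimes> t"
      using b r by blast
  qed (use r in simp)
qed

text \<open>Schur's lemma: right multiplication by \<open>r\<close> is a nonzero homomorphism on the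
  simple module \<open>R t\<close>, hence injective.\<close>

lemma left_ann_minimal_gen_eq:
  assumes t: "minimal_gen t" and r: "r \<in> carrier R" "t \<otimes> r \<noteq> \<zero>"
  shows "left_ann (t \<otimes> r) = left_ann t"
proof -
  have tc: "t \<in> carrier R" using t by (simp add: minimal_gen_def)
  have "a \<otimes> t = \<zero>" if a: "a \<in> carrier R" "a \<otimes> (t \<otimes> r) = \<zero>" for a
  proof (rule ccontr)
    assume "a \<otimes> t \<noteq> \<zero>"
    then obtain s where s: "s \<in> carrier R" "s \<otimes> (a \<otimes> t) = t"
      using t a by (auto simp: minimal_gen_def)
    have "t \<otimes> r = s \<otimes> (a \<otimes> t) \<otimes> r" using s by simp
    also have "\<dots> = s \<otimes> (a \<otimes> (t \<otimes> r))" using a r s(1) tc by (simp add: m_assoc)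
    also have "\<dots> = \<zero>" using a s by simp
    finally show False using r by simp
  qed
  moreover have "a \<otimes> (t \<otimes> r) = \<zero>" if "a \<in> carrier R" "a \<otimes> t = \<zero>" for a
    using that r tc by (simp flip: m_assoc)
  ultimately show ?thesis by (auto simp: left_ann_def)
qed

lemma left_ann_mult_cong:
  assumes "left_ann x = left_ann y" "x \<in> carrier R" "y \<in> carrier R" "c \<in> carrier R"
  shows "left_ann (c \<otimes> x) = left_ann (c \<otimes> y)"
proof -
  have "a \<otimes> (c \<otimes> x) = \<zero> \<longleftrightarrow> a \<otimes> (c \<otimes> y) = \<zero>" if "a \<in> carrier R" for a
  proof -
    have "a \<otimes> c \<in> left_ann x \<longleftrightarrow> a \<otimes> c \<in> left_ann y" using assms by simp
    then show ?thesis using that assms by (simp add: left_ann_def m_assoc)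
  qed
  then show ?thesis by (auto simp: left_ann_def)
qed

lemma left_ann_eq_zero: 
  assumes "left_ann x = left_ann y" "x \<in> carrier R" "y \<in> carrier R"
  shows "x = \<zero> \<longleftrightarrow> y = \<zero>"
proof -
  have "\<one> \<in> left_ann x \<longleftrightarrow> \<one> \<in> left_ann y" using assms by simp
  then show ?thesis using assms by (simp add: left_ann_def)
qed

lemma sim_refl: "t \<in> carrier R \<Longrightarrow> sim t t"
  unfolding sim_def by (rule bexI[of _ \<one>]) auto

text \<open>Simplicity of \<open>R t'\<close> gives \<open>b\<close> with
  \<open>b (r t') = t'\<close>, and the isomorphism sends \<open>t'\<close> to
  \<open>b t\<close>.\<close>

lemma sim_sym:
  assumes "sim t t'" "minimal_gen t" "minimal_gen t'"
  shows "sim t' t"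
proof -
  obtain r where r: "r \<in> carrier R" "left_ann (r \<otimes> t') = left_ann t"
    using assms by (auto simp: sim_def)
  have c: "t \<in> carrier R" "t' \<in> carrier R" "t \<noteq> \<zero>" using assms by (auto simp: minimal_gen_def)
  have "r \<otimes> t' \<noteq> \<zero>" using left_ann_eq_zero[OF r(2)] c r by auto
  then obtain b where b: "b \<in> carrier R" "b \<otimes> (r \<otimes> t') = t'"
    using assms r by (auto simp: minimal_gen_def)
  have "left_ann (b \<otimes> (r \<otimes> t')) = left_ann (b \<otimes> t)"
    by (rule left_ann_mult_cong[OF r(2)]) (use b c r in auto)
  then show ?thesis using b by (auto simp: sim_def)
qed

lemma sim_trans:
  assumes "sim t1 t2" "sim t2 t3" "t1 \<in> carrier R" "t2 \<in> carrier R" "t3 \<in> carrier R"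
  shows "sim t1 t3"
proof -
  obtain r where r: "r \<in> carrier R" "left_ann (r \<otimes> t2) = left_ann t1"
    using assms by (auto simp: sim_def)
  obtain s where s: "s \<in> carrier R" "left_ann (s \<otimes> t3) = left_ann t2"
    using assms by (auto simp: sim_def)
  have "left_ann (r \<otimes> (s \<otimes> t3)) = left_ann (r \<otimes> t2)"
    by (rule left_ann_mult_cong[OF s(2)]) (use assms r s in auto)
  then have "left_ann ((r \<otimes> s) \<otimes> t3) = left_ann t1"
    using r s assms by (simp add: m_assoc)
  then show ?thesis using r s by (auto simp: sim_def)
qed

text \<open>A nonzero element \<open>e a t\<close> makes \<open>R t\<close> a quotient of
  \<open>R e\<close>. For non-isomorphic quotients some element of \<open>e R e\<close> would kill a
  nonzero element of one and fix a nonzero element of the other; then neither it nor its difference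
  from \<open>e\<close> could be left invertible.\<close>

lemma local_idem_minimal_sim:
  assumes e: "idem e" "local_idem e" and t: "minimal_gen t" "minimal_gen t'"
    and a: "a \<in> carrier R" "e \<otimes> (a \<otimes> t) \<noteq> \<zero>" and b: "b \<in> carrier R" "e \<otimes> (b \<otimes> t') \<noteq> \<zero>"
  shows "sim t t'"
proof -
  \<comment> \<open>Stated for arbitrary data, so that exchanging the two ideals gives the reverse
    inclusion.\<close>
  have key: "left_ann (e \<otimes> (a \<otimes> t)) \<subseteq> left_ann (e \<otimes> (b \<otimes> t'))"
    if t: "minimal_gen t" "minimal_gen t'"
    and a: "a \<in> carrier R" "e \<otimes> (a \<otimes> t) \<noteq> \<zero>" and b: "b \<in> carrier R" "e \<otimes> (b \<otimes> t') \<noteq> \<zero>"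
  for t t' a b
  proof
    fix z assume "z \<in> left_ann (e \<otimes> (a \<otimes> t))"
    then have z: "z \<in> carrier R" "z \<otimes> (e \<otimes> (a \<otimes> t)) = \<zero>" by (auto simp: left_ann_def)
    define x where "x = e \<otimes> (a \<otimes> t)"
    define y where "y = e \<otimes> (b \<otimes> t')"
    have c: "t \<in> carrier R" "t' \<in> carrier R" "e \<in> carrier R"
      using t e by (auto simp: minimal_gen_def idem_def)
    have ee: "e \<otimes> e = e" using e by (simp add: idem_def)
    have xy: "x \<in> carrier R" "y \<in> carrier R" using c a b by (auto simp: x_def y_def)
    have ex: "e \<otimes> x = x" "e \<otimes> y = y"
      using c a b ee by (simp_all add: x_def y_def flip: m_assoc)
    have "(e \<otimes> b) \<otimes> t' \<noteq> \<zero>" using b c by (simp add: m_assoc)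
    then have my: "minimal_gen y"
      using minimal_gen_multiple[OF t(2), of "e \<otimes> b"] b c by (simp add: y_def m_assoc)
    have "z \<otimes> y = \<zero>"
    proof (rule ccontr)
      assume "z \<otimes> y \<noteq> \<zero>"
      then obtain s where s: "s \<in> carrier R" "s \<otimes> (z \<otimes> y) = y"
        using my z by (auto simp: minimal_gen_def)
      \<comment> \<open>\<open>s z\<close> kills \<open>x\<close> and fixes \<open>y\<close>.
        Cutting down by \<open>e\<close> on both sides preserves this, because \<open>e\<close>
        fixes \<open>x\<close> and \<open>y\<close>.\<close>
      define p where "p = e \<otimes> (s \<otimes> (z \<otimes> e))"
      have pc: "p \<in> carrier R" using s z c by (simp add: p_def)
      have ep: "e \<otimes> p = p" "p \<otimes> e = p"
        using s(1) z(1) c ee by (simp add: p_def flip: m_assoc, simp add: p_def m_assoc)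
      have px: "p \<otimes> x = \<zero>"
        using s(1) z c ee ex xy by (simp add: p_def m_assoc x_def[symmetric])
      have py: "p \<otimes> y = y"
        using s z(1) c ee ex xy by (simp add: p_def m_assoc)
      define q where "q = e \<ominus> p"
      have qc: "q \<in> carrier R" using pc c by (simp add: q_def)
      have eq: "e \<otimes> q = q" "q \<otimes> e = q" 
        using pc c ee ep by (simp_all add: q_def minus_distr_l minus_distr_r)
      have qy: "q \<otimes> y = \<zero>" using pc c xy ex py by (simp add: q_def minus_distr_l minus_eq_zero_iff)
      have pq: "p \<oplus> q = e" unfolding q_def using pc c by algebra
      have "(\<exists>c\<in>carrier R. c \<otimes> p = e) \<or> (\<exists>c\<in>carrier R. c \<otimes> q = e)"
        using e(2) pc qc ep eq pq by (simp add: local_idem_def)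
      then show False
      proof
        assume "\<exists>c\<in>carrier R. c \<otimes> p = e"
        then obtain d where d: "d \<in> carrier R" "d \<otimes> p = e" by auto
        then have "e \<otimes> x = d \<otimes> (p \<otimes> x)" using pc xy by (simp flip: m_assoc)
        then show False using px d ex a by (simp add: x_def)
      next
        assume "\<exists>c\<in>carrier R. c \<otimes> q = e"
        then obtain d where d: "d \<in> carrier R" "d \<otimes> q = e" by auto
        then have "e \<otimes> y = d \<otimes> (q \<otimes> y)" using qc xy by (simp flip: m_assoc)
        then show False using qy d ex b by (simp add: y_def)
      qed
    qed
    then show "z \<in> left_ann (e \<otimes> (b \<otimes> t'))" using z by (simp add: left_ann_def y_def)
  qed
  have c: "t \<in> carrier R" "t' \<in> carrier R" "e \<in> carrier R"
    using t e by (auto simp: minimal_gen_def idem_def)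
  have eq: "left_ann (e \<otimes> (a \<otimes> t)) = left_ann (e \<otimes> (b \<otimes> t'))"
    using key[OF t a b] key[OF t(2,1) b a] by blast
  have "(e \<otimes> a) \<otimes> t \<noteq> \<zero>" using a c by (simp add: m_assoc)
  then obtain s where s: "s \<in> carrier R" "s \<otimes> ((e \<otimes> a) \<otimes> t) = t"
    using t(1) a c unfolding minimal_gen_def by blast
  have "left_ann (s \<otimes> (e \<otimes> (a \<otimes> t))) = left_ann (s \<otimes> (e \<otimes> (b \<otimes> t')))"
    by (rule left_ann_mult_cong[OF eq]) (use a b c s in auto)
  then have "left_ann t = left_ann ((s \<otimes> (e \<otimes> b)) \<otimes> t')"
    using s a b c by (simp add: m_assoc)
  then show ?thesis using s b c by (auto simp: sim_def)
qed

end

text \<open>The descending chain condition on principal left ideals, phrased as a minimum condition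
  on sets of generators so that each use is a single choice of a minimal element.\<close>

locale left_dcc = ring +
  assumes dcc: "\<lbrakk>X \<subseteq> carrier R; X \<noteq> {}\<rbrakk> \<Longrightarrow>
    \<exists>x\<in>X. \<forall>y\<in>X. (\<exists>r\<in>carrier R. y = r \<otimes> x) \<longrightarrow> (\<exists>r\<in>carrier R. r \<otimes> y = x)"
begin

section \<open>Consequences of the minimum condition\<close>

lemma dcc_minimal:
  assumes "P x" "\<And>x. P x \<Longrightarrow> x \<in> carrier R"
  obtains y where "P y" "\<forall>r\<in>carrier R. P (r \<otimes> y) \<longrightarrow> (\<exists>s\<in>carrier R. s \<otimes> (r \<otimes> y) = y)"
proof -
  have "Collect P \<subseteq> carrier R" "Collect P \<noteq> {}" using assms by auto
  from dcc[OF this] that show thesis by blast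
qed

lemma minimal_gen_below:
  assumes x: "x \<in> carrier R" "x \<noteq> \<zero>"
  shows "\<exists>r\<in>carrier R. minimal_gen (r \<otimes> x)"
proof -
  define P where "P y \<longleftrightarrow> y \<in> carrier R \<and> y \<noteq> \<zero> \<and> (\<exists>r\<in>carrier R. y = r \<otimes> x)" for y
  have "P x" unfolding P_def using x by (auto intro!: bexI[of _ \<one>])
  moreover have "x \<in> carrier R" if "P x" for x using that by (simp add: P_def)
  ultimately obtain y where y: "P y" and min: "\<forall>r\<in>carrier R. P (r \<otimes> y) \<longrightarrow> (\<exists>s\<in>carrier R. s \<otimes> (r \<otimes> y) = y)"
    by (rule dcc_minimal)
  have "minimal_gen y"
    unfolding minimal_gen_def
  proof (intro conjI ballI impI)
    fix r assume r: "r \<in> carrier R" "r \<otimes> y \<noteq> \<zero>"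
    obtain q where q: "q \<in> carrier R" "y = q \<otimes> x" using y by (auto simp: P_def)
    have "r \<otimes> y = (r \<otimes> q) \<otimes> x" using q r x by (simp add: m_assoc)
    then have "\<exists>q\<in>carrier R. r \<otimes> y = q \<otimes> x" using r q by (intro bexI[of _ "r \<otimes> q"]) simp_all
    then have "P (r \<otimes> y)" using r y by (simp add: P_def)
    then show "\<exists>s\<in>carrier R. s \<otimes> (r \<otimes> y) = y" using min r(1) by blast
  qed (use y in \<open>auto simp: P_def\<close>)
  moreover obtain q where "q \<in> carrier R" "y = q \<otimes> x" using y by (auto simp: P_def)
  ultimately show ?thesis by blast
qed

text \<open>Among all elements of \<open>e R e\<close> with injective right multiplication on
  \<open>R e\<close> take \<open>v\<close> with \<open>R v\<close> minimal. Since \<open>w v\<close>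
  is another one and lies in \<open>R v\<close>, some \<open>x\<close> has \<open>x w v = v\<close>;
  then \<open>e - e x w\<close> kills \<open>v\<close>, so it vanishes by injectivity.\<close>

lemma left_inverse_of_injective:
  assumes e: "idem e" and w: "w \<in> carrier R" "e \<otimes> w = w" "w \<otimes> e = w"
    and inj: "\<And>x. \<lbrakk>x \<in> carrier R; x \<otimes> e = x; x \<otimes> w = \<zero>\<rbrakk> \<Longrightarrow> x = \<zero>"
  shows "\<exists>c\<in>carrier R. c \<otimes> w = e"
proof -
  have ec: "e \<in> carrier R" "e \<otimes> e = e" using e by (auto simp: idem_def)
  define P where "P v \<longleftrightarrow> v \<in> carrier R \<and> e \<otimes> v = v \<and> v \<otimes> e = v \<and>
      (\<forall>x\<in>carrier R. x \<otimes> e = x \<and> x \<otimes> v = \<zero> \<longrightarrow> x = \<zero>)" for v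
  have "P e" unfolding P_def using ec by metis
  moreover have "x \<in> carrier R" if "P x" for x using that by (simp add: P_def)
  ultimately obtain v where v: "P v" and min: "\<forall>r\<in>carrier R. P (r \<otimes> v) \<longrightarrow> (\<exists>s\<in>carrier R. s \<otimes> (r \<otimes> v) = v)"
    by (rule dcc_minimal)
  have vc: "v \<in> carrier R" "e \<otimes> v = v" "v \<otimes> e = v" using v by (auto simp: P_def)
  have "P (w \<otimes> v)"
    unfolding P_def
  proof (intro conjI ballI impI)
    show "w \<otimes> v \<in> carrier R" using w vc by simp
    show "e \<otimes> (w \<otimes> v) = w \<otimes> v" using w vc ec by (simp flip: m_assoc)
    show "w \<otimes> v \<otimes> e = w \<otimes> v" using w vc ec by (simp add: m_assoc)
    fix x assume x: "x \<in> carrier R" "x \<otimes> e = x \<and> x \<otimes> (w \<otimes> v) = \<zero>"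
    then have "(x \<otimes> w) \<otimes> v = \<zero>" "(x \<otimes> w) \<otimes> e = x \<otimes> w" using w vc ec by (simp_all add: m_assoc)
    then have "x \<otimes> w = \<zero>" using v x w by (simp add: P_def)
    then show "x = \<zero>" using inj x by simp
  qed
  then obtain x where x: "x \<in> carrier R" "x \<otimes> (w \<otimes> v) = v" using min w(1) by blast
  define y where "y = e \<ominus> e \<otimes> (x \<otimes> w)"
  have y: "y \<in> carrier R" using ec x w by (simp add: y_def)
  have "y \<otimes> e = y" using ec x(1) w by (simp add: y_def minus_distr_l m_assoc)
  moreover have "y \<otimes> v = \<zero>"
  proof -
    have "e \<otimes> (x \<otimes> w) \<otimes> v = v" using ec x w vc by (simp add: m_assoc)
    then show ?thesis using ec x(1) w vc by (simp add: y_def minus_distr_l minus_eq_zero_iff)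
  qed
  ultimately have "y = \<zero>" using v y by (simp add: P_def)
  then have "e = e \<otimes> (x \<otimes> w)" unfolding y_def using ec(1) x(1) w(1) 
    by (metis m_closed minus_eq_zero_iff)
  then have "(e \<otimes> x) \<otimes> w = e" using ec x(1) w by (simp add: m_assoc)
  then show ?thesis using ec x(1) by (intro bexI[of _ "e \<otimes> x"]) auto
qed

text \<open>If neither summand is left invertible, both have nonzero kernels on \<open>R e\<close>.
  By uniformity the kernels meet, yet \<open>r \<oplus> s = e\<close> fixes every element of
  \<open>R e\<close>.\<close>

lemma uniform_imp_local:
  assumes u: "uniform_idem e"
  shows "local_idem e"
  unfolding local_idem_def
proof (intro ballI impI)
  fix r s assume rs: "r \<in> carrier R" "s \<in> carrier R"
    and h: "r \<otimes> e = r \<and> e \<otimes> r = r \<and> s \<otimes> e = s \<and> e \<otimes> s = s \<and> r \<oplus> s = e"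
  have e: "idem e" "e \<in> carrier R" using u by (auto simp: uniform_idem_def idem_def)
  show "(\<exists>c\<in>carrier R. c \<otimes> r = e) \<or> (\<exists>c\<in>carrier R. c \<otimes> s = e)"
  proof (rule ccontr)
    assume "\<not> ?thesis"
    then have nr: "\<not> (\<exists>c\<in>carrier R. c \<otimes> r = e)" and ns: "\<not> (\<exists>c\<in>carrier R. c \<otimes> s = e)" by auto
    obtain x where x: "x \<in> carrier R" "x \<otimes> e = x" "x \<otimes> r = \<zero>" "x \<noteq> \<zero>"
      using left_inverse_of_injective[OF e(1) rs(1)] h nr by blast
    obtain y where y: "y \<in> carrier R" "y \<otimes> e = y" "y \<otimes> s = \<zero>" "y \<noteq> \<zero>"
      using left_inverse_of_injective[OF e(1) rs(2)] h ns by blast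
    obtain a b where ab: "a \<in> carrier R" "b \<in> carrier R" "a \<otimes> x = b \<otimes> y" "a \<otimes> x \<noteq> \<zero>"
      using u x y unfolding uniform_idem_def by blast
    have "a \<otimes> x = (a \<otimes> x) \<otimes> (r \<oplus> s)" using h ab(1) x e by (simp add: m_assoc)
    also have "\<dots> = a \<otimes> (x \<otimes> r) \<oplus> b \<otimes> (y \<otimes> s)"
    proof -
      have "(a \<otimes> x) \<otimes> (r \<oplus> s) = (a \<otimes> x) \<otimes> r \<oplus> (b \<otimes> y) \<otimes> s"
        using ab(1,2) x(1) rs by (simp add: r_distr ab(3)[symmetric])
      then show ?thesis using ab(1,2) x(1) y(1) rs by (simp add: m_assoc)
    qed
    also have "\<dots> = \<zero>" using x y ab by simp
    finally show False using ab by simp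
  qed
qed

end

context left_dcc
begin

text \<open>Take a nonzero idempotent \<open>f\<close> of \<open>e R e\<close> with
  \<open>R f\<close> minimal. A nonzero idempotent \<open>g\<close> of \<open>f R f\<close> lies in
  \<open>R f\<close>, so \<open>f = s g\<close>, whence \<open>f = f g = g\<close>.\<close>

lemma primitive_below:
  assumes e: "idem e" "e \<noteq> \<zero>"
  shows "\<exists>f. primitive f \<and> e \<otimes> f = f \<and> f \<otimes> e = f"
proof -
  have ec: "e \<in> carrier R" "e \<otimes> e = e" using e by (auto simp: idem_def)
  define P where "P f \<longleftrightarrow> idem f \<and> f \<noteq> \<zero> \<and> e \<otimes> f = f \<and> f \<otimes> e = f" for f
  have "P e" using e by (simp add: P_def idem_def)
  moreover have "x \<in> carrier R" if "P x" for x using that by (simp add: P_def idem_def)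
  ultimately obtain f where f: "P f" and min: "\<forall>r\<in>carrier R. P (r \<otimes> f) \<longrightarrow> (\<exists>s\<in>carrier R. s \<otimes> (r \<otimes> f) = f)"
    by (rule dcc_minimal)
  have fc: "f \<in> carrier R" "f \<otimes> f = f" "e \<otimes> f = f" "f \<otimes> e = f" "idem f" "f \<noteq> \<zero>"
    using f by (auto simp: P_def idem_def)
  have "g = \<zero> \<or> g = f" if g: "idem g" "f \<otimes> g = g" "g \<otimes> f = g" for g
  proof (rule disjCI)
    assume "g \<noteq> f"
    have gc: "g \<in> carrier R" "g \<otimes> g = g" using g by (auto simp: idem_def)
    show "g = \<zero>"
    proof (rule ccontr)
      assume "g \<noteq> \<zero>"
      moreover have "e \<otimes> g = g" using m_assoc[OF ec(1) fc(1) gc(1)] fc g by simp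
      moreover have "g \<otimes> e = g" using m_assoc[OF gc(1) fc(1) ec(1)] fc g by simp
      ultimately have "P (g \<otimes> f)" using g by (simp add: P_def)
      then obtain s where s: "s \<in> carrier R" "s \<otimes> g = f" using min gc g by auto
      have "f \<otimes> g = s \<otimes> (g \<otimes> g)" using m_assoc[OF s(1) gc(1) gc(1)] s(2) by simp
      then show False using gc s g \<open>g \<noteq> f\<close> by simp
    qed
  qed
  then show ?thesis using fc unfolding primitive_def by blast
qed

text \<open>The minimum condition is applied to the idempotent \<open>e\<close> that remains after
  splitting off finitely many primitive ones. Splitting \<open>f\<close> off a nonzero remainder
  leaves \<open>e - f\<close> in \<open>R e\<close>, so minimality would give
  \<open>e = s (e - f)\<close> and thus \<open>f = e f = 0\<close>.\<close>

lemma primitive_decomposition: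
  obtains F where "finite F" "\<And>e. e \<in> F \<Longrightarrow> primitive e"
    "\<And>e f. \<lbrakk>e \<in> F; f \<in> F; e \<noteq> f\<rbrakk> \<Longrightarrow> e \<otimes> f = \<zero>" "finsum R (\<lambda>x. x) F = \<one>"
proof -
  define Q where "Q e F \<longleftrightarrow> finite F \<and> (\<forall>f\<in>F. primitive f \<and> e \<otimes> f = \<zero> \<and> f \<otimes> e = \<zero>) \<and>
      (\<forall>f\<in>F. \<forall>g\<in>F. f \<noteq> g \<longrightarrow> f \<otimes> g = \<zero>) \<and> e \<oplus> finsum R (\<lambda>x. x) F = \<one>" for e F
  define P where "P e \<longleftrightarrow> idem e \<and> (\<exists>F. Q e F)" for e
  have "Q \<one> {}" by (simp add: Q_def)
  then have "P \<one>" unfolding P_def by (auto simp: idem_def)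
  moreover have "x \<in> carrier R" if "P x" for x using that by (simp add: P_def idem_def)
  ultimately obtain e where e: "P e" and min: "\<forall>r\<in>carrier R. P (r \<otimes> e) \<longrightarrow> (\<exists>s\<in>carrier R. s \<otimes> (r \<otimes> e) = e)"
    by (rule dcc_minimal)
  have ec: "e \<in> carrier R" "e \<otimes> e = e" "idem e" using e by (auto simp: P_def idem_def)
  obtain F where F: "finite F" "\<And>f. f \<in> F \<Longrightarrow> primitive f" "\<And>f. f \<in> F \<Longrightarrow> e \<otimes> f = \<zero>"
    "\<And>f. f \<in> F \<Longrightarrow> f \<otimes> e = \<zero>" "\<And>f g. \<lbrakk>f \<in> F; g \<in> F; f \<noteq> g\<rbrakk> \<Longrightarrow> f \<otimes> g = \<zero>"
    "e \<oplus> finsum R (\<lambda>x. x) F = \<one>"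
    using e by (auto simp: P_def Q_def)
  have prim_c: "f \<in> carrier R" "f \<otimes> f = f" "f \<noteq> \<zero>" if "primitive f" for f
    using that by (auto simp: primitive_def idem_def)
  have "e = \<zero>"
  proof (rule ccontr)
    assume "e \<noteq> \<zero>"
    then obtain f where f: "primitive f" "e \<otimes> f = f" "f \<otimes> e = f" using primitive_below[OF ec(3)] by blast
    note fc = prim_c[OF f(1)]
    define h where "h = e \<ominus> f"
    have hc: "h \<in> carrier R" using ec fc by (simp add: h_def)
    have hf: "h \<otimes> f = \<zero>" "f \<otimes> h = \<zero>" using ec fc f
      by (simp_all add: h_def minus_distr_l minus_distr_r minus_eq_zero_iff)
    have he: "h \<otimes> e = h" using ec fc f by (simp add: h_def minus_distr_l)
    have hh: "h \<otimes> h = h"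
    proof -
      have "h \<otimes> h = h \<otimes> e \<ominus> h \<otimes> f" unfolding h_def using ec fc by (simp add: minus_distr_r)
      then show ?thesis using he hf hc by (simp add: a_minus_def)
    qed
    have hg: "h \<otimes> g = \<zero> \<and> g \<otimes> h = \<zero> \<and> f \<otimes> g = \<zero> \<and> g \<otimes> f = \<zero>" if g: "g \<in> F" for g
    proof -
      have gc: "g \<in> carrier R" using prim_c F(2) g by blast
      have fg: "f \<otimes> g = \<zero>" using m_assoc[OF fc(1) ec(1) gc] f F(3)[OF g] fc by simp
      have gf: "g \<otimes> f = \<zero>" using m_assoc[OF gc ec(1) fc(1)] f F(4)[OF g] fc by simp
      show ?thesis using fg gf F(3,4)[OF g] gc ec fc
        by (simp add: h_def minus_distr_l minus_distr_r minus_eq_zero_iff)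
    qed
    have fF: "f \<notin> F" using F(3)[of f] f fc by auto
    have FR: "F \<subseteq> carrier R" using F(2) prim_c by blast
    have "h \<oplus> finsum R (\<lambda>x. x) (insert f F) = h \<oplus> (f \<oplus> finsum R (\<lambda>x. x) F)"
      using fF F(1) fc FR by (subst finsum_insert) (auto simp: Pi_def)
    also have "\<dots> = (h \<oplus> f) \<oplus> finsum R (\<lambda>x. x) F"
      using hc fc FR by (subst a_assoc) (auto intro!: finsum_closed)
    also have "h \<oplus> f = e" unfolding h_def using ec fc by algebra
    also have "e \<oplus> finsum R (\<lambda>x. x) F = \<one>" by (rule F(6))
    finally have sum: "h \<oplus> finsum R (\<lambda>x. x) (insert f F) = \<one>" .
    have "Q h (insert f F)"
      unfolding Q_def using F(1,2,5) f(1) hg hf sum by auto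
    then have "P (h \<otimes> e)" unfolding P_def he idem_def using hc hh by auto
    then obtain s where s: "s \<in> carrier R" "s \<otimes> h = e" using min hc he by auto
    have "e \<otimes> f = s \<otimes> (h \<otimes> f)" using m_assoc[OF s(1) hc fc(1)] s(2) by simp
    then show False using hf s f fc by simp
  qed
  moreover have "F \<subseteq> carrier R" using F(2) prim_c by blast
  ultimately have "finsum R (\<lambda>x. x) F = \<one>" using F(6) by (simp add: finsum_closed Pi_def subset_iff)
  then show thesis using that F by blast
qed

end

section \<open>Locality of primitive idempotents, and the count of socles\<close>

text \<open>Both properties hold for a ring that is invariant under the automorphisms of its left injective hull.\<close>

locale left_dcc_hull = left_dcc +
  assumes uniform_if_second_copy: "\<lbrakk>primitive e; minimal_gen t; t \<otimes> e = t; t' \<in> carrier R;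
      left_ann t' = left_ann t; t' \<noteq> t\<rbrakk> \<Longrightarrow> uniform_idem e"
    and uniform_transfer: "\<lbrakk>uniform_idem e; uniform_idem f; minimal_gen t; t \<otimes> e = t; t' \<in> carrier R;
      t' \<otimes> f = t'; left_ann t' = left_ann t\<rbrakk> \<Longrightarrow> \<exists>c\<in>carrier R. e \<otimes> c = c \<and> c \<otimes> f = c \<and> t \<otimes> c = t'"
begin

text \<open>By Schur a nonzero \<open>t r\<close> has the annihilator of \<open>t\<close>, so a
  value other than \<open>t\<close> would be a second copy. This is the rigidity from which locality
  is derived in the non-uniform case.\<close>

lemma nonuniform_act:
  assumes "primitive e" "\<not> uniform_idem e" "minimal_gen t" "t \<otimes> e = t" "r \<in> carrier R"
  shows "t \<otimes> r = \<zero> \<or> t \<otimes> r = t"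
proof (rule ccontr)
  assume h: "\<not> ?thesis"
  have "left_ann (t \<otimes> r) = left_ann t" using left_ann_minimal_gen_eq h assms by blast
  moreover have "t \<otimes> r \<in> carrier R" using assms by (simp add: minimal_gen_def)
  ultimately show False using uniform_if_second_copy assms h by blast
qed

text \<open>A nonzero kernel would contain a minimal left ideal, so injectivity on
  \<open>R e\<close> can be tested on the socle.\<close>

lemma injective_on_minimal:
  assumes e: "e \<in> carrier R" and w: "w \<in> carrier R" "\<And>t. \<lbrakk>minimal_gen t; t \<otimes> e = t\<rbrakk> \<Longrightarrow> t \<otimes> w \<noteq> \<zero>"
    and x: "x \<in> carrier R" "x \<otimes> e = x" "x \<otimes> w = \<zero>"
  shows "x = \<zero>"
proof (rule ccontr)
  assume "x \<noteq> \<zero>"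
  then obtain r where r: "r \<in> carrier R" "minimal_gen (r \<otimes> x)" using minimal_gen_below x by blast
  moreover have "(r \<otimes> x) \<otimes> e = r \<otimes> x" "(r \<otimes> x) \<otimes> w = \<zero>" using r x e w by (simp_all add: m_assoc)
  ultimately show False using w by blast
qed

text \<open>
  Choose \<open>r\<close> such that \<open>d = r - r\<^sup>2\<close> generates a minimal principal left ideal. Passing to \<open>r\<^sup>2\<close>
  and to \<open>(e - r)\<^sup>2\<close> gives \<open>d = c d\<^sup>2\<close> for some \<open>c\<close>. Since \<open>d\<close> kills all minimal left ideals in \<open>R e\<close>,
  \<open>e - c d\<close> is left invertible in \<open>e R e\<close>, so \<open>d = 0\<close> and \<open>r\<close> is idempotent.
\<close>

lemma nonuniform_dichotomy:
  assumes e: "primitive e" "\<not> uniform_idem e"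
    and r: "r \<in> carrier R" "e \<otimes> r = r" "r \<otimes> e = r"
    and t1: "minimal_gen t1" "t1 \<otimes> e = t1" "t1 \<otimes> r \<noteq> \<zero>"
    and t2: "minimal_gen t2" "t2 \<otimes> e = t2" "t2 \<otimes> (e \<ominus> r) \<noteq> \<zero>"
  shows False
proof -
  have ec: "e \<in> carrier R" "e \<otimes> e = e" "idem e" using e by (auto simp: primitive_def idem_def)
  have mc: "t \<in> carrier R" "t \<noteq> \<zero>" if "minimal_gen t" for t using that by (auto simp: minimal_gen_def)
  have act: "t \<otimes> r = \<zero> \<or> t \<otimes> r = t" if "minimal_gen t" "t \<otimes> e = t" "r \<in> carrier R" for t r
    using nonuniform_act[OF e] that by blast
  \<comment> \<open>The counterexamples: elements of \<open>e R e\<close> that act as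
    \<open>1\<close> on one minimal left ideal of \<open>R e\<close> and as \<open>0\<close> on
    another. They are closed under squaring and under passing from \<open>r\<close> to
    \<open>e - r\<close>.\<close>
  define X where "X r \<longleftrightarrow> r \<in> carrier R \<and> e \<otimes> r = r \<and> r \<otimes> e = r \<and>
      (\<exists>t. minimal_gen t \<and> t \<otimes> e = t \<and> t \<otimes> r \<noteq> \<zero>) \<and>
      (\<exists>t. minimal_gen t \<and> t \<otimes> e = t \<and> t \<otimes> (e \<ominus> r) \<noteq> \<zero>)" for r
  define D where "D r = r \<ominus> r \<otimes> r" for r
  have X_sq: "X (r \<otimes> r)" if Xr: "X r" for r
  proof -
    have rc: "r \<in> carrier R" "e \<otimes> r = r" "r \<otimes> e = r" using that by (auto simp: X_def)
    obtain a where a: "minimal_gen a" "a \<otimes> e = a" "a \<otimes> r \<noteq> \<zero>" using Xr unfolding X_def by blast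
    obtain b where b: "minimal_gen b" "b \<otimes> e = b" "b \<otimes> (e \<ominus> r) \<noteq> \<zero>" using Xr unfolding X_def by blast
    have ar: "a \<otimes> r = a" using act[OF a(1,2) rc(1)] a by simp
    have "b \<otimes> r \<noteq> b" using b mc(1)[OF b(1)] rc ec by (auto simp: minus_distr_r minus_eq_zero_iff)
    then have br: "b \<otimes> r = \<zero>" using act[OF b(1,2) rc(1)] by simp
    have "a \<otimes> (r \<otimes> r) \<noteq> \<zero>" using ar mc[OF a(1)] rc by (simp flip: m_assoc)
    moreover have "b \<otimes> (e \<ominus> r \<otimes> r) \<noteq> \<zero>"
    proof -
      have "b \<otimes> (r \<otimes> r) = \<zero>" using br mc[OF b(1)] rc by (simp flip: m_assoc)
      then show ?thesis using mc[OF b(1)] b(2) rc ec by (simp add: minus_distr_r minus_eq_zero_iff)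
    qed
    moreover have "e \<otimes> (r \<otimes> r) = r \<otimes> r" using rc ec by (simp flip: m_assoc)
    moreover have "(r \<otimes> r) \<otimes> e = r \<otimes> r" using rc ec by (simp add: m_assoc)
    ultimately show ?thesis using rc a b unfolding X_def by blast
  qed
  have X_compl: "X (e \<ominus> r)" if "X r" for r
  proof -
    have rc: "r \<in> carrier R" "e \<otimes> r = r" "r \<otimes> e = r" using that by (auto simp: X_def)
    have "e \<ominus> (e \<ominus> r) = r" using ec(1) rc(1) by algebra
    moreover have "e \<otimes> (e \<ominus> r) = e \<ominus> r" "(e \<ominus> r) \<otimes> e = e \<ominus> r"
      using ec rc by (simp_all add: minus_distr_r minus_distr_l)
    ultimately show ?thesis using that ec rc unfolding X_def by auto
  qed
  define P where "P d \<longleftrightarrow> (\<exists>r. X r \<and> d = D r)" for d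
  have "X r" unfolding X_def using r t1 t2 by blast
  then have "P (D r)" by (auto simp: P_def)
  moreover have "x \<in> carrier R" if "P x" for x using that by (auto simp: P_def D_def X_def)
  ultimately obtain d where d: "P d" and min: "\<forall>r\<in>carrier R. P (r \<otimes> d) \<longrightarrow> (\<exists>s\<in>carrier R. s \<otimes> (r \<otimes> d) = d)"
    by (rule dcc_minimal)
  have key: "\<exists>y\<in>carrier R. y \<otimes> (d \<otimes> r) = d" if "X r" "D r = d" for r
  proof -
    have rc: "r \<in> carrier R" "e \<otimes> r = r" "r \<otimes> e = r" using that by (auto simp: X_def)
    define q where "q = r \<otimes> r"
    have qc: "q \<in> carrier R" using rc by (simp add: q_def)
    have rq: "q \<otimes> r = r \<otimes> q" using rc by (simp add: q_def m_assoc)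
    have qq: "r \<otimes> (r \<otimes> q) = q \<otimes> q" using rc qc by (simp add: q_def m_assoc)
    have eq: "e \<otimes> q = q" using rc ec by (simp add: q_def flip: m_assoc)
    have dq: "d = r \<ominus> q" using that by (simp add: D_def q_def)
    have rr: "r \<otimes> r = q" by (simp add: q_def)
    \<comment> \<open>\<open>r - r^2\<close> divides \<open>r^2 - r^4\<close>, which equals
      \<open>(r + r^2) d = (e + r) d r\<close>. As \<open>R d\<close> is minimal, \<open>d\<close>
      is recovered from this value and so lies in \<open>R d r\<close>.\<close>
    have 1: "D q = (r \<oplus> q) \<otimes> d"
    proof -
      have "(r \<oplus> q) \<otimes> d = (q \<ominus> r \<otimes> q) \<oplus> (r \<otimes> q \<ominus> q \<otimes> q)"
      proof -
        have "r \<otimes> d = q \<ominus> r \<otimes> q" "q \<otimes> d = r \<otimes> q \<ominus> q \<otimes> q"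
          unfolding dq using rc(1) qc rq rr by (simp_all add: minus_distr_r)
        moreover have "d \<in> carrier R" unfolding dq using rc qc by simp
        ultimately show ?thesis using rc(1) qc by (simp add: l_distr)
      qed
      also have "\<dots> = q \<ominus> q \<otimes> q" 
      proof -
        have "r \<otimes> q \<in> carrier R" "q \<otimes> q \<in> carrier R" using rc qc by auto
        then show ?thesis using qc by algebra
      qed
      finally show ?thesis by (simp add: D_def)
    qed
    have 2: "(r \<oplus> q) \<otimes> d = (e \<oplus> r) \<otimes> (d \<otimes> r)"
    proof -
      have "d \<otimes> r = r \<otimes> d" unfolding dq using rc(1) qc rq rr by (simp add: minus_distr_l minus_distr_r)
      moreover have "(e \<oplus> r) \<otimes> r = r \<oplus> q" using rc ec rr by (simp add: l_distr)
      moreover have "d \<in> carrier R" unfolding dq using rc qc by simp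
      ultimately show ?thesis using ec rc by (simp flip: m_assoc)
    qed
    have "X q" using X_sq that by (simp add: q_def)
    then have "P ((r \<oplus> q) \<otimes> d)" using 1 by (auto simp: P_def)
    then obtain s where s: "s \<in> carrier R" "s \<otimes> ((r \<oplus> q) \<otimes> d) = d" using min rc qc by auto
    have dc: "d \<in> carrier R" unfolding dq using rc qc by simp
    have "(s \<otimes> (e \<oplus> r)) \<otimes> (d \<otimes> r) = d" using s dc ec rc by (simp add: m_assoc 2)
    then show ?thesis using s ec rc by blast
  qed
  obtain r where r: "X r" "D r = d" using d by (auto simp: P_def)
  have rc: "r \<in> carrier R" "e \<otimes> r = r" "r \<otimes> e = r" using r by (auto simp: X_def)
  have rrc: "r \<otimes> r \<in> carrier R" using rc by simp
  \<comment> \<open>\<open>D\<close> has the same value at \<open>e - r\<close> as at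
    \<open>r\<close>, so the minimal \<open>d\<close> is also a left multiple of \<open>d s\<close>.
    Together with \<open>s r = d\<close> this gives \<open>y (z d s) r = d\<close>.\<close>
  define s where "s = e \<ominus> r"
  have sc: "s \<in> carrier R" using rc ec by (simp add: s_def)
  have sr: "s \<otimes> r = d" using rc ec r(2) by (simp add: s_def minus_distr_l D_def)
  have "D s = d"
  proof -
    have "s \<otimes> s = s \<ominus> d" unfolding s_def r(2)[symmetric] D_def using rc ec rrc
      by (simp add: minus_distr_l minus_distr_r)
    moreover have "d \<in> carrier R" using rc unfolding r(2)[symmetric] D_def by simp
    then have "s \<ominus> (s \<ominus> d) = d" using sc by algebra
    ultimately show ?thesis by (simp add: D_def)
  qed
  then obtain z where z: "z \<in> carrier R" "z \<otimes> (d \<otimes> s) = d" using key[of s] X_compl[OF r(1)] s_def by auto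
  obtain y where y: "y \<in> carrier R" "y \<otimes> (d \<otimes> r) = d" using key[OF r] by auto
  have dc: "d \<in> carrier R" using r rc by (auto simp: D_def)
  have ed: "e \<otimes> d = d" "d \<otimes> e = d"
  proof -
    have "e \<otimes> (r \<otimes> r) = r \<otimes> r" using rc ec by (simp flip: m_assoc)
    then show "e \<otimes> d = d" unfolding r(2)[symmetric] D_def using rc ec by (simp add: minus_distr_r)
    show "d \<otimes> e = d" unfolding r(2)[symmetric] D_def using rc ec by (simp add: minus_distr_l m_assoc)
  qed
  define c where "c = y \<otimes> z"
  have cc: "c \<in> carrier R" using y z by (simp add: c_def)
  have cdd: "c \<otimes> (d \<otimes> d) = d"
  proof -
    have "c \<otimes> (d \<otimes> d) = y \<otimes> ((z \<otimes> (d \<otimes> s)) \<otimes> r)"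
      using y(1) z(1) dc sc rc by (simp add: c_def m_assoc sr)
    then show ?thesis using y z by simp
  qed
  have td: "t \<otimes> d = \<zero>" if t: "minimal_gen t" "t \<otimes> e = t" for t
  proof -
    have "t \<otimes> d = t \<otimes> r \<ominus> (t \<otimes> r) \<otimes> r"
      unfolding r(2)[symmetric] D_def using mc[OF t(1)] rc by (simp add: minus_distr_r m_assoc)
    then show ?thesis using act[OF t rc(1)] mc[OF t(1)] rc by (auto simp: minus_eq_zero_iff)
  qed
  \<comment> \<open>The extra factor \<open>e\<close> puts \<open>w\<close> into
    \<open>e R e\<close>. Left invertibility contradicts \<open>d \<noteq> 0\<close> because
    \<open>w d = d - c d^2 = 0\<close>.\<close>
  define w where "w = e \<ominus> e \<otimes> (c \<otimes> d)"
  have wc: "w \<in> carrier R" "e \<otimes> w = w" "w \<otimes> e = w"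
  proof -
    show "w \<in> carrier R" using ec cc dc by (simp add: w_def)
    have "e \<otimes> (e \<otimes> (c \<otimes> d)) = e \<otimes> (c \<otimes> d)" using ec cc dc by (simp flip: m_assoc)
    then show "e \<otimes> w = w" using ec cc dc by (simp add: w_def minus_distr_r)
    show "w \<otimes> e = w" using ec cc dc ed by (simp add: w_def minus_distr_l m_assoc)
  qed
  have tw: "t \<otimes> w \<noteq> \<zero>" if t: "minimal_gen t" "t \<otimes> e = t" for t
  proof -
    have "t \<otimes> w = t \<otimes> e \<ominus> (t \<otimes> e) \<otimes> (c \<otimes> d)"
      using mc[OF t(1)] ec(1) cc dc by (simp add: w_def minus_distr_r m_assoc)
    also have "(t \<otimes> e) \<otimes> (c \<otimes> d) = (t \<otimes> c) \<otimes> d" using t mc[OF t(1)] cc dc by (simp add: m_assoc)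
    also have "\<dots> = \<zero>" using act[OF t cc] td[OF t] dc by auto
    finally show ?thesis using mc[OF t(1)] t by (simp add: minus_eq_zero_iff)
  qed
  obtain w' where w': "w' \<in> carrier R" "w' \<otimes> w = e"
    using left_inverse_of_injective[OF ec(3) wc] injective_on_minimal[OF ec(1) wc(1) tw] by blast
  have "w \<otimes> d = \<zero>"
    using ec cc dc ed cdd by (simp add: w_def minus_distr_l m_assoc minus_eq_zero_iff)
  then have "e \<otimes> d = \<zero>" using m_assoc[OF w'(1) wc(1) dc] w' by simp
  then have "d = \<zero>" using ed by simp
  then have "r \<otimes> r = r" using r(2) rc by (simp add: D_def minus_eq_zero_iff)
  then have "r = \<zero> \<or> r = e" using e(1) rc by (auto simp: primitive_def idem_def)
  then show False
  proof
    assume "r = \<zero>" then show False using r(1) mc(1) by (auto simp: X_def)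
  next
    assume "r = e" 
    then have "e \<ominus> r = \<zero>" using ec by (simp add: minus_eq_zero_iff)
    then show False using r(1) mc(1) by (auto simp: X_def)
  qed
qed

text \<open>In the non-uniform case: if \<open>r\<close> kills one minimal left ideal of
  \<open>R e\<close>, the dichotomy makes it kill all of them, so \<open>s = e - r\<close> is
  injective on the socle; otherwise \<open>r\<close> is. Injectivity yields the left
  inverse.\<close>

lemma primitive_imp_local:
  assumes e: "primitive e"
  shows "local_idem e"
proof (cases "uniform_idem e")
  case True
  then show ?thesis by (rule uniform_imp_local)
next
  case False
  have ec: "e \<in> carrier R" "e \<otimes> e = e" "idem e" using e by (auto simp: primitive_def idem_def)
  show ?thesis
    unfolding local_idem_def
  proof (intro ballI impI)
    fix r s assume rs: "r \<in> carrier R" "s \<in> carrier R"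
      and h: "r \<otimes> e = r \<and> e \<otimes> r = r \<and> s \<otimes> e = s \<and> e \<otimes> s = s \<and> r \<oplus> s = e"
    have s: "s = e \<ominus> r"
    proof -
      have "e \<ominus> r = (r \<oplus> s) \<ominus> r" using h by simp
      also have "\<dots> = s" using rs by algebra
      finally show ?thesis by simp
    qed
    show "(\<exists>c\<in>carrier R. c \<otimes> r = e) \<or> (\<exists>c\<in>carrier R. c \<otimes> s = e)"
    proof (cases "\<exists>t. minimal_gen t \<and> t \<otimes> e = t \<and> t \<otimes> r = \<zero>")
      case False
      then have "\<exists>c\<in>carrier R. c \<otimes> r = e"
        using left_inverse_of_injective[OF ec(3) rs(1)] injective_on_minimal[OF ec(1) rs(1)] h by blast
      then show ?thesis ..
    next
      case True
      then obtain t where t: "minimal_gen t" "t \<otimes> e = t" "t \<otimes> r = \<zero>" by blast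
      have tc: "t \<in> carrier R" "t \<noteq> \<zero>" using t by (auto simp: minimal_gen_def)
      have ts: "t \<otimes> (e \<ominus> r) \<noteq> \<zero>" using t tc ec rs by (simp add: minus_distr_r minus_eq_zero_iff)
      have "t' \<otimes> s \<noteq> \<zero>" if t': "minimal_gen t'" "t' \<otimes> e = t'" for t'
      proof
        assume "t' \<otimes> s = \<zero>"
        have tc: "t' \<in> carrier R" "t' \<noteq> \<zero>" using t' by (auto simp: minimal_gen_def)
        have "t' \<otimes> r = t' \<otimes> e"
          using \<open>t' \<otimes> s = \<zero>\<close> tc ec rs t' by (simp add: s minus_distr_r minus_eq_zero_iff)
        then have "t' \<otimes> r \<noteq> \<zero>" using tc t' by simp
        then show False using nonuniform_dichotomy[OF e \<open>\<not> uniform_idem e\<close> rs(1)] h t' t ts by blast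
      qed
      then have "\<exists>c\<in>carrier R. c \<otimes> s = e"
        using left_inverse_of_injective[OF ec(3) rs(2)] injective_on_minimal[OF ec(1) rs(2)] h by blast
      then show ?thesis ..
    qed
  qed
qed

text \<open>For \<open>e \<noteq> f\<close>, isomorphic minimal left ideals in the two summands are
  second copies of each other, so both summands are uniform. The isomorphism then extends to maps
  \<open>R e \<rightarrow> R f\<close> and back. Both are injective, their composite on
  \<open>R e\<close> is onto, and every nonzero map out of \<open>R e\<close> therefore yields one
  out of \<open>R f\<close>.\<close>

lemma sim_top_cong:
  assumes e: "primitive e" "minimal_gen te" "te \<otimes> e = te"
    and f: "primitive f" "minimal_gen tf" "tf \<otimes> f = tf"
    and ef: "e \<noteq> f \<Longrightarrow> e \<otimes> f = \<zero>" "e \<noteq> f \<Longrightarrow> f \<otimes> e = \<zero>"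
    and sim: "sim te tf"
    and t: "t \<in> carrier R" "a \<in> carrier R" "e \<otimes> (a \<otimes> t) \<noteq> \<zero>"
  shows "\<exists>b\<in>carrier R. f \<otimes> (b \<otimes> t) \<noteq> \<zero>"
proof (cases "e = f")
  case True
  then show ?thesis using t by blast
next
  case False
  have ec: "e \<in> carrier R" "e \<otimes> e = e" "idem e" "f \<in> carrier R" "f \<otimes> f = f" "idem f"
    using e f by (auto simp: primitive_def idem_def)
  have tc: "te \<in> carrier R" "te \<noteq> \<zero>" "tf \<in> carrier R" "tf \<noteq> \<zero>"
    using e f by (auto simp: minimal_gen_def)
  \<comment> \<open>Otherwise \<open>te\<close> is the only element with its annihilator, so it lies
    in \<open>R tf\<close>, hence in \<open>R f\<close>, and is killed by \<open>e\<close>.\<close>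
  have uni: "uniform_idem e"
    if e: "primitive e" "minimal_gen te" "te \<otimes> e = te" and f: "f \<in> carrier R" "f \<otimes> e = \<zero>"
      and tf: "tf \<in> carrier R" "tf \<otimes> f = tf" and sim: "sim te tf" for e te f tf
  proof (rule ccontr)
    assume nu: "\<not> uniform_idem e"
    obtain r where r: "r \<in> carrier R" "left_ann (r \<otimes> tf) = left_ann te"
      using sim by (auto simp: sim_def)
    have c: "e \<in> carrier R" "te \<in> carrier R" "te \<noteq> \<zero>"
      using e by (auto simp: primitive_def idem_def minimal_gen_def)
    have "r \<otimes> tf = te"
      using uniform_if_second_copy[OF e _ r(2)] nu r(1) tf by auto
    moreover have "(r \<otimes> tf) \<otimes> e = r \<otimes> (tf \<otimes> f \<otimes> e)" using r tf f c by (simp add: m_assoc)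
    moreover have "\<dots> = \<zero>" using m_assoc[OF tf(1) f(1) c(1)] r tf f by simp
    ultimately show False using e c by simp
  qed
  have eu: "uniform_idem e" using uni[OF e ec(4) ef(2)[OF False] tc(3) f(3) sim] .
  have sim': "sim tf te" using sim_sym[OF sim] e f by blast
  have fu: "uniform_idem f" using uni[OF f ec(1) ef(1)[OF False] tc(1) e(3) sim'] .
  have ex: "\<exists>c\<in>carrier R. e \<otimes> c = c \<and> c \<otimes> f = c \<and> (\<forall>x\<in>carrier R. x \<otimes> e = x \<and> x \<otimes> c = \<zero> \<longrightarrow> x = \<zero>)"
    if eu: "uniform_idem e" and fu: "uniform_idem f" and e: "minimal_gen te" "te \<otimes> e = te"
      and tf: "tf \<in> carrier R" "tf \<otimes> f = tf" and sim: "sim te tf" for e te f tf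
  proof -
    have ec: "e \<in> carrier R" "f \<in> carrier R" using eu fu by (auto simp: uniform_idem_def idem_def)
    have tc: "te \<in> carrier R" "te \<noteq> \<zero>" using e by (auto simp: minimal_gen_def)
    obtain r where r: "r \<in> carrier R" "left_ann (r \<otimes> tf) = left_ann te"
      using sim by (auto simp: sim_def)
    have rt: "r \<otimes> tf \<in> carrier R" "(r \<otimes> tf) \<otimes> f = r \<otimes> tf" using r tf ec by (simp_all add: m_assoc)
    obtain c where c: "c \<in> carrier R" "e \<otimes> c = c" "c \<otimes> f = c" "te \<otimes> c = r \<otimes> tf"
      using uniform_transfer[OF eu fu e rt r(2)] by blast
    have nz: "r \<otimes> tf \<noteq> \<zero>" using left_ann_eq_zero[OF r(2)] rt tc by simp
    \<comment> \<open>By uniformity and simplicity a nonzero kernel element has \<open>te\<close> as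
      a multiple, but \<open>te\<close> is sent to the nonzero element \<open>r tf\<close>.\<close>
    have "x = \<zero>" if x: "x \<in> carrier R" "x \<otimes> e = x" "x \<otimes> c = \<zero>" for x
    proof (rule ccontr)
      assume "x \<noteq> \<zero>"
      then obtain p q where p: "p \<in> carrier R" "q \<in> carrier R" "p \<otimes> x = q \<otimes> te" "p \<otimes> x \<noteq> \<zero>"
        using eu x tc e unfolding uniform_idem_def by blast
      then obtain s where s: "s \<in> carrier R" "s \<otimes> (q \<otimes> te) = te"
        using e(1) unfolding minimal_gen_def by metis
      have "te \<otimes> c = s \<otimes> (q \<otimes> te) \<otimes> c" using s by simp
      also have "\<dots> = s \<otimes> (p \<otimes> x) \<otimes> c" using p by simp
      also have "\<dots> = s \<otimes> (p \<otimes> (x \<otimes> c))" using s(1) p(1) x(1) c(1) by (simp add: m_assoc)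
      also have "\<dots> = \<zero>" using x s p by simp
      finally show False using c nz by simp
    qed
    then show ?thesis using c by blast
  qed
  obtain c where c: "c \<in> carrier R" "e \<otimes> c = c" "c \<otimes> f = c"
      "\<And>x. \<lbrakk>x \<in> carrier R; x \<otimes> e = x; x \<otimes> c = \<zero>\<rbrakk> \<Longrightarrow> x = \<zero>"
    using ex[OF eu fu e(2,3) tc(3) f(3) sim] by blast
  obtain d where d: "d \<in> carrier R" "f \<otimes> d = d" "d \<otimes> e = d"
      "\<And>x. \<lbrakk>x \<in> carrier R; x \<otimes> f = x; x \<otimes> d = \<zero>\<rbrakk> \<Longrightarrow> x = \<zero>"
    using ex[OF fu eu f(2,3) tc(1) e(3) sim'] by blast
  have "\<exists>w\<in>carrier R. w \<otimes> (c \<otimes> d) = e"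
  proof (rule left_inverse_of_injective[OF ec(3)])
    show "c \<otimes> d \<in> carrier R" using c d by simp
    show "e \<otimes> (c \<otimes> d) = c \<otimes> d" using c d ec by (simp flip: m_assoc)
    show "c \<otimes> d \<otimes> e = c \<otimes> d" using c d ec by (simp add: m_assoc)
    fix x assume x: "x \<in> carrier R" "x \<otimes> e = x" "x \<otimes> (c \<otimes> d) = \<zero>"
    then have "(x \<otimes> c) \<otimes> d = \<zero>" "(x \<otimes> c) \<otimes> f = x \<otimes> c" using c d ec by (simp_all add: m_assoc)
    then show "x = \<zero>" using c d x by simp
  qed
  then obtain w where w: "w \<in> carrier R" "w \<otimes> (c \<otimes> d) = e" by blast
  have "e \<otimes> (a \<otimes> t) = (w \<otimes> (c \<otimes> d)) \<otimes> (a \<otimes> t)" using w by simp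
  also have "\<dots> = w \<otimes> (c \<otimes> (d \<otimes> (a \<otimes> t)))" using w(1) c(1) d(1) t by (simp add: m_assoc)
  finally have "d \<otimes> (a \<otimes> t) \<noteq> \<zero>" using t w c by auto
  moreover have "f \<otimes> ((d \<otimes> a) \<otimes> t) = d \<otimes> (a \<otimes> t)"
  proof -
    have "f \<otimes> ((d \<otimes> a) \<otimes> t) = (f \<otimes> d) \<otimes> (a \<otimes> t)" using ec d(1) t by (simp add: m_assoc)
    then show ?thesis using d by simp
  qed
  ultimately show ?thesis using d t by (intro bexI[of _ "d \<otimes> a"]) auto
qed

lemma finsum_one_nonzero_component:
  assumes F: "finite F" "F \<subseteq> carrier R" "finsum R (\<lambda>x. x) F = \<one>" and t: "t \<in> carrier R" "t \<noteq> \<zero>"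
  shows "\<exists>e\<in>F. e \<otimes> t \<noteq> \<zero>"
proof (rule ccontr)
  assume "\<not> ?thesis"
  then have z: "\<And>e. e \<in> F \<Longrightarrow> e \<otimes> t = \<zero>" by blast
  have "finsum R (\<lambda>x. x) F \<otimes> t = finsum R (\<lambda>x. x \<otimes> t) F"
    using F t by (intro finsum_ldistr) auto
  also have "\<dots> = finsum R (\<lambda>x. \<zero>) F" using z by (intro finsum_cong') auto
  finally show False using F t by simp
qed

text \<open>The count is needed to show that every minimal left ideal is isomorphic to some
  \<open>R (T f)\<close>. One inside a non-uniform \<open>R e\<close> has no second copy, so it is
  contained in \<open>R (T f)\<close> itself; orthogonality forces \<open>f = e\<close>. Hence
  \<open>R (T e)\<close> is the only minimal left ideal of \<open>R e\<close>, and
  \<open>R e\<close> is uniform after all.\<close>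

theorem one_finsum_uniform_idems:
  obtains F where "finite F" "\<And>e. e \<in> F \<Longrightarrow> uniform_idem e" "finsum R (\<lambda>x. x) F = \<one>"
proof -
  obtain F where F: "finite F" "\<And>e. e \<in> F \<Longrightarrow> primitive e"
    "\<And>e f. \<lbrakk>e \<in> F; f \<in> F; e \<noteq> f\<rbrakk> \<Longrightarrow> e \<otimes> f = \<zero>" "finsum R (\<lambda>x. x) F = \<one>"
    by (rule primitive_decomposition) blast
  have Fc: "e \<in> carrier R" "e \<otimes> e = e" "e \<noteq> \<zero>" "idem e" if "e \<in> F" for e
    using F(2)[OF that] by (auto simp: primitive_def idem_def)
  have "\<forall>e\<in>F. \<exists>t. minimal_gen t \<and> t \<otimes> e = t"
  proof
    fix e assume e: "e \<in> F"
    obtain r where "r \<in> carrier R" "minimal_gen (r \<otimes> e)"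
      using minimal_gen_below[OF Fc(1)[OF e] Fc(3)[OF e]] by blast
    moreover have "(r \<otimes> e) \<otimes> e = r \<otimes> e" using Fc[OF e] calculation by (simp add: m_assoc)
    ultimately show "\<exists>t. minimal_gen t \<and> t \<otimes> e = t" by blast
  qed
  then obtain T where T: "\<And>e. e \<in> F \<Longrightarrow> minimal_gen (T e)" "\<And>e. e \<in> F \<Longrightarrow> T e \<otimes> e = T e"
    by metis
  have mc: "t \<in> carrier R" "t \<noteq> \<zero>" if "minimal_gen t" for t using that by (auto simp: minimal_gen_def)
  have FR: "F \<subseteq> carrier R" using Fc(1) by blast
  \<comment> \<open>Since the summands add up to \<open>\<one>\<close>, some \<open>e\<close> has
    \<open>e t \<noteq> 0\<close>; right multiplication by \<open>t\<close> then maps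
    \<open>R e\<close> onto \<open>R t\<close>.\<close>
  define top where "top t = (SOME e. e \<in> F \<and> e \<otimes> t \<noteq> \<zero>)" for t
  have top': "top t \<in> F \<and> top t \<otimes> t \<noteq> \<zero>" if "minimal_gen t" for t
    unfolding top_def by (rule someI_ex) (use finsum_one_nonzero_component[OF F(1) FR F(4)] mc that in blast)
  then have top: "\<And>t. minimal_gen t \<Longrightarrow> top t \<in> F" "\<And>t. minimal_gen t \<Longrightarrow> top t \<otimes> t \<noteq> \<zero>"
    by blast+
  define cls where "cls t = {s. minimal_gen s \<and> sim t s}" for t
  have cls_eq: "cls s = cls t \<longleftrightarrow> sim s t" if "minimal_gen s" "minimal_gen t" for s t
  proof
    assume "cls s = cls t"
    moreover have "t \<in> cls t" using that mc sim_refl by (auto simp: cls_def)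
    ultimately have "t \<in> cls s" by simp
    then show "sim s t" by (simp add: cls_def)
  next
    assume st: "sim s t"
    then have ts: "sim t s" using sim_sym that by blast
    show "cls s = cls t" 
      unfolding cls_def using sim_trans[OF st] sim_trans[OF ts] that mc by blast
  qed
  \<comment> \<open>If the socle pieces agree, \<open>top t\<close> covers \<open>s\<close> as well
    as \<open>t\<close>, and a local summand has only one simple quotient up to isomorphism.\<close>
  have inj: "sim s t" if st: "minimal_gen s" "minimal_gen t" and eq: "cls (T (top s)) = cls (T (top t))" for s t
  proof -
    have sim: "sim (T (top s)) (T (top t))"
      using eq cls_eq T(1)[OF top(1)] st by blast
    note F1 = top(1)[OF st(1)] and F2 = top(1)[OF st(2)]
    have 1: "top s \<otimes> (\<one> \<otimes> s) \<noteq> \<zero>" using top(2)[OF st(1)] mc[OF st(1)] by simp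
    have "\<exists>b\<in>carrier R. top t \<otimes> (b \<otimes> s) \<noteq> \<zero>"
      by (rule sim_top_cong[OF F(2)[OF F1] T[OF F1] F(2)[OF F2] T[OF F2] F(3)[OF F1 F2] F(3)[OF F2 F1]
            sim mc(1)[OF st(1)] one_closed 1]) simp_all
    then obtain b where b: "b \<in> carrier R" "top t \<otimes> (b \<otimes> s) \<noteq> \<zero>" by blast
    have "top t \<otimes> (\<one> \<otimes> t) \<noteq> \<zero>" using top(2)[OF st(2)] mc[OF st(2)] by simp
    then show ?thesis
      by (rule local_idem_minimal_sim[OF Fc(4)[OF F2] primitive_imp_local[OF F(2)[OF F2]] st b one_closed])
  qed
  define Q where "Q = (cls \<circ> T) ` F"
  define A where "A = cls ` Collect minimal_gen"
  have QA: "Q \<subseteq> A" using T by (auto simp: Q_def A_def)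
  define rep where "rep c = (SOME t. minimal_gen t \<and> cls t = c)" for c
  have rep: "minimal_gen (rep c) \<and> cls (rep c) = c" if "c \<in> A" for c
    unfolding rep_def by (rule someI_ex) (use that in \<open>auto simp: A_def\<close>)
  txt \<open>Mapping a minimal left ideal to the socle of a summand covering it is injective on isomorphism classes, so by counting
    every class occurs as such a socle.\<close>
  have "inj_on (\<lambda>c. cls (T (top (rep c)))) A"
    by (rule inj_onI) (metis inj cls_eq rep)
  moreover have "(\<lambda>c. cls (T (top (rep c)))) ` A \<subseteq> Q" using rep top by (auto simp: Q_def)
  moreover have "finite Q" using F by (simp add: Q_def)
  ultimately have "finite A" "card A \<le> card Q" by (auto intro: inj_on_finite card_inj_on_le)
  then have "Q = A" using QA by (simp add: card_seteq)
  have all: "\<exists>e\<in>F. sim t (T e)" if t: "minimal_gen t" for t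
  proof -
    have "cls t \<in> Q" using t \<open>Q = A\<close> by (simp add: A_def)
    then obtain e where "e \<in> F" "cls t = cls (T e)" by (auto simp: Q_def)
    then show ?thesis using cls_eq t T by blast
  qed
  have "uniform_idem e" if e: "e \<in> F" for e
  proof (rule ccontr)
    assume nu: "\<not> uniform_idem e"
    have mult: "\<exists>r\<in>carrier R. t = r \<otimes> T e" if t: "minimal_gen t" "t \<otimes> e = t" for t
    proof -
      obtain f where f: "f \<in> F" "sim t (T f)" using all t by blast
      then obtain r where r: "r \<in> carrier R" "left_ann (r \<otimes> T f) = left_ann t" by (auto simp: sim_def)
      have Tf: "T f \<in> carrier R" using T f mc by blast
      have rt: "r \<otimes> T f = t"
        using uniform_if_second_copy[OF F(2)[OF e] t _ r(2)] nu r(1) Tf by auto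
      have "f = e"
      proof (rule ccontr)
        assume "f \<noteq> e"
        then have fe: "f \<otimes> e = \<zero>" using F(3) e f by blast
        have "t \<otimes> e = (r \<otimes> (T f \<otimes> f)) \<otimes> e" using rt T f by simp
        also have "\<dots> = r \<otimes> (T f \<otimes> (f \<otimes> e))" using r(1) Tf Fc e f(1) by (simp add: m_assoc)
        also have "\<dots> = \<zero>" using fe r Tf by simp
        finally show False using t mc by simp
      qed
      then show ?thesis using rt r by blast
    qed
    have "\<exists>r\<in>carrier R. \<exists>s\<in>carrier R. r \<otimes> x = s \<otimes> y \<and> r \<otimes> x \<noteq> \<zero>"
      if x: "x \<in> carrier R" "x \<otimes> e = x" "x \<noteq> \<zero>" and y: "y \<in> carrier R" "y \<otimes> e = y" "y \<noteq> \<zero>" for x y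
    proof -
      have reach: "\<exists>r\<in>carrier R. r \<otimes> x = T e" if x: "x \<in> carrier R" "x \<otimes> e = x" "x \<noteq> \<zero>" for x
      proof -
        obtain p where p: "p \<in> carrier R" "minimal_gen (p \<otimes> x)" using minimal_gen_below x by blast
        moreover have "(p \<otimes> x) \<otimes> e = p \<otimes> x" using p(1) x(1,2) Fc(1)[OF e] by (simp add: m_assoc)
        ultimately obtain r where r: "r \<in> carrier R" "p \<otimes> x = r \<otimes> T e" using mult by blast
        then have "r \<otimes> T e \<noteq> \<zero>" using mc(2)[OF p(2)] by simp
        then obtain s where s: "s \<in> carrier R" "s \<otimes> (r \<otimes> T e) = T e"
          using T(1)[OF e] r unfolding minimal_gen_def by blast
        then have "(s \<otimes> p) \<otimes> x = T e" using p r x by (simp add: m_assoc)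
        then show ?thesis using s p by blast
      qed
      obtain r where r: "r \<in> carrier R" "r \<otimes> x = T e" using reach x by blast
      obtain s where s: "s \<in> carrier R" "s \<otimes> y = T e" using reach y by blast
      have "T e \<noteq> \<zero>" using T e mc by blast
      then show ?thesis using r s by (intro bexI[of _ r] bexI[of _ s]) auto
    qed
    then have "uniform_idem e" unfolding uniform_idem_def using Fc(4)[OF e] by blast
    then show False using nu by simp
  qed
  then show thesis using that F by blast
qed

end

section \<open>Quasi-injective modules\<close>

context left_module
begin

section \<open>Arithmetic in modules, submodules and homomorphisms\<close>

lemma smult_l_null [simp]: "x \<in> carrier M \<Longrightarrow> \<zero> \<odot>\<^bsub>M\<^esub> x = \<zero>\<^bsub>M\<^esub>"
  by (metis M.add.l_cancel_one R.add.l_one R.zero_closed smult_closed smult_l_distr)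

lemma smult_r_null [simp]: "a \<in> carrier R \<Longrightarrow> a \<odot>\<^bsub>M\<^esub> \<zero>\<^bsub>M\<^esub> = \<zero>\<^bsub>M\<^esub>"
  by (metis M.add.l_cancel_one M.add.l_one M.zero_closed smult_closed smult_r_distr)

lemma smult_l_minus: "\<lbrakk>a \<in> carrier R; x \<in> carrier M\<rbrakk> \<Longrightarrow> (\<ominus> a) \<odot>\<^bsub>M\<^esub> x = \<ominus>\<^bsub>M\<^esub> (a \<odot>\<^bsub>M\<^esub> x)"
  by (metis M.minus_equality R.add.inv_closed R.l_neg smult_closed smult_l_distr smult_l_null)

lemma smult_r_minus: "\<lbrakk>a \<in> carrier R; x \<in> carrier M\<rbrakk> \<Longrightarrow> a \<odot>\<^bsub>M\<^esub> (\<ominus>\<^bsub>M\<^esub> x) = \<ominus>\<^bsub>M\<^esub> (a \<odot>\<^bsub>M\<^esub> x)"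
  by (metis M.minus_equality M.a_inv_closed M.l_neg smult_closed smult_r_distr smult_r_null)

lemma minus_eq_smult: "x \<in> carrier M \<Longrightarrow> \<ominus>\<^bsub>M\<^esub> x = (\<ominus> \<one>) \<odot>\<^bsub>M\<^esub> x"
  by (simp add: smult_l_minus)

lemma smult_l_diff: "\<lbrakk>a \<in> carrier R; b \<in> carrier R; x \<in> carrier M\<rbrakk> \<Longrightarrow>
    (a \<ominus> b) \<odot>\<^bsub>M\<^esub> x = a \<odot>\<^bsub>M\<^esub> x \<ominus>\<^bsub>M\<^esub> b \<odot>\<^bsub>M\<^esub> x"
  by (simp add: a_minus_def smult_l_distr smult_l_minus)

lemma module_minus_eq_zero_iff:
  "\<lbrakk>a \<in> carrier M; b \<in> carrier M\<rbrakk> \<Longrightarrow> a \<ominus>\<^bsub>M\<^esub> b = \<zero>\<^bsub>M\<^esub> \<longleftrightarrow> a = b"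
  by (metis M.a_inv_closed M.minus_equality M.minus_minus M.r_neg a_minus_def)

text \<open>Rewriting modulo associativity and commutativity sorts the summands and can leave a term
  between \<open>x\<close> and its negative; these rules cancel across it.\<close>

lemma neg_cancel:
  assumes "x \<in> carrier M" "y \<in> carrier M" "z \<in> carrier M"
  shows "x \<oplus>\<^bsub>M\<^esub> (y \<oplus>\<^bsub>M\<^esub> (\<ominus>\<^bsub>M\<^esub> x \<oplus>\<^bsub>M\<^esub> z)) = y \<oplus>\<^bsub>M\<^esub> z" "x \<oplus>\<^bsub>M\<^esub> (y \<oplus>\<^bsub>M\<^esub> \<ominus>\<^bsub>M\<^esub> x) = y"
    "\<ominus>\<^bsub>M\<^esub> x \<oplus>\<^bsub>M\<^esub> (y \<oplus>\<^bsub>M\<^esub> (x \<oplus>\<^bsub>M\<^esub> z)) = y \<oplus>\<^bsub>M\<^esub> z" "\<ominus>\<^bsub>M\<^esub> x \<oplus>\<^bsub>M\<^esub> (y \<oplus>\<^bsub>M\<^esub> x) = y"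
  using assms M.a_lcomm[of x y] M.a_lcomm[of "\<ominus>\<^bsub>M\<^esub> x" y]
  by (simp_all add: M.r_neg1 M.r_neg2 M.r_neg M.l_neg)

lemmas abelian_simps = neg_cancel M.a_assoc M.a_comm M.a_lcomm M.l_neg M.r_neg M.r_neg1 M.r_neg2 M.minus_add
  M.minus_minus M.minus_eq

text \<open>Closure under negatives comes from the action of
  \<open>\<ominus> \<one>\<close>.\<close>

lemma submodule_iff: "submodule N R M \<longleftrightarrow> N \<subseteq> carrier M \<and> \<zero>\<^bsub>M\<^esub> \<in> N \<and>
    (\<forall>x\<in>N. \<forall>y\<in>N. x \<oplus>\<^bsub>M\<^esub> y \<in> N) \<and> (\<forall>a\<in>carrier R. \<forall>x\<in>N. a \<odot>\<^bsub>M\<^esub> x \<in> N)"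
  (is "_ \<longleftrightarrow> ?r")
proof
  assume "submodule N R M"
  then interpret submodule N R M .
  show ?r using subset one_closed m_closed smult_closed by auto
next
  assume r: ?r
  have "subgroup N (add_monoid M)"
  proof
    fix x assume x: "x \<in> N"
    then have "\<ominus>\<^bsub>M\<^esub> x \<in> N" using r minus_eq_smult by auto
    then show "inv\<^bsub>add_monoid M\<^esub> x \<in> N" by (simp add: a_inv_def)
  qed (use r in auto)
  then show "submodule N R M" using r by (simp add: submodule_def submodule_axioms_def)
qed

lemma submoduleD:
  assumes "submodule N R M"
  shows "N \<subseteq> carrier M" "x \<in> N \<Longrightarrow> x \<in> carrier M" "\<zero>\<^bsub>M\<^esub> \<in> N" "\<lbrakk>x \<in> N; y \<in> N\<rbrakk> \<Longrightarrow> x \<oplus>\<^bsub>M\<^esub> y \<in> N"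
    "\<lbrakk>a \<in> carrier R; x \<in> N\<rbrakk> \<Longrightarrow> a \<odot>\<^bsub>M\<^esub> x \<in> N" "x \<in> N \<Longrightarrow> \<ominus>\<^bsub>M\<^esub> x \<in> N"
    "\<lbrakk>x \<in> N; y \<in> N\<rbrakk> \<Longrightarrow> x \<ominus>\<^bsub>M\<^esub> y \<in> N"
proof -
  show *: "N \<subseteq> carrier M" "x \<in> N \<Longrightarrow> x \<in> carrier M" "\<zero>\<^bsub>M\<^esub> \<in> N"
    "\<And>x y. \<lbrakk>x \<in> N; y \<in> N\<rbrakk> \<Longrightarrow> x \<oplus>\<^bsub>M\<^esub> y \<in> N" "\<lbrakk>a \<in> carrier R; x \<in> N\<rbrakk> \<Longrightarrow> a \<odot>\<^bsub>M\<^esub> x \<in> N"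
    using assms unfolding submodule_iff by auto
  show **: "\<And>x. x \<in> N \<Longrightarrow> \<ominus>\<^bsub>M\<^esub> x \<in> N" using assms minus_eq_smult unfolding submodule_iff by auto
  show "\<lbrakk>x \<in> N; y \<in> N\<rbrakk> \<Longrightarrow> x \<ominus>\<^bsub>M\<^esub> y \<in> N" unfolding a_minus_def using *(4) ** by blast
qed

lemma submodule_cyclic: "x \<in> carrier M \<Longrightarrow> submodule {r \<odot>\<^bsub>M\<^esub> x | r. r \<in> carrier R} R M"
  unfolding submodule_iff
proof (intro conjI ballI)
  assume x: "x \<in> carrier M"
  show "{r \<odot>\<^bsub>M\<^esub> x | r. r \<in> carrier R} \<subseteq> carrier M" using x by auto
  show "\<zero>\<^bsub>M\<^esub> \<in> {r \<odot>\<^bsub>M\<^esub> x | r. r \<in> carrier R}" using x by (auto intro!: exI[of _ \<zero>])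
  fix y assume "y \<in> {r \<odot>\<^bsub>M\<^esub> x | r. r \<in> carrier R}"
  then obtain r where r: "r \<in> carrier R" "y = r \<odot>\<^bsub>M\<^esub> x" by auto
  {
    fix z assume "z \<in> {r \<odot>\<^bsub>M\<^esub> x | r. r \<in> carrier R}"
    then obtain s where s: "s \<in> carrier R" "z = s \<odot>\<^bsub>M\<^esub> x" by auto
    show "y \<oplus>\<^bsub>M\<^esub> z \<in> {r \<odot>\<^bsub>M\<^esub> x | r. r \<in> carrier R}"
      using r s x by (auto simp: smult_l_distr intro!: exI[of _ "r \<oplus> s"])
  next
    fix a assume "a \<in> carrier R"
    then show "a \<odot>\<^bsub>M\<^esub> y \<in> {r \<odot>\<^bsub>M\<^esub> x | r. r \<in> carrier R}"
      using r x by (auto simp: smult_assoc1 intro!: exI[of _ "a \<otimes> r"])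
  }
qed

lemma submodule_add:
  assumes A: "submodule A R M" and B: "submodule B R M"
  shows "submodule {a \<oplus>\<^bsub>M\<^esub> b | a b. a \<in> A \<and> b \<in> B} R M" (is "submodule ?S R M")
  unfolding submodule_iff
proof (intro conjI ballI)
  show "?S \<subseteq> carrier M" using submoduleD(2)[OF A] submoduleD(2)[OF B] by auto
  show "\<zero>\<^bsub>M\<^esub> \<in> ?S" using submoduleD(3)[OF A] submoduleD(3)[OF B]
    by (auto intro!: exI[of _ "\<zero>\<^bsub>M\<^esub>"])
  fix x assume "x \<in> ?S"
  then obtain a b where ab: "a \<in> A" "b \<in> B" "x = a \<oplus>\<^bsub>M\<^esub> b" by auto
  note abc = submoduleD(2)[OF A ab(1)] submoduleD(2)[OF B ab(2)]
  {
    fix y assume "y \<in> ?S"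
    then obtain c d where cd: "c \<in> A" "d \<in> B" "y = c \<oplus>\<^bsub>M\<^esub> d" by auto
    note cdc = submoduleD(2)[OF A cd(1)] submoduleD(2)[OF B cd(2)]
    have "x \<oplus>\<^bsub>M\<^esub> y = (a \<oplus>\<^bsub>M\<^esub> c) \<oplus>\<^bsub>M\<^esub> (b \<oplus>\<^bsub>M\<^esub> d)" using abc cdc ab cd by (simp add: M.a_ac)
    then show "x \<oplus>\<^bsub>M\<^esub> y \<in> ?S" using submoduleD(4)[OF A] submoduleD(4)[OF B] ab cd by blast
  next
    fix r assume r: "r \<in> carrier R"
    then have "r \<odot>\<^bsub>M\<^esub> x = r \<odot>\<^bsub>M\<^esub> a \<oplus>\<^bsub>M\<^esub> r \<odot>\<^bsub>M\<^esub> b" using abc ab by (simp add: smult_r_distr)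
    then show "r \<odot>\<^bsub>M\<^esub> x \<in> ?S" using submoduleD(5)[OF A r] submoduleD(5)[OF B r] ab by blast
  }
qed

lemma left_module_submodule:
  assumes "submodule N R M"
  shows "left_module R (M\<lparr>carrier := N\<rparr>)"
proof -
  note D = submoduleD[OF assms]
  have "abelian_group (M\<lparr>carrier := N\<rparr>)"
  proof (rule abelian_groupI)
    fix x assume "x \<in> carrier (M\<lparr>carrier := N\<rparr>)"
    then have "\<ominus>\<^bsub>M\<^esub> x \<in> N \<and> \<ominus>\<^bsub>M\<^esub> x \<oplus>\<^bsub>M\<^esub> x = \<zero>\<^bsub>M\<^esub>" using D(2,6) by (simp add: M.l_neg)
    then show "\<exists>y\<in>carrier (M\<lparr>carrier := N\<rparr>). y \<oplus>\<^bsub>M\<lparr>carrier := N\<rparr>\<^esub> x = \<zero>\<^bsub>M\<lparr>carrier := N\<rparr>\<^esub>" by auto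
  qed (use D(2-5) in \<open>auto simp: M.a_ac\<close>)
  then show ?thesis
    by (intro left_module.intro left_module_axioms.intro R.ring_axioms)
      (use D(2,5) in \<open>auto simp: smult_l_distr smult_r_distr smult_assoc1\<close>)
qed

end

lemma module_homD:
  assumes "f \<in> module_hom R M N"
  shows "x \<in> carrier M \<Longrightarrow> f x \<in> carrier N"
    "\<lbrakk>x \<in> carrier M; y \<in> carrier M\<rbrakk> \<Longrightarrow> f (x \<oplus>\<^bsub>M\<^esub> y) = f x \<oplus>\<^bsub>N\<^esub> f y"
    "\<lbrakk>a \<in> carrier R; x \<in> carrier M\<rbrakk> \<Longrightarrow> f (a \<odot>\<^bsub>M\<^esub> x) = a \<odot>\<^bsub>N\<^esub> f x"
  using assms by (auto simp: module_hom_def)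

lemma module_homI:
  assumes "\<And>x. x \<in> carrier M \<Longrightarrow> f x \<in> carrier N"
    "\<And>x y. \<lbrakk>x \<in> carrier M; y \<in> carrier M\<rbrakk> \<Longrightarrow> f (x \<oplus>\<^bsub>M\<^esub> y) = f x \<oplus>\<^bsub>N\<^esub> f y"
    "\<And>a x. \<lbrakk>a \<in> carrier R; x \<in> carrier M\<rbrakk> \<Longrightarrow> f (a \<odot>\<^bsub>M\<^esub> x) = a \<odot>\<^bsub>N\<^esub> f x"
  shows "f \<in> module_hom R M N"
  using assms by (auto simp: module_hom_def)

lemma module_hom_zero:
  assumes "left_module R M" "left_module R N" "f \<in> module_hom R M N"
  shows "f \<zero>\<^bsub>M\<^esub> = \<zero>\<^bsub>N\<^esub>"
proof -
  interpret M: left_module R M by fact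
  interpret N: left_module R N by fact
  have "f (\<zero>\<^bsub>R\<^esub> \<odot>\<^bsub>M\<^esub> \<zero>\<^bsub>M\<^esub>) = \<zero>\<^bsub>R\<^esub> \<odot>\<^bsub>N\<^esub> f \<zero>\<^bsub>M\<^esub>" by (rule module_homD(3)[OF assms(3) M.R.zero_closed M.M.zero_closed])
  then show ?thesis using module_homD(1)[OF assms(3)] by simp
qed

lemma module_hom_minus:
  assumes "left_module R M" "left_module R N" "f \<in> module_hom R M N" "x \<in> carrier M"
  shows "f (\<ominus>\<^bsub>M\<^esub> x) = \<ominus>\<^bsub>N\<^esub> f x"
proof -
  interpret M: left_module R M by fact
  interpret N: left_module R N by fact
  show ?thesis using module_homD[OF assms(3)] assms(4)
    by (simp add: M.minus_eq_smult N.minus_eq_smult)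
qed

lemma module_hom_diff:
  assumes "left_module R M" "left_module R N" "f \<in> module_hom R M N" "x \<in> carrier M" "y \<in> carrier M"
  shows "f (x \<ominus>\<^bsub>M\<^esub> y) = f x \<ominus>\<^bsub>N\<^esub> f y"
proof -
  interpret M: left_module R M by fact
  show ?thesis using assms module_homD(2)[OF assms(3)] by (simp add: a_minus_def module_hom_minus)
qed

lemma module_hom_comp:
  assumes "f \<in> module_hom R M N" "g \<in> module_hom R N L"
  shows "(\<lambda>x. g (f x)) \<in> module_hom R M L"
  using module_homD[OF assms(1)] module_homD[OF assms(2)] by (intro module_homI) auto

lemma module_hom_add:
  assumes "left_module R N" "f \<in> module_hom R M N" "g \<in> module_hom R M N"
  shows "(\<lambda>x. f x \<oplus>\<^bsub>N\<^esub> g x) \<in> module_hom R M N"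
proof -
  interpret N: left_module R N by fact
  show ?thesis using module_homD[OF assms(2)] module_homD[OF assms(3)]
    by (intro module_homI) (auto simp: N.M.a_ac N.smult_r_distr)
qed

lemma module_hom_neg:
  assumes "left_module R N" "f \<in> module_hom R M N"
  shows "(\<lambda>x. \<ominus>\<^bsub>N\<^esub> f x) \<in> module_hom R M N"
proof -
  interpret N: left_module R N by fact
  show ?thesis using module_homD[OF assms(2)]
    by (intro module_homI) (auto simp: N.M.minus_add N.smult_r_minus)
qed

lemma module_hom_sub:
  assumes "left_module R N" "f \<in> module_hom R M N" "g \<in> module_hom R M N"
  shows "(\<lambda>x. f x \<ominus>\<^bsub>N\<^esub> g x) \<in> module_hom R M N"
  unfolding a_minus_def using assms by (intro module_hom_add module_hom_neg)

lemma module_hom_id: "(\<lambda>x. x) \<in> module_hom R M M"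
  by (auto simp: module_hom_def)

lemma submodule_image:
  assumes "left_module R M" "left_module R N" "f \<in> module_hom R M N"
  shows "submodule (f ` carrier M) R N"
proof -
  interpret M: left_module R M by fact
  interpret N: left_module R N by fact
  note D = module_homD[OF assms(3)]
  show ?thesis
    unfolding N.submodule_iff
  proof (intro conjI ballI)
    show "\<zero>\<^bsub>N\<^esub> \<in> f ` carrier M" using module_hom_zero[OF assms] by (metis M.M.zero_closed imageI)
    show "f ` carrier M \<subseteq> carrier N" using D(1) by auto
    show "x \<oplus>\<^bsub>N\<^esub> y \<in> f ` carrier M" if "x \<in> f ` carrier M" "y \<in> f ` carrier M" for x y
      using that D(2) by (force simp flip: D(2))
    show "a \<odot>\<^bsub>N\<^esub> x \<in> f ` carrier M" if "a \<in> carrier R" "x \<in> f ` carrier M" for a x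
      using that by (force simp flip: D(3))
  qed
qed

section \<open>Complements, hulls and automorphisms of quasi-injective modules\<close>

context left_module
begin

text \<open>Zorn's lemma provides a maximal \<open>C\<close>. The last clause is maximality spelled
  out: \<open>C + R x\<close> is strictly larger than \<open>C\<close>, so it meets \<open>B\<close>
  nontrivially.\<close>

lemma complement_Zorn:
  assumes A: "submodule A R M" and B: "submodule B R M" and AB: "A \<inter> B = {\<zero>\<^bsub>M\<^esub>}"
  obtains C where "submodule C R M" "A \<subseteq> C" "C \<inter> B = {\<zero>\<^bsub>M\<^esub>}"
    "\<And>x. \<lbrakk>x \<in> carrier M; x \<notin> C\<rbrakk> \<Longrightarrow> \<exists>r\<in>carrier R. \<exists>c\<in>C. c \<oplus>\<^bsub>M\<^esub> r \<odot>\<^bsub>M\<^esub> x \<in> B \<and> c \<oplus>\<^bsub>M\<^esub> r \<odot>\<^bsub>M\<^esub> x \<noteq> \<zero>\<^bsub>M\<^esub>"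
proof -
  define S where "S = {C. submodule C R M \<and> A \<subseteq> C \<and> C \<inter> B = {\<zero>\<^bsub>M\<^esub>}}"
  have "\<exists>C\<in>S. \<forall>X\<in>S. C \<subseteq> X \<longrightarrow> X = C"
  proof (rule subset_Zorn_nonempty)
    show "S \<noteq> {}" using A AB by (auto simp: S_def)
    fix K assume K: "K \<noteq> {}" "subset.chain S K"
    have sub: "submodule C R M" "A \<subseteq> C" "C \<inter> B = {\<zero>\<^bsub>M\<^esub>}" if "C \<in> K" for C
      using K that by (auto simp: S_def subset.chain_def)
    have "submodule (\<Union>K) R M"
      unfolding submodule_iff
    proof (intro conjI ballI)
      show "\<Union>K \<subseteq> carrier M" using submoduleD(1)[OF sub(1)] by blast
      show "\<zero>\<^bsub>M\<^esub> \<in> \<Union>K" using submoduleD(3)[OF sub(1)] K(1) by blast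
      fix x assume "x \<in> \<Union>K"
      then obtain C where C: "C \<in> K" "x \<in> C" by auto
      {
        fix y assume "y \<in> \<Union>K"
        then obtain D where D: "D \<in> K" "y \<in> D" by auto
        have "C \<subseteq> D \<or> D \<subseteq> C" using K(2) C D by (auto simp: subset.chain_def)
        then show "x \<oplus>\<^bsub>M\<^esub> y \<in> \<Union>K"
          using submoduleD(4)[OF sub(1)[OF C(1)]] submoduleD(4)[OF sub(1)[OF D(1)]] C D by blast
      next
        fix a assume "a \<in> carrier R"
        then show "a \<odot>\<^bsub>M\<^esub> x \<in> \<Union>K" using submoduleD(5)[OF sub(1)[OF C(1)]] C by blast
      }
    qed
    then show "\<Union>K \<in> S" using sub K(1) unfolding S_def by blast
  qed
  then obtain C where C: "C \<in> S" and max: "\<And>X. \<lbrakk>X \<in> S; C \<subseteq> X\<rbrakk> \<Longrightarrow> X = C" by blast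
  have Cs: "submodule C R M" "A \<subseteq> C" "C \<inter> B = {\<zero>\<^bsub>M\<^esub>}" using C by (auto simp: S_def)
  have "\<exists>r\<in>carrier R. \<exists>c\<in>C. c \<oplus>\<^bsub>M\<^esub> r \<odot>\<^bsub>M\<^esub> x \<in> B \<and> c \<oplus>\<^bsub>M\<^esub> r \<odot>\<^bsub>M\<^esub> x \<noteq> \<zero>\<^bsub>M\<^esub>"
    if x: "x \<in> carrier M" "x \<notin> C" for x
  proof (rule ccontr)
    assume no: "\<not> ?thesis"
    let ?X = "{c \<oplus>\<^bsub>M\<^esub> d | c d. c \<in> C \<and> d \<in> {r \<odot>\<^bsub>M\<^esub> x | r. r \<in> carrier R}}"
    have X: "submodule ?X R M" by (rule submodule_add[OF Cs(1) submodule_cyclic[OF x(1)]])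
    have CX: "C \<subseteq> ?X"
    proof
      fix c assume c: "c \<in> C"
      then have "c = c \<oplus>\<^bsub>M\<^esub> \<zero> \<odot>\<^bsub>M\<^esub> x" using x submoduleD(2)[OF Cs(1)] by simp
      then show "c \<in> ?X" using c R.zero_closed by blast
    qed
    have xX: "x \<in> ?X"
    proof -
      have "x = \<zero>\<^bsub>M\<^esub> \<oplus>\<^bsub>M\<^esub> \<one> \<odot>\<^bsub>M\<^esub> x" using x by simp
      then show ?thesis using submoduleD(3)[OF Cs(1)] R.one_closed by blast
    qed
    have "?X \<inter> B \<subseteq> {\<zero>\<^bsub>M\<^esub>}" using no by blast
    then have "?X \<inter> B = {\<zero>\<^bsub>M\<^esub>}" using submoduleD(3)[OF X] submoduleD(3)[OF B] by blast
    then have "?X \<in> S" unfolding S_def using X CX Cs(2) by blast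
    then show False using max CX xX x(2) by blast
  qed
  then show thesis using that Cs by blast
qed

end

text \<open>Inside the hull only extensions of maps from a submodule of \<open>M\<close> back into
  \<open>M\<close> are used. Isolating this property removes the type argument of
  \<open>injective_module\<close>.\<close>

locale quasi_injective_module = left_module +
  assumes hom_extends: "\<lbrakk>submodule N R M; \<theta> \<in> module_hom R (M\<lparr>carrier := N\<rparr>) M\<rbrakk> \<Longrightarrow>
    \<exists>f\<in>module_hom R M M. \<forall>x\<in>N. f x = \<theta> x"
begin

lemmas endo_zero = module_hom_zero[OF left_module_axioms left_module_axioms]
lemmas endo_diff = module_hom_diff[OF left_module_axioms left_module_axioms]
lemmas endo_add = module_hom_add[OF left_module_axioms]
lemmas endo_sub = module_hom_sub[OF left_module_axioms]

text \<open>The inclusion of annihilators makes \<open>r x \<mapsto> r y\<close> well defined on the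
  cyclic submodule. Equal left annihilators are turned into endomorphisms in this way.\<close>

lemma hom_extends_cyclic:
  assumes x: "x \<in> carrier M" and y: "y \<in> carrier M"
    and ann: "\<And>r. \<lbrakk>r \<in> carrier R; r \<odot>\<^bsub>M\<^esub> x = \<zero>\<^bsub>M\<^esub>\<rbrakk> \<Longrightarrow> r \<odot>\<^bsub>M\<^esub> y = \<zero>\<^bsub>M\<^esub>"
  shows "\<exists>f\<in>module_hom R M M. f x = y"
proof -
  let ?N = "{r \<odot>\<^bsub>M\<^esub> x | r. r \<in> carrier R}"
  define \<theta> where "\<theta> z = (SOME r. r \<in> carrier R \<and> z = r \<odot>\<^bsub>M\<^esub> x) \<odot>\<^bsub>M\<^esub> y" for z
  have \<theta>: "\<theta> (r \<odot>\<^bsub>M\<^esub> x) = r \<odot>\<^bsub>M\<^esub> y" if r: "r \<in> carrier R" for r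
  proof -
    let ?s = "SOME s. s \<in> carrier R \<and> r \<odot>\<^bsub>M\<^esub> x = s \<odot>\<^bsub>M\<^esub> x"
    have s: "?s \<in> carrier R \<and> r \<odot>\<^bsub>M\<^esub> x = ?s \<odot>\<^bsub>M\<^esub> x" by (rule someI_ex) (use r in blast)
    have "(?s \<ominus> r) \<odot>\<^bsub>M\<^esub> x = \<zero>\<^bsub>M\<^esub>" using s r x by (simp add: smult_l_diff module_minus_eq_zero_iff)
    then have "(?s \<ominus> r) \<odot>\<^bsub>M\<^esub> y = \<zero>\<^bsub>M\<^esub>" using ann s r by simp
    then show ?thesis using s r y by (simp add: smult_l_diff module_minus_eq_zero_iff \<theta>_def)
  qed
  have "\<theta> \<in> module_hom R (M\<lparr>carrier := ?N\<rparr>) M"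
  proof (rule module_homI)
    fix z assume "z \<in> carrier (M\<lparr>carrier := ?N\<rparr>)"
    then obtain r where r: "r \<in> carrier R" "z = r \<odot>\<^bsub>M\<^esub> x" by auto
    then show "\<theta> z \<in> carrier M" using \<theta> y by simp
    {
      fix w assume "w \<in> carrier (M\<lparr>carrier := ?N\<rparr>)"
      then obtain s where s: "s \<in> carrier R" "w = s \<odot>\<^bsub>M\<^esub> x" by auto
      have "z \<oplus>\<^bsub>M\<^esub> w = (r \<oplus> s) \<odot>\<^bsub>M\<^esub> x" using r s x by (simp add: smult_l_distr)
      then show "\<theta> (z \<oplus>\<^bsub>M\<lparr>carrier := ?N\<rparr>\<^esub> w) = \<theta> z \<oplus>\<^bsub>M\<^esub> \<theta> w"
        using r s y \<theta> by (simp add: smult_l_distr)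
    next
      fix a assume a: "a \<in> carrier R"
      have "a \<odot>\<^bsub>M\<^esub> z = (a \<otimes> r) \<odot>\<^bsub>M\<^esub> x" using r a x by (simp add: smult_assoc1)
      then show "\<theta> (a \<odot>\<^bsub>M\<lparr>carrier := ?N\<rparr>\<^esub> z) = a \<odot>\<^bsub>M\<^esub> \<theta> z"
        using r a y \<theta> by (simp add: smult_assoc1)
    }
  qed
  then obtain f where f: "f \<in> module_hom R M M" "\<forall>z\<in>?N. f z = \<theta> z"
    using hom_extends submodule_cyclic[OF x] by blast
  have "\<one> \<odot>\<^bsub>M\<^esub> x \<in> ?N" using R.one_closed by blast
  then have "f (\<one> \<odot>\<^bsub>M\<^esub> x) = \<theta> (\<one> \<odot>\<^bsub>M\<^esub> x)" using f by blast
  then have "f x = y" using \<theta>[of \<one>] x y by simp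
  then show ?thesis using f by blast
qed

text \<open>\<open>V\<close> is a maximal complement of \<open>N\<close> containing
  \<open>V0\<close>, and \<open>W\<close> a maximal complement of \<open>V\<close> containing
  \<open>N\<close>. Extending the projection \<open>W + V \<rightarrow> W\<close> to
  \<open>M\<close> gives \<open>\<pi>\<close>; its image is \<open>W\<close>, in which
  \<open>N\<close> is essential. The parameter \<open>V0\<close> allows part of the kernel to be
  prescribed.\<close>

lemma hull_idempotent:
  assumes N: "submodule N R M" and V0: "submodule V0 R M" and NV: "N \<inter> V0 = {\<zero>\<^bsub>M\<^esub>}"
  obtains \<pi> where "\<pi> \<in> module_hom R M M" "\<And>x. x \<in> carrier M \<Longrightarrow> \<pi> (\<pi> x) = \<pi> x"
    "\<And>x. x \<in> N \<Longrightarrow> \<pi> x = x" "\<And>x. x \<in> V0 \<Longrightarrow> \<pi> x = \<zero>\<^bsub>M\<^esub>"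
    "\<And>x. \<lbrakk>x \<in> carrier M; \<pi> x \<noteq> \<zero>\<^bsub>M\<^esub>\<rbrakk> \<Longrightarrow> \<exists>r\<in>carrier R. r \<odot>\<^bsub>M\<^esub> \<pi> x \<in> N \<and> r \<odot>\<^bsub>M\<^esub> \<pi> x \<noteq> \<zero>\<^bsub>M\<^esub>"
proof -
  have VN: "V0 \<inter> N = {\<zero>\<^bsub>M\<^esub>}" using NV by blast
  obtain V where V: "submodule V R M" "V0 \<subseteq> V" "V \<inter> N = {\<zero>\<^bsub>M\<^esub>}"
    "\<And>x. \<lbrakk>x \<in> carrier M; x \<notin> V\<rbrakk> \<Longrightarrow> \<exists>r\<in>carrier R. \<exists>c\<in>V. c \<oplus>\<^bsub>M\<^esub> r \<odot>\<^bsub>M\<^esub> x \<in> N \<and> c \<oplus>\<^bsub>M\<^esub> r \<odot>\<^bsub>M\<^esub> x \<noteq> \<zero>\<^bsub>M\<^esub>"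
    by (rule complement_Zorn[OF V0 N VN]) blast
  have NV': "N \<inter> V = {\<zero>\<^bsub>M\<^esub>}" using V(3) by blast
  obtain W where W: "submodule W R M" "N \<subseteq> W" "W \<inter> V = {\<zero>\<^bsub>M\<^esub>}"
    "\<And>x. \<lbrakk>x \<in> carrier M; x \<notin> W\<rbrakk> \<Longrightarrow> \<exists>r\<in>carrier R. \<exists>c\<in>W. c \<oplus>\<^bsub>M\<^esub> r \<odot>\<^bsub>M\<^esub> x \<in> V \<and> c \<oplus>\<^bsub>M\<^esub> r \<odot>\<^bsub>M\<^esub> x \<noteq> \<zero>\<^bsub>M\<^esub>"
    by (rule complement_Zorn[OF N V(1) NV']) blast
  note WD = submoduleD[OF W(1)] and VD = submoduleD[OF V(1)]
  let ?S = "{w \<oplus>\<^bsub>M\<^esub> v | w v. w \<in> W \<and> v \<in> V}"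
  define \<theta> where "\<theta> y = (SOME w. w \<in> W \<and> (\<exists>v\<in>V. y = w \<oplus>\<^bsub>M\<^esub> v))" for y
  have \<theta>: "\<theta> (w \<oplus>\<^bsub>M\<^esub> v) = w" if wv: "w \<in> W" "v \<in> V" for w v
  proof -
    have "\<theta> (w \<oplus>\<^bsub>M\<^esub> v) \<in> W \<and> (\<exists>v'\<in>V. w \<oplus>\<^bsub>M\<^esub> v = \<theta> (w \<oplus>\<^bsub>M\<^esub> v) \<oplus>\<^bsub>M\<^esub> v')"
      unfolding \<theta>_def by (rule someI_ex) (use wv in blast)
    then obtain w' v' where w': "\<theta> (w \<oplus>\<^bsub>M\<^esub> v) = w'" "w' \<in> W" "v' \<in> V" "w \<oplus>\<^bsub>M\<^esub> v = w' \<oplus>\<^bsub>M\<^esub> v'" by blast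
    note c = WD(2)[OF wv(1)] VD(2)[OF wv(2)] WD(2)[OF w'(2)] VD(2)[OF w'(3)]
    have "w \<ominus>\<^bsub>M\<^esub> w' = (w \<oplus>\<^bsub>M\<^esub> v) \<ominus>\<^bsub>M\<^esub> (w' \<oplus>\<^bsub>M\<^esub> v)" using c(1-3) by (simp add: abelian_simps)
    also have "\<dots> = (w' \<oplus>\<^bsub>M\<^esub> v') \<ominus>\<^bsub>M\<^esub> (w' \<oplus>\<^bsub>M\<^esub> v)" using w' by simp
    also have "\<dots> = v' \<ominus>\<^bsub>M\<^esub> v" using c(2-4) by (simp add: abelian_simps)
    finally have "w \<ominus>\<^bsub>M\<^esub> w' = v' \<ominus>\<^bsub>M\<^esub> v" .
    then have "w \<ominus>\<^bsub>M\<^esub> w' \<in> W \<inter> V" using WD(7)[OF wv(1) w'(2)] VD(7)[OF w'(3) wv(2)] by simp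
    then have "w \<ominus>\<^bsub>M\<^esub> w' = \<zero>\<^bsub>M\<^esub>" using W(3) by blast
    then show ?thesis using w' c module_minus_eq_zero_iff by simp
  qed
  have "\<theta> \<in> module_hom R (M\<lparr>carrier := ?S\<rparr>) M"
  proof (rule module_homI)
    fix x assume "x \<in> carrier (M\<lparr>carrier := ?S\<rparr>)"
    then obtain w v where wv: "w \<in> W" "v \<in> V" "x = w \<oplus>\<^bsub>M\<^esub> v" by auto
    note c = WD(2)[OF wv(1)] VD(2)[OF wv(2)]
    show "\<theta> x \<in> carrier M" using wv \<theta> c by simp
    {
      fix y assume "y \<in> carrier (M\<lparr>carrier := ?S\<rparr>)"
      then obtain w' v' where wv': "w' \<in> W" "v' \<in> V" "y = w' \<oplus>\<^bsub>M\<^esub> v'" by auto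
      note c' = WD(2)[OF wv'(1)] VD(2)[OF wv'(2)]
      have "x \<oplus>\<^bsub>M\<^esub> y = (w \<oplus>\<^bsub>M\<^esub> w') \<oplus>\<^bsub>M\<^esub> (v \<oplus>\<^bsub>M\<^esub> v')" using c c' wv wv' by (simp add: M.a_ac)
      then show "\<theta> (x \<oplus>\<^bsub>M\<lparr>carrier := ?S\<rparr>\<^esub> y) = \<theta> x \<oplus>\<^bsub>M\<^esub> \<theta> y"
        using \<theta>[OF WD(4)[OF wv(1) wv'(1)] VD(4)[OF wv(2) wv'(2)]] \<theta> wv wv' by simp
    next
      fix r assume r: "r \<in> carrier R"
      then have "r \<odot>\<^bsub>M\<^esub> x = r \<odot>\<^bsub>M\<^esub> w \<oplus>\<^bsub>M\<^esub> r \<odot>\<^bsub>M\<^esub> v" using wv c by (simp add: smult_r_distr)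
      then show "\<theta> (r \<odot>\<^bsub>M\<lparr>carrier := ?S\<rparr>\<^esub> x) = r \<odot>\<^bsub>M\<^esub> \<theta> x"
        using \<theta>[OF WD(5)[OF r wv(1)] VD(5)[OF r wv(2)]] \<theta> wv by simp
    }
  qed
  then obtain f where f: "f \<in> module_hom R M M" "\<forall>x\<in>?S. f x = \<theta> x"
    using hom_extends submodule_add[OF W(1) V(1)] by blast
  have f_sum: "f (w \<oplus>\<^bsub>M\<^esub> v) = w" if wv: "w \<in> W" "v \<in> V" for w v
  proof -
    have "w \<oplus>\<^bsub>M\<^esub> v \<in> ?S" using wv by blast
    then have "f (w \<oplus>\<^bsub>M\<^esub> v) = \<theta> (w \<oplus>\<^bsub>M\<^esub> v)" using f(2) by blast
    then show ?thesis using \<theta>[OF wv] by simp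
  qed
  have fW: "f w = w" if w: "w \<in> W" for w
    using f_sum[OF w VD(3)] WD(2)[OF w] by simp
  have fV: "f v = \<zero>\<^bsub>M\<^esub>" if v: "v \<in> V" for v
    using f_sum[OF WD(3) v] VD(2)[OF v] by simp
  note fD = module_homD[OF f(1)]
  \<comment> \<open>If not, maximality of \<open>W\<close> yields \<open>y\<close> with
    \<open>f y\<close> nonzero in \<open>V\<close>. Then \<open>y\<close> is outside
    \<open>V\<close>, and maximality of \<open>V\<close> puts a nonzero \<open>v + s y\<close> into
    \<open>N\<close>. Being fixed by \<open>f\<close>, it equals \<open>s f y\<close>, an element of
    \<open>V\<close>, against \<open>V \<inter> N = 0\<close>.\<close>
  have f_in: "f x \<in> W" if x: "x \<in> carrier M" for x
  proof (rule ccontr)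
    assume "f x \<notin> W"
    then obtain r w where rw: "r \<in> carrier R" "w \<in> W" "w \<oplus>\<^bsub>M\<^esub> r \<odot>\<^bsub>M\<^esub> f x \<in> V" "w \<oplus>\<^bsub>M\<^esub> r \<odot>\<^bsub>M\<^esub> f x \<noteq> \<zero>\<^bsub>M\<^esub>"
      using W(4) fD(1) x by blast
    define y where "y = w \<oplus>\<^bsub>M\<^esub> r \<odot>\<^bsub>M\<^esub> x"
    have y: "y \<in> carrier M" using rw x WD(2) by (simp add: y_def)
    have fy: "f y = w \<oplus>\<^bsub>M\<^esub> r \<odot>\<^bsub>M\<^esub> f x" unfolding y_def using rw x WD(2) fD fW by simp
    have "y \<notin> V" using fV fy rw by auto
    then obtain s v where sv: "s \<in> carrier R" "v \<in> V" "v \<oplus>\<^bsub>M\<^esub> s \<odot>\<^bsub>M\<^esub> y \<in> N" "v \<oplus>\<^bsub>M\<^esub> s \<odot>\<^bsub>M\<^esub> y \<noteq> \<zero>\<^bsub>M\<^esub>"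
      using V(4) y by blast
    have "f (v \<oplus>\<^bsub>M\<^esub> s \<odot>\<^bsub>M\<^esub> y) = s \<odot>\<^bsub>M\<^esub> f y" using sv VD(2) fD fV y by simp
    then have "v \<oplus>\<^bsub>M\<^esub> s \<odot>\<^bsub>M\<^esub> y = s \<odot>\<^bsub>M\<^esub> f y" using fW sv W(2) by auto
    moreover have "s \<odot>\<^bsub>M\<^esub> f y \<in> V" using VD(5) sv rw fy by simp
    ultimately show False using sv V(3) by auto
  qed
  show thesis
  proof (rule that[OF f(1)])
    fix x assume x: "x \<in> carrier M"
    show "f (f x) = f x" using f_in fW x by simp
    assume nz: "f x \<noteq> \<zero>\<^bsub>M\<^esub>"
    then have "f x \<notin> V" using W(3) f_in[OF x] by blast
    then obtain r v where rv: "r \<in> carrier R" "v \<in> V" "v \<oplus>\<^bsub>M\<^esub> r \<odot>\<^bsub>M\<^esub> f x \<in> N" "v \<oplus>\<^bsub>M\<^esub> r \<odot>\<^bsub>M\<^esub> f x \<noteq> \<zero>\<^bsub>M\<^esub>"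
      using V(4) fD(1) x by blast
    have c: "v \<in> carrier M" "r \<odot>\<^bsub>M\<^esub> f x \<in> carrier M" "r \<odot>\<^bsub>M\<^esub> f x \<in> W"
      using rv VD(2) fD(1) x WD(5) f_in by auto
    have "(v \<oplus>\<^bsub>M\<^esub> r \<odot>\<^bsub>M\<^esub> f x) \<ominus>\<^bsub>M\<^esub> r \<odot>\<^bsub>M\<^esub> f x \<in> W" using rv c W(2) WD(7) by blast
    moreover have "(v \<oplus>\<^bsub>M\<^esub> r \<odot>\<^bsub>M\<^esub> f x) \<ominus>\<^bsub>M\<^esub> r \<odot>\<^bsub>M\<^esub> f x = v" using c(1,2) by (simp add: abelian_simps)
    ultimately have "v = \<zero>\<^bsub>M\<^esub>" using W(3) rv by auto
    then show "\<exists>r\<in>carrier R. r \<odot>\<^bsub>M\<^esub> f x \<in> N \<and> r \<odot>\<^bsub>M\<^esub> f x \<noteq> \<zero>\<^bsub>M\<^esub>" using rv c by auto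
  qed (use fW fV W(2) V(2) in auto)
qed

text \<open>The inverse on the image extends to \<open>b\<close> with \<open>b a = 1\<close>. The
  kernel of \<open>b\<close> meets the essential image of \<open>a\<close> trivially, so
  \<open>b\<close> is injective; from \<open>b (a (b x) - x) = 0\<close> follows
  \<open>a b = 1\<close>.\<close>

lemma automorphism_if_essential_image:
  assumes a: "a \<in> module_hom R M M"
    and inj: "\<And>x. \<lbrakk>x \<in> carrier M; a x = \<zero>\<^bsub>M\<^esub>\<rbrakk> \<Longrightarrow> x = \<zero>\<^bsub>M\<^esub>"
    and ess: "\<And>x. \<lbrakk>x \<in> carrier M; x \<noteq> \<zero>\<^bsub>M\<^esub>\<rbrakk> \<Longrightarrow>
      \<exists>r\<in>carrier R. \<exists>y\<in>carrier M. r \<odot>\<^bsub>M\<^esub> x = a y \<and> r \<odot>\<^bsub>M\<^esub> x \<noteq> \<zero>\<^bsub>M\<^esub>"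
  shows "module_automorphism R M a"
proof -
  note aD = module_homD[OF a]
  have inj_a: "inj_on a (carrier M)"
  proof (rule inj_onI)
    fix x y assume xy: "x \<in> carrier M" "y \<in> carrier M" "a x = a y"
    then have "a (x \<ominus>\<^bsub>M\<^esub> y) = \<zero>\<^bsub>M\<^esub>" using aD(1) by (simp add: endo_diff[OF a] module_minus_eq_zero_iff)
    then have "x \<ominus>\<^bsub>M\<^esub> y = \<zero>\<^bsub>M\<^esub>" using inj xy by simp
    then show "x = y" using xy module_minus_eq_zero_iff by simp
  qed
  let ?N = "a ` carrier M"
  let ?\<theta> = "inv_into (carrier M) a"
  have \<theta>: "?\<theta> (a x) = x" if "x \<in> carrier M" for x using inv_into_f_f[OF inj_a that] .
  have N: "submodule ?N R M" by (rule submodule_image[OF left_module_axioms left_module_axioms a])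
  have "?\<theta> \<in> module_hom R (M\<lparr>carrier := ?N\<rparr>) M"
  proof (rule module_homI)
    fix x assume "x \<in> carrier (M\<lparr>carrier := ?N\<rparr>)"
    then obtain p where p: "p \<in> carrier M" "x = a p" by auto
    then show "?\<theta> x \<in> carrier M" using \<theta> by simp
    {
      fix y assume "y \<in> carrier (M\<lparr>carrier := ?N\<rparr>)"
      then obtain q where q: "q \<in> carrier M" "y = a q" by auto
      then have "x \<oplus>\<^bsub>M\<^esub> y = a (p \<oplus>\<^bsub>M\<^esub> q)" using p aD(2) by auto
      then show "?\<theta> (x \<oplus>\<^bsub>M\<lparr>carrier := ?N\<rparr>\<^esub> y) = ?\<theta> x \<oplus>\<^bsub>M\<^esub> ?\<theta> y" using \<theta> p q by simp
    next
      fix r assume r: "r \<in> carrier R"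
      then have "r \<odot>\<^bsub>M\<^esub> x = a (r \<odot>\<^bsub>M\<^esub> p)" using p aD(3) by auto
      then show "?\<theta> (r \<odot>\<^bsub>M\<lparr>carrier := ?N\<rparr>\<^esub> x) = r \<odot>\<^bsub>M\<^esub> ?\<theta> x" using \<theta> p r by simp
    }
  qed
  then obtain b where b: "b \<in> module_hom R M M" "\<forall>x\<in>?N. b x = ?\<theta> x" using hom_extends[OF N] by blast
  note bD = module_homD[OF b(1)]
  have ba: "b (a x) = x" if "x \<in> carrier M" for x using b(2) \<theta>[OF that] that by simp
  have b_inj: "x = \<zero>\<^bsub>M\<^esub>" if x: "x \<in> carrier M" "b x = \<zero>\<^bsub>M\<^esub>" for x
  proof (rule ccontr)
    assume "x \<noteq> \<zero>\<^bsub>M\<^esub>"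
    then obtain r y where ry: "r \<in> carrier R" "y \<in> carrier M" "r \<odot>\<^bsub>M\<^esub> x = a y" "r \<odot>\<^bsub>M\<^esub> x \<noteq> \<zero>\<^bsub>M\<^esub>"
      using ess x by blast
    have "b (r \<odot>\<^bsub>M\<^esub> x) = r \<odot>\<^bsub>M\<^esub> b x" by (rule bD(3)[OF ry(1) x(1)])
    then have "y = \<zero>\<^bsub>M\<^esub>" using ry x ba by simp
    then show False using ry endo_zero[OF a] by simp
  qed
  have "a (b x) = x" if x: "x \<in> carrier M" for x
  proof -
    have "b (a (b x) \<ominus>\<^bsub>M\<^esub> x) = \<zero>\<^bsub>M\<^esub>"
      using x aD(1) bD(1) ba by (simp add: endo_diff[OF b(1)] module_minus_eq_zero_iff)
    then have "a (b x) \<ominus>\<^bsub>M\<^esub> x = \<zero>\<^bsub>M\<^esub>" using b_inj x aD(1) bD(1) by simp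
    then show ?thesis using x aD(1) bD(1) module_minus_eq_zero_iff by simp
  qed
  then have "bij_betw a (carrier M) (carrier M)"
    using ba aD(1) bD(1) by (intro bij_betw_byWitness[where f' = b]) auto
  then show ?thesis using a by (simp add: module_automorphism_def)
qed

lemma automorphism_one_plus_square_zero:
  assumes n: "n \<in> module_hom R M M" and sq: "\<And>x. x \<in> carrier M \<Longrightarrow> n (n x) = \<zero>\<^bsub>M\<^esub>"
  shows "module_automorphism R M (\<lambda>x. x \<oplus>\<^bsub>M\<^esub> n x)"
  unfolding module_automorphism_def
proof
  note nD = module_homD[OF n]
  show "(\<lambda>x. x \<oplus>\<^bsub>M\<^esub> n x) \<in> module_hom R M M" by (intro endo_add module_hom_id n)
  show "bij_betw (\<lambda>x. x \<oplus>\<^bsub>M\<^esub> n x) (carrier M) (carrier M)"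
  proof (rule bij_betw_byWitness[where f' = "\<lambda>x. x \<ominus>\<^bsub>M\<^esub> n x"])
    show "\<forall>x\<in>carrier M. (x \<oplus>\<^bsub>M\<^esub> n x) \<ominus>\<^bsub>M\<^esub> n (x \<oplus>\<^bsub>M\<^esub> n x) = x"
      using nD(1,2) sq by (simp add: abelian_simps)
    show "\<forall>x\<in>carrier M. (x \<ominus>\<^bsub>M\<^esub> n x) \<oplus>\<^bsub>M\<^esub> n (x \<ominus>\<^bsub>M\<^esub> n x) = x"
      using nD(1) sq endo_diff[OF n] by (simp add: abelian_simps)
  qed (use nD(1) in auto)
qed

text \<open>The fixed points of an idempotent form its image, so this describes a projection onto a
  uniform direct summand.\<close>

definition uniform_proj :: "('c \<Rightarrow> 'c) \<Rightarrow> bool" where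
  "uniform_proj \<pi> \<longleftrightarrow> \<pi> \<in> module_hom R M M \<and> (\<forall>x\<in>carrier M. \<pi> (\<pi> x) = \<pi> x) \<and>
     (\<forall>x\<in>carrier M. \<forall>y\<in>carrier M. \<pi> x = x \<and> \<pi> y = y \<and> x \<noteq> \<zero>\<^bsub>M\<^esub> \<and> y \<noteq> \<zero>\<^bsub>M\<^esub> \<longrightarrow>
        (\<exists>r\<in>carrier R. \<exists>s\<in>carrier R. r \<odot>\<^bsub>M\<^esub> x = s \<odot>\<^bsub>M\<^esub> y \<and> r \<odot>\<^bsub>M\<^esub> x \<noteq> \<zero>\<^bsub>M\<^esub>))"

lemma uniform_projD:
  assumes "uniform_proj \<pi>"
  shows "\<pi> \<in> module_hom R M M" "x \<in> carrier M \<Longrightarrow> \<pi> (\<pi> x) = \<pi> x"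
    "\<lbrakk>x \<in> carrier M; y \<in> carrier M; \<pi> x = x; \<pi> y = y; x \<noteq> \<zero>\<^bsub>M\<^esub>; y \<noteq> \<zero>\<^bsub>M\<^esub>\<rbrakk> \<Longrightarrow>
      \<exists>r\<in>carrier R. \<exists>s\<in>carrier R. r \<odot>\<^bsub>M\<^esub> x = s \<odot>\<^bsub>M\<^esub> y \<and> r \<odot>\<^bsub>M\<^esub> x \<noteq> \<zero>\<^bsub>M\<^esub>"
  using assms unfolding uniform_proj_def by blast+

text \<open>The map is \<open>k\<close> on the summand and the identity on its complement. By
  uniformity the nonzero images under \<open>k\<close> are essential in the summand, which is enough
  in a quasi-injective module.\<close>

lemma automorphism_uniform_proj:
  assumes \<pi>: "uniform_proj \<pi>" and k: "k \<in> module_hom R M M"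
    and k\<pi>: "\<And>x. x \<in> carrier M \<Longrightarrow> k (\<pi> x) = k x" and \<pi>k: "\<And>x. x \<in> carrier M \<Longrightarrow> \<pi> (k x) = k x"
    and inj: "\<And>x. \<lbrakk>x \<in> carrier M; \<pi> x = x; k x = \<zero>\<^bsub>M\<^esub>\<rbrakk> \<Longrightarrow> x = \<zero>\<^bsub>M\<^esub>"
  shows "module_automorphism R M (\<lambda>x. k x \<oplus>\<^bsub>M\<^esub> (x \<ominus>\<^bsub>M\<^esub> \<pi> x))"
proof (rule automorphism_if_essential_image)
  note p = uniform_projD(1)[OF \<pi>]
  note pD = module_homD[OF p] and kD = module_homD[OF k] and pp = uniform_projD(2)[OF \<pi>]
  show "(\<lambda>x. k x \<oplus>\<^bsub>M\<^esub> (x \<ominus>\<^bsub>M\<^esub> \<pi> x)) \<in> module_hom R M M"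
    by (intro endo_add endo_sub module_hom_id p k)
  fix x assume x: "x \<in> carrier M"
  have p1: "\<pi> (x \<ominus>\<^bsub>M\<^esub> \<pi> x) = \<zero>\<^bsub>M\<^esub>" using x pD(1) pp by (simp add: endo_diff[OF p] module_minus_eq_zero_iff)
  {
    assume z: "k x \<oplus>\<^bsub>M\<^esub> (x \<ominus>\<^bsub>M\<^esub> \<pi> x) = \<zero>\<^bsub>M\<^esub>"
    then have "\<pi> (k x \<oplus>\<^bsub>M\<^esub> (x \<ominus>\<^bsub>M\<^esub> \<pi> x)) = \<zero>\<^bsub>M\<^esub>" using endo_zero[OF p] by simp
    then have kx: "k x = \<zero>\<^bsub>M\<^esub>" using x kD(1) pD(1,2) \<pi>k p1 by simp
    then have "\<pi> x = x" using z x pD(1) by (simp add: module_minus_eq_zero_iff)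
    then show "x = \<zero>\<^bsub>M\<^esub>" using inj x kx by simp
  next
    assume nz: "x \<noteq> \<zero>\<^bsub>M\<^esub>"
    show "\<exists>r\<in>carrier R. \<exists>y\<in>carrier M. r \<odot>\<^bsub>M\<^esub> x = k y \<oplus>\<^bsub>M\<^esub> (y \<ominus>\<^bsub>M\<^esub> \<pi> y) \<and> r \<odot>\<^bsub>M\<^esub> x \<noteq> \<zero>\<^bsub>M\<^esub>"
    proof (cases "\<pi> x = \<zero>\<^bsub>M\<^esub>")
      case True
      then have "k x = \<zero>\<^bsub>M\<^esub>" using k\<pi>[OF x] endo_zero[OF k] by simp
      then have "\<one> \<odot>\<^bsub>M\<^esub> x = k x \<oplus>\<^bsub>M\<^esub> (x \<ominus>\<^bsub>M\<^esub> \<pi> x)" using True x by (simp add: a_minus_def)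
      then show ?thesis using x nz by (intro bexI[of _ \<one>] bexI[of _ x]) auto
    next
      case False
      have kp: "k (\<pi> x) \<noteq> \<zero>\<^bsub>M\<^esub>" using inj[of "\<pi> x"] pp x pD(1) False by auto
      then obtain r s where rs: "r \<in> carrier R" "s \<in> carrier R" "r \<odot>\<^bsub>M\<^esub> \<pi> x = s \<odot>\<^bsub>M\<^esub> k (\<pi> x)" "r \<odot>\<^bsub>M\<^esub> \<pi> x \<noteq> \<zero>\<^bsub>M\<^esub>"
        using uniform_projD(3)[OF \<pi>, of "\<pi> x" "k (\<pi> x)"] pp x pD(1) kD(1) \<pi>k False by auto
      \<comment> \<open>A preimage of \<open>r x\<close>: on the summand \<open>s (\<pi> x)\<close>
        is mapped to \<open>r (\<pi> x)\<close> by the choice of \<open>r\<close> and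
        \<open>s\<close>, and the complementary part is simply multiplied by
        \<open>r\<close>.\<close>
      define y where "y = s \<odot>\<^bsub>M\<^esub> \<pi> x \<oplus>\<^bsub>M\<^esub> r \<odot>\<^bsub>M\<^esub> (x \<ominus>\<^bsub>M\<^esub> \<pi> x)"
      have yc: "y \<in> carrier M" using rs x pD(1) by (simp add: y_def)
      have "\<pi> y = s \<odot>\<^bsub>M\<^esub> \<pi> x" unfolding y_def using rs x pD pp p1 by simp
      moreover have "k y = s \<odot>\<^bsub>M\<^esub> k (\<pi> x)"
        using k\<pi>[OF yc] calculation kD(3)[OF rs(2) pD(1)[OF x]] by simp
      ultimately have "k y \<oplus>\<^bsub>M\<^esub> (y \<ominus>\<^bsub>M\<^esub> \<pi> y) = r \<odot>\<^bsub>M\<^esub> \<pi> x \<oplus>\<^bsub>M\<^esub> r \<odot>\<^bsub>M\<^esub> (x \<ominus>\<^bsub>M\<^esub> \<pi> x)"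
        using rs x pD(1) by (simp add: y_def abelian_simps)
      also have "\<dots> = r \<odot>\<^bsub>M\<^esub> (\<pi> x \<oplus>\<^bsub>M\<^esub> (x \<ominus>\<^bsub>M\<^esub> \<pi> x))"
        using rs x pD(1) by (simp add: smult_r_distr)
      also have "\<pi> x \<oplus>\<^bsub>M\<^esub> (x \<ominus>\<^bsub>M\<^esub> \<pi> x) = x" using x pD(1) by (simp add: abelian_simps)
      finally have "r \<odot>\<^bsub>M\<^esub> x = k y \<oplus>\<^bsub>M\<^esub> (y \<ominus>\<^bsub>M\<^esub> \<pi> y)" by simp
      moreover have "r \<odot>\<^bsub>M\<^esub> x \<noteq> \<zero>\<^bsub>M\<^esub>"
        using rs(4) pD(3)[OF rs(1) x] endo_zero[OF p] by auto
      ultimately show ?thesis using rs yc by blast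
    qed
  }
qed

end

section \<open>Rings invariant in their injective hull\<close>

text \<open>\<open>u\<close> plays the role of \<open>\<one>\<close> under the embedding of the ring
  into its hull \<open>M\<close>, which identifies \<open>R\<close> with \<open>R u\<close>. By
  linearity it suffices to control automorphisms at \<open>u\<close>.\<close>

locale essential_generator = quasi_injective_module R M + left_dcc R
  for R :: "('a, 'm) ring_scheme" (structure) and M :: "('a, 'b, 'n) module_scheme" (structure) +
  fixes u
  assumes gen_closed: "u \<in> carrier M"
    and gen_faithful: "\<lbrakk>r \<in> carrier R; r \<odot>\<^bsub>M\<^esub> u = \<zero>\<^bsub>M\<^esub>\<rbrakk> \<Longrightarrow> r = \<zero>"
    and gen_essential: "\<lbrakk>x \<in> carrier M; x \<noteq> \<zero>\<^bsub>M\<^esub>\<rbrakk> \<Longrightarrow>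
      \<exists>r\<in>carrier R. \<exists>s\<in>carrier R. r \<odot>\<^bsub>M\<^esub> x = s \<odot>\<^bsub>M\<^esub> u \<and> r \<odot>\<^bsub>M\<^esub> x \<noteq> \<zero>\<^bsub>M\<^esub>"
    and gen_automorphism: "module_automorphism R M \<phi> \<Longrightarrow> \<exists>c\<in>carrier R. \<phi> u = c \<odot>\<^bsub>M\<^esub> u"
begin

section \<open>Endomorphisms of the hull that preserve the copy of the ring\<close>

definition span :: "'b set" where
  "span = {r \<odot>\<^bsub>M\<^esub> u | r. r \<in> carrier R}"

lemmas span_closed = submoduleD[OF submodule_cyclic[OF gen_closed], folded span_def]

lemma gen_in_span: "u \<in> span"
proof -
  have "u = \<one> \<odot>\<^bsub>M\<^esub> u" using gen_closed by simp
  then show ?thesis unfolding span_def using R.one_closed by blast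
qed

lemma spanE:
  assumes "x \<in> span"
  obtains r where "r \<in> carrier R" "x = r \<odot>\<^bsub>M\<^esub> u"
  using assms by (auto simp: span_def)

lemma automorphism_span: "module_automorphism R M \<phi> \<Longrightarrow> \<phi> u \<in> span"
  using gen_automorphism by (auto simp: span_def)

lemma gen_cancel:
  assumes "r \<in> carrier R" "s \<in> carrier R" "r \<odot>\<^bsub>M\<^esub> u = s \<odot>\<^bsub>M\<^esub> u"
  shows "r = s"
proof -
  have "(r \<ominus> s) \<odot>\<^bsub>M\<^esub> u = \<zero>\<^bsub>M\<^esub>" using assms gen_closed by (simp add: smult_l_diff module_minus_eq_zero_iff)
  then have "r \<ominus> s = \<zero>" using gen_faithful assms by simp
  then show ?thesis using assms minus_eq_zero_iff by simp
qed

lemma left_ann_smult: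
  assumes "left_ann t' = left_ann t" "r \<in> carrier R" "t \<in> carrier R" "t' \<in> carrier R"
  shows "r \<odot>\<^bsub>M\<^esub> (t \<odot>\<^bsub>M\<^esub> u) = \<zero>\<^bsub>M\<^esub> \<longleftrightarrow> r \<odot>\<^bsub>M\<^esub> (t' \<odot>\<^bsub>M\<^esub> u) = \<zero>\<^bsub>M\<^esub>"
proof -
  have *: "r \<odot>\<^bsub>M\<^esub> (t \<odot>\<^bsub>M\<^esub> u) = \<zero>\<^bsub>M\<^esub> \<longleftrightarrow> r \<in> left_ann t" if "t \<in> carrier R" for t
    using that assms(2) gen_closed gen_faithful[of "r \<otimes> t"] by (auto simp: left_ann_def simp flip: smult_assoc1)
  show ?thesis using assms * by simp
qed

text \<open>\<open>n = (1 + n) - 1\<close> is a difference of automorphisms.\<close>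

lemma square_zero_span:
  assumes n: "n \<in> module_hom R M M" and sq: "\<And>x. x \<in> carrier M \<Longrightarrow> n (n x) = \<zero>\<^bsub>M\<^esub>"
  shows "n u \<in> span"
proof -
  have "u \<oplus>\<^bsub>M\<^esub> n u \<in> span" by (rule automorphism_span[OF automorphism_one_plus_square_zero[OF n sq]])
  then have "(u \<oplus>\<^bsub>M\<^esub> n u) \<ominus>\<^bsub>M\<^esub> u \<in> span" using span_closed(7) gen_in_span by blast
  moreover have "(u \<oplus>\<^bsub>M\<^esub> n u) \<ominus>\<^bsub>M\<^esub> u = n u"
    using gen_closed module_homD(1)[OF n gen_closed] by (simp add: abelian_simps)
  ultimately show ?thesis by simp
qed

lemma uniform_proj_span_aux:
  assumes \<pi>: "uniform_proj \<pi>" and k: "k \<in> module_hom R M M"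
    and k\<pi>: "\<And>x. x \<in> carrier M \<Longrightarrow> k (\<pi> x) = k x" and \<pi>k: "\<And>x. x \<in> carrier M \<Longrightarrow> \<pi> (k x) = k x"
    and inj: "\<And>x. \<lbrakk>x \<in> carrier M; \<pi> x = x; k x = \<zero>\<^bsub>M\<^esub>\<rbrakk> \<Longrightarrow> x = \<zero>\<^bsub>M\<^esub>"
  shows "k u \<oplus>\<^bsub>M\<^esub> (u \<ominus>\<^bsub>M\<^esub> \<pi> u) \<in> span"
  by (rule automorphism_span[OF automorphism_uniform_proj[OF assms]])

text \<open>Let \<open>f\<close> be an endomorphism with \<open>f u = x\<close> and split
  \<open>\<pi> f\<close> into \<open>\<pi> f (1 - \<pi>)\<close>, which has square zero, and the
  corner part \<open>k = \<pi> f \<pi>\<close>. By uniformity \<open>k\<close> or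
  \<open>\<pi> - k\<close> is injective on the summand, so it becomes an automorphism after adding
  \<open>1 - \<pi>\<close>. As \<open>(1 - \<pi>) u\<close> lies in \<open>span\<close>, so does
  \<open>k u\<close>, and \<open>x = n u + k u\<close>.\<close>

lemma uniform_proj_image_span:
  assumes \<pi>: "uniform_proj \<pi>" and pu: "\<pi> u \<in> span" and x: "x \<in> carrier M" "\<pi> x = x"
  shows "x \<in> span"
proof -
  note p = uniform_projD(1)[OF \<pi>] and pp = uniform_projD(2)[OF \<pi>]
  note pD = module_homD[OF p]
  have "r \<odot>\<^bsub>M\<^esub> x = \<zero>\<^bsub>M\<^esub>" if "r \<in> carrier R" "r \<odot>\<^bsub>M\<^esub> u = \<zero>\<^bsub>M\<^esub>" for r
    using gen_faithful[OF that] x by simp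
  then obtain f where f: "f \<in> module_hom R M M" "f u = x"
    using hom_extends_cyclic[OF gen_closed x(1)] by blast
  note fD = module_homD[OF f(1)]
  define n where "n z = \<pi> (f (z \<ominus>\<^bsub>M\<^esub> \<pi> z))" for z
  define k where "k z = \<pi> (f (\<pi> z))" for z
  define j where "j z = \<pi> z \<ominus>\<^bsub>M\<^esub> k z" for z
  have n: "n \<in> module_hom R M M" unfolding n_def
    by (intro module_hom_comp[OF _ p] module_hom_comp[OF _ f(1)] endo_sub module_hom_id p)
  have k: "k \<in> module_hom R M M" unfolding k_def
    by (intro module_hom_comp[OF _ p] module_hom_comp[OF _ f(1)] p)
  have j: "j \<in> module_hom R M M" unfolding j_def by (intro endo_sub p k)
  have "n (n z) = \<zero>\<^bsub>M\<^esub>" if z: "z \<in> carrier M" for z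
  proof -
    have nz: "n z \<in> carrier M" "\<pi> (n z) = n z" using z pD(1) fD(1) pp by (auto simp: n_def)
    then have "n z \<ominus>\<^bsub>M\<^esub> \<pi> (n z) = \<zero>\<^bsub>M\<^esub>" by (simp add: module_minus_eq_zero_iff)
    then show ?thesis using endo_zero[OF p] endo_zero[OF f(1)] n_def[of "n z"] by simp
  qed
  then have nu: "n u \<in> span" by (rule square_zero_span[OF n])
  have u1: "u \<ominus>\<^bsub>M\<^esub> \<pi> u \<in> span" using span_closed(7) gen_in_span pu by blast
  have strip: "g u \<in> span" if g: "g \<in> module_hom R M M" "g u \<oplus>\<^bsub>M\<^esub> (u \<ominus>\<^bsub>M\<^esub> \<pi> u) \<in> span" for g
  proof -
    have "(g u \<oplus>\<^bsub>M\<^esub> (u \<ominus>\<^bsub>M\<^esub> \<pi> u)) \<ominus>\<^bsub>M\<^esub> (u \<ominus>\<^bsub>M\<^esub> \<pi> u) \<in> span" using span_closed(7) g u1 by blast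
    moreover have "(g u \<oplus>\<^bsub>M\<^esub> (u \<ominus>\<^bsub>M\<^esub> \<pi> u)) \<ominus>\<^bsub>M\<^esub> (u \<ominus>\<^bsub>M\<^esub> \<pi> u) = g u"
      using module_homD(1)[OF g(1) gen_closed] gen_closed span_closed(2)[OF u1] by (simp add: M.minus_eq M.a_assoc M.r_neg)
    ultimately show ?thesis by simp
  qed
  have kp: "k (\<pi> z) = k z" "\<pi> (k z) = k z" "k z \<in> carrier M" if "z \<in> carrier M" for z
    using that pp pD(1) fD(1) by (auto simp: k_def)
  have ku: "k u \<in> span"
  proof (cases "\<forall>z\<in>carrier M. \<pi> z = z \<and> k z = \<zero>\<^bsub>M\<^esub> \<longrightarrow> z = \<zero>\<^bsub>M\<^esub>")
    case True
    then show ?thesis by (intro strip[OF k] uniform_proj_span_aux[OF \<pi> k]) (use kp in auto)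
  next
    case False
    then obtain a where a: "a \<in> carrier M" "\<pi> a = a" "k a = \<zero>\<^bsub>M\<^esub>" "a \<noteq> \<zero>\<^bsub>M\<^esub>" by blast
    \<comment> \<open>Now \<open>k\<close> kills some nonzero \<open>a\<close> of the summand. A
      nonzero \<open>z\<close> with \<open>j z = 0\<close> is fixed by \<open>k\<close>, yet shares
      a nonzero multiple with \<open>a\<close>.\<close>
    have "j u \<in> span"
    proof (intro strip[OF j] uniform_proj_span_aux[OF \<pi> j])
      fix z assume z: "z \<in> carrier M"
      show "j (\<pi> z) = j z" using z kp pp pD(1) by (simp add: j_def)
      show "\<pi> (j z) = j z" using z kp pp pD(1) by (simp add: j_def endo_diff[OF p])
      assume pz: "\<pi> z = z" and jz: "j z = \<zero>\<^bsub>M\<^esub>"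
      show "z = \<zero>\<^bsub>M\<^esub>"
      proof (rule ccontr)
        assume "z \<noteq> \<zero>\<^bsub>M\<^esub>"
        then obtain r s where rs: "r \<in> carrier R" "s \<in> carrier R" "r \<odot>\<^bsub>M\<^esub> a = s \<odot>\<^bsub>M\<^esub> z" "r \<odot>\<^bsub>M\<^esub> a \<noteq> \<zero>\<^bsub>M\<^esub>"
          using uniform_projD(3)[OF \<pi> a(1) z a(2) pz a(4)] by blast
        have kz: "k z = z" using jz pz kp z by (simp add: j_def module_minus_eq_zero_iff)
        have "k (r \<odot>\<^bsub>M\<^esub> a) = \<zero>\<^bsub>M\<^esub>" using module_homD(3)[OF k rs(1) a(1)] a rs by simp
        moreover have "k (s \<odot>\<^bsub>M\<^esub> z) = s \<odot>\<^bsub>M\<^esub> z" using module_homD(3)[OF k rs(2) z] kz by simp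
        ultimately show False using rs by simp
      qed
    qed
    then have "\<pi> u \<ominus>\<^bsub>M\<^esub> j u \<in> span" using span_closed(7) pu by blast
    moreover have "\<pi> u \<ominus>\<^bsub>M\<^esub> j u = k u" using gen_closed pD(1) kp by (simp add: j_def abelian_simps)
    ultimately show ?thesis by simp
  qed
  have "n u = \<pi> (f u) \<ominus>\<^bsub>M\<^esub> k u" unfolding n_def k_def
    using gen_closed pD(1) fD(1) by (simp add: endo_diff[OF p] endo_diff[OF f(1)])
  then have "n u \<oplus>\<^bsub>M\<^esub> k u = \<pi> (f u)" using gen_closed pD(1) fD(1) kp by (simp add: abelian_simps)
  then have "n u \<oplus>\<^bsub>M\<^esub> k u = x" using f x by simp
  then show ?thesis using span_closed(4)[OF nu ku] by simp
qed

text \<open>The image of \<open>\<pi>\<close> is a hull of the simple module \<open>R x\<close>, so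
  a corner map is injective on it as soon as it does not kill \<open>x\<close>. If \<open>x'\<close>
  leaves the summand, its component \<open>w\<close> outside is a copy of \<open>x\<close>, and
  passing from \<open>x\<close> to \<open>w\<close> and back gives a corner map \<open>k\<close>
  from two square-zero maps. If \<open>x'\<close> stays inside, \<open>x \<mapsto> x'\<close> yields
  \<open>k\<close> with \<open>k\<close> and \<open>k - \<pi>\<close> both injective, and
  \<open>\<pi>\<close> is their difference.\<close>

lemma second_copy_span:
  assumes t: "minimal_gen t" and t': "t' \<in> carrier R" "left_ann t' = left_ann t" "t' \<noteq> t"
    and \<pi>: "uniform_proj \<pi>" and pt: "\<pi> (t \<odot>\<^bsub>M\<^esub> u) = t \<odot>\<^bsub>M\<^esub> u"
    and reach: "\<And>x. \<lbrakk>x \<in> carrier M; \<pi> x = x; x \<noteq> \<zero>\<^bsub>M\<^esub>\<rbrakk> \<Longrightarrow> \<exists>r\<in>carrier R. r \<odot>\<^bsub>M\<^esub> x = t \<odot>\<^bsub>M\<^esub> u"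
  shows "\<pi> u \<in> span"
proof -
  note p = uniform_projD(1)[OF \<pi>] and pp = uniform_projD(2)[OF \<pi>]
  note pD = module_homD[OF p]
  have tc: "t \<in> carrier R" "t \<noteq> \<zero>" using t by (auto simp: minimal_gen_def)
  define x where "x = t \<odot>\<^bsub>M\<^esub> u"
  define x' where "x' = t' \<odot>\<^bsub>M\<^esub> u"
  have xc: "x \<in> carrier M" "x' \<in> carrier M" using tc t' gen_closed by (auto simp: x_def x'_def)
  have px: "\<pi> x = x" using pt by (simp add: x_def)
  have x_ne: "x \<noteq> \<zero>\<^bsub>M\<^esub>" using gen_faithful tc by (auto simp: x_def)
  have ann: "r \<odot>\<^bsub>M\<^esub> x = \<zero>\<^bsub>M\<^esub> \<longleftrightarrow> r \<odot>\<^bsub>M\<^esub> x' = \<zero>\<^bsub>M\<^esub>" if "r \<in> carrier R" for r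
    unfolding x_def x'_def by (rule left_ann_smult[OF t'(2) that tc(1) t'(1)])
  have inj: "z = \<zero>\<^bsub>M\<^esub>" if g: "g \<in> module_hom R M M" "g x \<noteq> \<zero>\<^bsub>M\<^esub>"
    and z: "z \<in> carrier M" "\<pi> z = z" "g z = \<zero>\<^bsub>M\<^esub>" for g z
  proof (rule ccontr)
    assume "z \<noteq> \<zero>\<^bsub>M\<^esub>"
    then obtain r where r: "r \<in> carrier R" "r \<odot>\<^bsub>M\<^esub> z = x" using reach z by (auto simp: x_def)
    then have "g x = r \<odot>\<^bsub>M\<^esub> g z" using module_homD(3)[OF g(1) r(1) z(1)] by simp
    then show False using g z r by simp
  qed
  have u1: "u \<ominus>\<^bsub>M\<^esub> \<pi> u \<in> carrier M" using gen_closed pD(1) by simp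
  define w where "w = x' \<ominus>\<^bsub>M\<^esub> \<pi> x'"
  have wc: "w \<in> carrier M" using xc pD(1) by (simp add: w_def)
  have pw: "\<pi> w = \<zero>\<^bsub>M\<^esub>" using xc pD(1) pp by (simp add: w_def endo_diff[OF p] module_minus_eq_zero_iff)
  show ?thesis
  proof (cases "w = \<zero>\<^bsub>M\<^esub>")
    case False
    \<comment> \<open>For the harder direction: if \<open>r x \<noteq> 0\<close>, some
      \<open>s r\<close> fixes \<open>x\<close>, hence \<open>x'\<close> by equality of
      annihilators, hence \<open>w\<close>; so \<open>r w\<close> cannot vanish.\<close>
    have annw: "r \<odot>\<^bsub>M\<^esub> w = \<zero>\<^bsub>M\<^esub> \<longleftrightarrow> r \<odot>\<^bsub>M\<^esub> x = \<zero>\<^bsub>M\<^esub>" if r: "r \<in> carrier R" for r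
    proof
      have rw: "r \<odot>\<^bsub>M\<^esub> w = r \<odot>\<^bsub>M\<^esub> x' \<ominus>\<^bsub>M\<^esub> \<pi> (r \<odot>\<^bsub>M\<^esub> x')" if "r \<in> carrier R" for r
        using that xc pD(1,3) by (simp add: w_def M.minus_eq smult_r_distr smult_r_minus)
      {
        assume "r \<odot>\<^bsub>M\<^esub> x = \<zero>\<^bsub>M\<^esub>"
        then have "r \<odot>\<^bsub>M\<^esub> x' = \<zero>\<^bsub>M\<^esub>" using ann r by simp
        then show "r \<odot>\<^bsub>M\<^esub> w = \<zero>\<^bsub>M\<^esub>" using rw[OF r] endo_zero[OF p] by (simp add: a_minus_def)
      }
      assume r0: "r \<odot>\<^bsub>M\<^esub> w = \<zero>\<^bsub>M\<^esub>"
      show "r \<odot>\<^bsub>M\<^esub> x = \<zero>\<^bsub>M\<^esub>"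
      proof (rule ccontr)
        assume "r \<odot>\<^bsub>M\<^esub> x \<noteq> \<zero>\<^bsub>M\<^esub>"
        moreover have "r \<odot>\<^bsub>M\<^esub> x = (r \<otimes> t) \<odot>\<^bsub>M\<^esub> u" using r tc gen_closed by (simp add: x_def smult_assoc1)
        ultimately have "r \<otimes> t \<noteq> \<zero>" using gen_closed by auto
        then obtain s where s: "s \<in> carrier R" "s \<otimes> (r \<otimes> t) = t"
          using t r unfolding minimal_gen_def by blast
        have "(s \<otimes> r) \<odot>\<^bsub>M\<^esub> x = x"
          using s r tc gen_closed by (simp add: x_def R.m_assoc flip: smult_assoc1)
        then have "(\<one> \<ominus> s \<otimes> r) \<odot>\<^bsub>M\<^esub> x = \<zero>\<^bsub>M\<^esub>"
          using s(1) r xc by (simp add: smult_l_diff module_minus_eq_zero_iff)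
        then have "(\<one> \<ominus> s \<otimes> r) \<odot>\<^bsub>M\<^esub> x' = \<zero>\<^bsub>M\<^esub>" using ann s(1) r by simp
        then have sx: "(s \<otimes> r) \<odot>\<^bsub>M\<^esub> x' = x'"
          using s(1) r xc by (simp add: smult_l_diff module_minus_eq_zero_iff)
        have "(s \<otimes> r) \<odot>\<^bsub>M\<^esub> w = w" using rw[of "s \<otimes> r"] sx s(1) r by (simp add: w_def)
        then have "w = s \<odot>\<^bsub>M\<^esub> (r \<odot>\<^bsub>M\<^esub> w)" using s(1) r wc by (simp add: smult_assoc1)
        then show False using r0 s False by simp
      qed
    qed
    obtain f where f: "f \<in> module_hom R M M" "f x = w" using hom_extends_cyclic[OF xc(1) wc] annw by blast
    obtain h where h: "h \<in> module_hom R M M" "h w = x" using hom_extends_cyclic[OF wc xc(1)] annw by blast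
    note fD = module_homD[OF f(1)] and hD = module_homD[OF h(1)]
    \<comment> \<open>The two off-diagonal blocks, from the summand to its complement and back. Each
      has square zero, and their composite fixes \<open>x\<close>.\<close>
    define n1 where "n1 z = f (\<pi> z) \<ominus>\<^bsub>M\<^esub> \<pi> (f (\<pi> z))" for z
    define n2 where "n2 z = \<pi> (h (z \<ominus>\<^bsub>M\<^esub> \<pi> z))" for z
    define k where "k z = n2 (n1 z)" for z
    have n1: "n1 \<in> module_hom R M M" unfolding n1_def
      by (intro endo_sub module_hom_comp[OF _ p] module_hom_comp[OF _ f(1)] p)
    have n2: "n2 \<in> module_hom R M M" unfolding n2_def
      by (intro module_hom_comp[OF _ p] module_hom_comp[OF _ h(1)] endo_sub module_hom_id p)
    have k: "k \<in> module_hom R M M" unfolding k_def by (rule module_hom_comp[OF n1 n2])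
    have "n1 (n1 z) = \<zero>\<^bsub>M\<^esub>" if z: "z \<in> carrier M" for z
    proof -
      have "\<pi> (n1 z) = \<zero>\<^bsub>M\<^esub>" using z pD(1) fD(1) pp
        by (simp add: n1_def endo_diff[OF p] module_minus_eq_zero_iff)
      then show ?thesis using endo_zero[OF f(1)] endo_zero[OF p] n1_def[of "n1 z"] by (simp add: a_minus_def)
    qed
    then have n1u: "n1 u \<in> span" by (rule square_zero_span[OF n1])
    have pn2: "\<pi> (n2 z) = n2 z" "n2 z \<in> carrier M" if z: "z \<in> carrier M" for z
      using z pD(1) hD(1) pp by (auto simp: n2_def)
    have "n2 (n2 z) = \<zero>\<^bsub>M\<^esub>" if z: "z \<in> carrier M" for z
    proof -
      have "n2 z \<ominus>\<^bsub>M\<^esub> \<pi> (n2 z) = \<zero>\<^bsub>M\<^esub>" using pn2[OF z] by (simp add: module_minus_eq_zero_iff)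
      then show ?thesis using endo_zero[OF p] endo_zero[OF h(1)] n2_def[of "n2 z"] by simp
    qed
    then have n2u: "n2 u \<in> span" by (rule square_zero_span[OF n2])
    obtain c where c: "c \<in> carrier R" "n1 u = c \<odot>\<^bsub>M\<^esub> u" using n1u by (rule spanE)
    \<comment> \<open>Square-zero maps send \<open>u\<close> to multiples of \<open>u\<close>, so
      linearity carries this over to composites.\<close>
    have ku: "k u \<in> span"
      unfolding k_def c(2) module_homD(3)[OF n2 c(1) gen_closed] by (rule span_closed(5)[OF c(1) n2u])
    have kx: "k x = x"
    proof -
      have "n1 x = w" using px f pw wc by (simp add: n1_def a_minus_def)
      moreover have "w \<ominus>\<^bsub>M\<^esub> \<zero>\<^bsub>M\<^esub> = w" using wc by (simp add: a_minus_def)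
      then have "n2 w = x" using pw h px by (simp add: n2_def)
      ultimately show ?thesis by (simp add: k_def)
    qed
    have "k u \<oplus>\<^bsub>M\<^esub> (u \<ominus>\<^bsub>M\<^esub> \<pi> u) \<in> span"
    proof (rule uniform_proj_span_aux[OF \<pi> k])
      fix z assume z: "z \<in> carrier M"
      show "k (\<pi> z) = k z" using pp[OF z] by (simp add: k_def n1_def)
      show "\<pi> (k z) = k z" using pn2 module_homD(1)[OF n1 z] by (simp add: k_def)
      assume "\<pi> z = z" "k z = \<zero>\<^bsub>M\<^esub>"
      then show "z = \<zero>\<^bsub>M\<^esub>" using inj[OF k _ z] kx x_ne by simp
    qed
    then have "u \<ominus>\<^bsub>M\<^esub> ((k u \<oplus>\<^bsub>M\<^esub> (u \<ominus>\<^bsub>M\<^esub> \<pi> u)) \<ominus>\<^bsub>M\<^esub> k u) \<in> span"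
      using span_closed(7) gen_in_span ku by blast
    moreover have "u \<ominus>\<^bsub>M\<^esub> ((k u \<oplus>\<^bsub>M\<^esub> (u \<ominus>\<^bsub>M\<^esub> \<pi> u)) \<ominus>\<^bsub>M\<^esub> k u) = \<pi> u"
      using gen_closed pD(1) module_homD(1)[OF k] by (simp add: abelian_simps)
    ultimately show ?thesis by simp
  next
    case True
    then have px': "\<pi> x' = x'" using xc pD(1) by (simp add: w_def module_minus_eq_zero_iff)
    obtain f where f: "f \<in> module_hom R M M" "f x = x'" using hom_extends_cyclic[OF xc] ann by blast
    note fD = module_homD[OF f(1)]
    define k where "k z = \<pi> (f (\<pi> z))" for z
    define j where "j z = k z \<ominus>\<^bsub>M\<^esub> \<pi> z" for z
    have k: "k \<in> module_hom R M M" unfolding k_def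
      by (intro module_hom_comp[OF _ p] module_hom_comp[OF _ f(1)] p)
    have j: "j \<in> module_hom R M M" unfolding j_def by (intro endo_sub p k)
    have kp: "k (\<pi> z) = k z" "\<pi> (k z) = k z" "k z \<in> carrier M" if "z \<in> carrier M" for z
      using that pp pD(1) fD(1) by (auto simp: k_def)
    have kx: "k x = x'" using px px' f by (simp add: k_def)
    have x'_ne: "x' \<noteq> \<zero>\<^bsub>M\<^esub>" using ann[of \<one>] xc x_ne by simp
    \<comment> \<open>Here \<open>t' \<noteq> t\<close> enters: \<open>j x = x' - x\<close>.\<close>
    have jx: "j x \<noteq> \<zero>\<^bsub>M\<^esub>"
    proof
      assume "j x = \<zero>\<^bsub>M\<^esub>"
      then have "x' = x" using kx px xc by (simp add: j_def module_minus_eq_zero_iff)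
      then show False using gen_cancel t' tc by (auto simp: x_def x'_def)
    qed
    have ks: "k u \<oplus>\<^bsub>M\<^esub> (u \<ominus>\<^bsub>M\<^esub> \<pi> u) \<in> span"
      by (rule uniform_proj_span_aux[OF \<pi> k]) (use kp inj[OF k] kx x'_ne in auto)
    have js: "j u \<oplus>\<^bsub>M\<^esub> (u \<ominus>\<^bsub>M\<^esub> \<pi> u) \<in> span"
    proof (rule uniform_proj_span_aux[OF \<pi> j])
      fix z assume z: "z \<in> carrier M"
      show "j (\<pi> z) = j z" using z kp pp pD(1) by (simp add: j_def)
      show "\<pi> (j z) = j z" using z kp pp pD(1) by (simp add: j_def endo_diff[OF p])
      assume "\<pi> z = z" "j z = \<zero>\<^bsub>M\<^esub>"
      then show "z = \<zero>\<^bsub>M\<^esub>" using inj[OF j jx z] by simp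
    qed
    have "(k u \<oplus>\<^bsub>M\<^esub> (u \<ominus>\<^bsub>M\<^esub> \<pi> u)) \<ominus>\<^bsub>M\<^esub> (j u \<oplus>\<^bsub>M\<^esub> (u \<ominus>\<^bsub>M\<^esub> \<pi> u)) \<in> span"
      using span_closed(7)[OF ks js] .
    moreover have "(k u \<oplus>\<^bsub>M\<^esub> (u \<ominus>\<^bsub>M\<^esub> \<pi> u)) \<ominus>\<^bsub>M\<^esub> (j u \<oplus>\<^bsub>M\<^esub> (u \<ominus>\<^bsub>M\<^esub> \<pi> u)) = \<pi> u"
      using gen_closed pD(1) kp by (simp add: j_def abelian_simps)
    ultimately show ?thesis by simp
  qed
qed

text \<open>Because \<open>t = t e\<close>, the ideals \<open>R t\<close> and
  \<open>R (1 - e)\<close> meet trivially, so the projection onto a hull of \<open>R t u\<close> can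
  be chosen to kill \<open>(1 - e) u\<close>. This choice is the source of
  \<open>\<pi> u = e \<pi> u\<close>.\<close>

lemma cyclic_gen_complement:
  assumes e: "idem e" and t: "t \<in> carrier R" "t \<otimes> e = t"
  obtains \<pi> where "\<pi> \<in> module_hom R M M" "\<And>x. x \<in> carrier M \<Longrightarrow> \<pi> (\<pi> x) = \<pi> x"
    "\<pi> (t \<odot>\<^bsub>M\<^esub> u) = t \<odot>\<^bsub>M\<^esub> u" "\<pi> u = e \<odot>\<^bsub>M\<^esub> \<pi> u"
    "\<And>x. \<lbrakk>x \<in> carrier M; \<pi> x \<noteq> \<zero>\<^bsub>M\<^esub>\<rbrakk> \<Longrightarrow> \<exists>r\<in>carrier R. \<exists>s\<in>carrier R.
      r \<odot>\<^bsub>M\<^esub> \<pi> x = (s \<otimes> t) \<odot>\<^bsub>M\<^esub> u \<and> s \<otimes> t \<noteq> \<zero>"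
proof -
  have ec: "e \<in> carrier R" "e \<otimes> e = e" using e by (auto simp: idem_def)
  let ?x = "t \<odot>\<^bsub>M\<^esub> u" and ?y = "(\<one> \<ominus> e) \<odot>\<^bsub>M\<^esub> u"
  let ?N = "{r \<odot>\<^bsub>M\<^esub> ?x | r. r \<in> carrier R}" and ?V = "{r \<odot>\<^bsub>M\<^esub> ?y | r. r \<in> carrier R}"
  have xy: "?x \<in> carrier M" "?y \<in> carrier M" using t ec gen_closed by auto
  note N = submodule_cyclic[OF xy(1)] and V = submodule_cyclic[OF xy(2)]
  have "z = \<zero>\<^bsub>M\<^esub>" if z: "z \<in> ?N" "z \<in> ?V" for z
  proof -
    obtain r s where rs: "r \<in> carrier R" "s \<in> carrier R" "z = r \<odot>\<^bsub>M\<^esub> ?x" "z = s \<odot>\<^bsub>M\<^esub> ?y"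
      using z by auto
    then have "(r \<otimes> t) \<odot>\<^bsub>M\<^esub> u = (s \<otimes> (\<one> \<ominus> e)) \<odot>\<^bsub>M\<^esub> u" using t ec gen_closed by (simp add: smult_assoc1)
    then have eq: "r \<otimes> t = s \<otimes> (\<one> \<ominus> e)" by (rule gen_cancel[rotated 2]) (use rs t ec in auto)
    have "r \<otimes> t = (r \<otimes> t) \<otimes> e" using rs(1) t ec by (simp add: R.m_assoc)
    also have "\<dots> = s \<otimes> ((\<one> \<ominus> e) \<otimes> e)" using rs(2) ec by (simp add: eq R.m_assoc)
    also have "(\<one> \<ominus> e) \<otimes> e = \<zero>" using ec by (simp add: minus_distr_l minus_eq_zero_iff)
    finally have "r \<otimes> t = \<zero>" using rs by simp
    then have "(r \<otimes> t) \<odot>\<^bsub>M\<^esub> u = \<zero>\<^bsub>M\<^esub>" using gen_closed by simp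
    then show ?thesis using rs t gen_closed by (simp add: smult_assoc1)
  qed
  then have NV: "?N \<inter> ?V = {\<zero>\<^bsub>M\<^esub>}" using submoduleD(3)[OF N] submoduleD(3)[OF V] by blast
  obtain \<pi> where \<pi>: "\<pi> \<in> module_hom R M M" "\<And>x. x \<in> carrier M \<Longrightarrow> \<pi> (\<pi> x) = \<pi> x"
    "\<And>x. x \<in> ?N \<Longrightarrow> \<pi> x = x" "\<And>x. x \<in> ?V \<Longrightarrow> \<pi> x = \<zero>\<^bsub>M\<^esub>"
    "\<And>x. \<lbrakk>x \<in> carrier M; \<pi> x \<noteq> \<zero>\<^bsub>M\<^esub>\<rbrakk> \<Longrightarrow> \<exists>r\<in>carrier R. r \<odot>\<^bsub>M\<^esub> \<pi> x \<in> ?N \<and> r \<odot>\<^bsub>M\<^esub> \<pi> x \<noteq> \<zero>\<^bsub>M\<^esub>"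
    by (rule hull_idempotent[OF N V NV]) blast
  note pD = module_homD[OF \<pi>(1)]
  show thesis
  proof (rule that[OF \<pi>(1,2)])
    have "?x = \<one> \<odot>\<^bsub>M\<^esub> ?x" using xy by simp
    then have "?x \<in> ?N" using R.one_closed by blast
    then show "\<pi> ?x = ?x" by (rule \<pi>(3))
    have "?y = \<one> \<odot>\<^bsub>M\<^esub> ?y" using xy by simp
    then have "?y \<in> ?V" using R.one_closed by blast
    then have "\<pi> ?y = \<zero>\<^bsub>M\<^esub>" by (rule \<pi>(4))
    then have "(\<one> \<ominus> e) \<odot>\<^bsub>M\<^esub> \<pi> u = \<zero>\<^bsub>M\<^esub>" using pD(3) ec gen_closed by simp
    then show "\<pi> u = e \<odot>\<^bsub>M\<^esub> \<pi> u" using ec gen_closed pD(1) by (simp add: smult_l_diff module_minus_eq_zero_iff)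
  next
    fix x assume x: "x \<in> carrier M" "\<pi> x \<noteq> \<zero>\<^bsub>M\<^esub>"
    then obtain r s where rs: "r \<in> carrier R" "s \<in> carrier R" "r \<odot>\<^bsub>M\<^esub> \<pi> x = s \<odot>\<^bsub>M\<^esub> ?x" "r \<odot>\<^bsub>M\<^esub> \<pi> x \<noteq> \<zero>\<^bsub>M\<^esub>"
      using \<pi>(5)[OF x] by auto
    have "s \<odot>\<^bsub>M\<^esub> ?x = (s \<otimes> t) \<odot>\<^bsub>M\<^esub> u" using rs t gen_closed by (simp add: smult_assoc1)
    moreover have "s \<otimes> t \<noteq> \<zero>" using rs calculation gen_closed by auto
    ultimately show "\<exists>r\<in>carrier R. \<exists>s\<in>carrier R. r \<odot>\<^bsub>M\<^esub> \<pi> x = (s \<otimes> t) \<odot>\<^bsub>M\<^esub> u \<and> s \<otimes> t \<noteq> \<zero>"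
      using rs by auto
  qed
qed

text \<open>The projection sends \<open>u\<close> to \<open>g u\<close> for an idempotent
  \<open>g\<close> of the ring. Primitivity of \<open>e\<close> gives \<open>g e = e\<close>, so
  right multiplication by \<open>g\<close> embeds \<open>R e\<close> into the image of
  \<open>\<pi>\<close>, a uniform module.\<close>

lemma uniform_idem_if_second_copy:
  assumes e: "primitive e" and t: "minimal_gen t" "t \<otimes> e = t"
    and t': "t' \<in> carrier R" "left_ann t' = left_ann t" "t' \<noteq> t"
  shows "uniform_idem e"
proof -
  have ec: "e \<in> carrier R" "e \<otimes> e = e" "idem e" using e by (auto simp: primitive_def idem_def)
  have tc: "t \<in> carrier R" "t \<noteq> \<zero>" using t by (auto simp: minimal_gen_def)
  obtain \<pi> where \<pi>: "\<pi> \<in> module_hom R M M" "\<And>x. x \<in> carrier M \<Longrightarrow> \<pi> (\<pi> x) = \<pi> x"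
    "\<pi> (t \<odot>\<^bsub>M\<^esub> u) = t \<odot>\<^bsub>M\<^esub> u" "\<pi> u = e \<odot>\<^bsub>M\<^esub> \<pi> u"
    "\<And>x. \<lbrakk>x \<in> carrier M; \<pi> x \<noteq> \<zero>\<^bsub>M\<^esub>\<rbrakk> \<Longrightarrow> \<exists>r\<in>carrier R. \<exists>s\<in>carrier R.
      r \<odot>\<^bsub>M\<^esub> \<pi> x = (s \<otimes> t) \<odot>\<^bsub>M\<^esub> u \<and> s \<otimes> t \<noteq> \<zero>"
    by (rule cyclic_gen_complement[OF ec(3) tc(1) t(2)]) blast
  note pD = module_homD[OF \<pi>(1)]
  have reach: "\<exists>r\<in>carrier R. r \<odot>\<^bsub>M\<^esub> x = t \<odot>\<^bsub>M\<^esub> u"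
    if x: "x \<in> carrier M" "\<pi> x = x" "x \<noteq> \<zero>\<^bsub>M\<^esub>" for x
  proof -
    obtain r s where rs: "r \<in> carrier R" "s \<in> carrier R" "r \<odot>\<^bsub>M\<^esub> x = (s \<otimes> t) \<odot>\<^bsub>M\<^esub> u" "s \<otimes> t \<noteq> \<zero>"
      using \<pi>(5)[OF x(1)] x(2,3) by auto
    then obtain q where q: "q \<in> carrier R" "q \<otimes> (s \<otimes> t) = t" using t(1) unfolding minimal_gen_def by blast
    have "(q \<otimes> r) \<odot>\<^bsub>M\<^esub> x = q \<odot>\<^bsub>M\<^esub> ((s \<otimes> t) \<odot>\<^bsub>M\<^esub> u)" using q rs x by (simp add: smult_assoc1)
    also have "\<dots> = t \<odot>\<^bsub>M\<^esub> u" using q rs(2) tc gen_closed by (simp flip: smult_assoc1)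
    finally show ?thesis using q rs by blast
  qed
  have tu: "t \<odot>\<^bsub>M\<^esub> u \<noteq> \<zero>\<^bsub>M\<^esub>" using gen_faithful tc by blast
  have \<pi>u: "uniform_proj \<pi>"
    unfolding uniform_proj_def
  proof (intro conjI ballI impI; (elim conjE)?)
    fix x y assume x: "x \<in> carrier M" "\<pi> x = x" "x \<noteq> \<zero>\<^bsub>M\<^esub>" and y: "y \<in> carrier M" "\<pi> y = y" "y \<noteq> \<zero>\<^bsub>M\<^esub>"
    obtain r s where "r \<in> carrier R" "r \<odot>\<^bsub>M\<^esub> x = t \<odot>\<^bsub>M\<^esub> u" "s \<in> carrier R" "s \<odot>\<^bsub>M\<^esub> y = t \<odot>\<^bsub>M\<^esub> u"
      using reach x y by metis
    then show "\<exists>r\<in>carrier R. \<exists>s\<in>carrier R. r \<odot>\<^bsub>M\<^esub> x = s \<odot>\<^bsub>M\<^esub> y \<and> r \<odot>\<^bsub>M\<^esub> x \<noteq> \<zero>\<^bsub>M\<^esub>"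
      using tu by (intro bexI[of _ r] bexI[of _ s]) auto
  qed (use \<pi> in auto)
  have "\<pi> u \<in> span" by (rule second_copy_span[OF t(1) t' \<pi>u \<pi>(3) reach])
  then obtain g where g: "g \<in> carrier R" "\<pi> u = g \<odot>\<^bsub>M\<^esub> u" by (rule spanE)
  have eg: "e \<otimes> g = g"
    by (rule gen_cancel) (use \<pi>(4) g ec gen_closed in \<open>simp_all add: smult_assoc1\<close>)
  have tg: "t \<otimes> g = t"
    by (rule gen_cancel) (use \<pi>(3) pD(3)[OF tc(1) gen_closed] g tc gen_closed in \<open>simp_all add: smult_assoc1\<close>)
  have gg: "g \<otimes> g = g"
  proof (rule gen_cancel)
    show "(g \<otimes> g) \<odot>\<^bsub>M\<^esub> u = g \<odot>\<^bsub>M\<^esub> u"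
      using \<pi>(2)[OF gen_closed] g pD(3)[OF g(1) gen_closed] gen_closed by (simp add: smult_assoc1)
  qed (use g in auto)
  \<comment> \<open>\<open>g\<close> itself need not lie in \<open>e R e\<close>; \<open>g e\<close>
    does, it is again idempotent, and it is nonzero because it fixes \<open>t\<close>.\<close>
  define h where "h = g \<otimes> e"
  have hc: "h \<in> carrier R" using g ec by (simp add: h_def)
  have "h \<otimes> h = g \<otimes> (e \<otimes> g) \<otimes> e" using g(1) ec by (simp add: h_def R.m_assoc)
  then have hh: "h \<otimes> h = h" using eg gg by (simp add: h_def)
  have eh: "e \<otimes> h = h" using m_assoc[OF ec(1) g(1) ec(1)] eg by (simp add: h_def)
  have he: "h \<otimes> e = h" using g(1) ec by (simp add: h_def R.m_assoc)
  have "t \<otimes> h = t" using m_assoc[OF tc(1) g(1) ec(1)] tg t(2) by (simp add: h_def)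
  then have "h \<noteq> \<zero>" using tc by auto
  then have ge: "g \<otimes> e = e" using e hc hh eh he unfolding primitive_def idem_def h_def by blast
  show ?thesis
    unfolding uniform_idem_def
  proof (intro conjI ballI impI; (elim conjE)?)
    fix x y assume x: "x \<in> carrier R" "x \<otimes> e = x" "x \<noteq> \<zero>" and y: "y \<in> carrier R" "y \<otimes> e = y" "y \<noteq> \<zero>"
    have xge: "(x \<otimes> g) \<otimes> e = x" if "x \<in> carrier R" "x \<otimes> e = x" for x
      using that g(1) ec ge by (simp add: R.m_assoc)
    have im: "\<pi> ((x \<otimes> g) \<odot>\<^bsub>M\<^esub> u) = (x \<otimes> g) \<odot>\<^bsub>M\<^esub> u \<and> (x \<otimes> g) \<odot>\<^bsub>M\<^esub> u \<noteq> \<zero>\<^bsub>M\<^esub> \<and> (x \<otimes> g) \<odot>\<^bsub>M\<^esub> u \<in> carrier M"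
      if x: "x \<in> carrier R" "x \<otimes> e = x" "x \<noteq> \<zero>" for x
    proof -
      have "(x \<otimes> g) \<odot>\<^bsub>M\<^esub> u = \<pi> (x \<odot>\<^bsub>M\<^esub> u)" using x(1) g gen_closed pD(3) by (simp add: smult_assoc1)
      moreover have "x \<otimes> g \<noteq> \<zero>" using xge[OF x(1,2)] x(3) ec by auto
      ultimately show ?thesis using \<pi>(2) pD(1) x(1) g gen_closed gen_faithful[of "x \<otimes> g"] by auto
    qed
    obtain r s where rs: "r \<in> carrier R" "s \<in> carrier R"
        "r \<odot>\<^bsub>M\<^esub> ((x \<otimes> g) \<odot>\<^bsub>M\<^esub> u) = s \<odot>\<^bsub>M\<^esub> ((y \<otimes> g) \<odot>\<^bsub>M\<^esub> u)" "r \<odot>\<^bsub>M\<^esub> ((x \<otimes> g) \<odot>\<^bsub>M\<^esub> u) \<noteq> \<zero>\<^bsub>M\<^esub>"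
      using uniform_projD(3)[OF \<pi>u] im[OF x] im[OF y] by blast
    have eq: "r \<otimes> (x \<otimes> g) = s \<otimes> (y \<otimes> g)"
      by (rule gen_cancel) (use rs x(1) y(1) g(1) gen_closed in \<open>simp_all add: smult_assoc1\<close>)
    have "r \<otimes> x = (r \<otimes> (x \<otimes> g)) \<otimes> e" using rs(1) x g(1) ec ge by (simp add: R.m_assoc)
    also have "\<dots> = s \<otimes> y" unfolding eq using rs(2) y g(1) ec ge by (simp add: R.m_assoc)
    finally have "r \<otimes> x = s \<otimes> y" .
    moreover have "r \<otimes> x \<noteq> \<zero>"
    proof
      assume "r \<otimes> x = \<zero>"
      then have "r \<otimes> (x \<otimes> g) = \<zero>" using m_assoc[OF rs(1) x(1) g(1)] g by simp
      then have "(r \<otimes> (x \<otimes> g)) \<odot>\<^bsub>M\<^esub> u = \<zero>\<^bsub>M\<^esub>" using gen_closed by simp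
      then show False using rs x(1) g(1) gen_closed by (simp add: smult_assoc1)
    qed
    ultimately show "\<exists>r\<in>carrier R. \<exists>s\<in>carrier R. r \<otimes> x = s \<otimes> y \<and> r \<otimes> x \<noteq> \<zero>" using rs by blast
  qed (rule ec(3))
qed

text \<open>With \<open>t = f\<close> the projection satisfies \<open>\<pi> u = f u\<close>, which
  lies in \<open>span\<close>, and its image inherits uniformity from the essential submodule
  \<open>R f u\<close>. Therefore the hull of \<open>R f\<close> lies inside the ring.\<close>

lemma uniform_idem_hull:
  assumes f: "uniform_idem f"
  obtains \<pi> where "uniform_proj \<pi>" "\<pi> u = f \<odot>\<^bsub>M\<^esub> u"
    "\<And>x. \<lbrakk>x \<in> carrier M; \<pi> x = x\<rbrakk> \<Longrightarrow> x \<in> span"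
proof -
  have fc: "f \<in> carrier R" "f \<otimes> f = f" "idem f" using f by (auto simp: uniform_idem_def idem_def)
  obtain \<pi> where \<pi>: "\<pi> \<in> module_hom R M M" "\<And>x. x \<in> carrier M \<Longrightarrow> \<pi> (\<pi> x) = \<pi> x"
    "\<pi> (f \<odot>\<^bsub>M\<^esub> u) = f \<odot>\<^bsub>M\<^esub> u" "\<pi> u = f \<odot>\<^bsub>M\<^esub> \<pi> u"
    "\<And>x. \<lbrakk>x \<in> carrier M; \<pi> x \<noteq> \<zero>\<^bsub>M\<^esub>\<rbrakk> \<Longrightarrow> \<exists>r\<in>carrier R. \<exists>s\<in>carrier R.
      r \<odot>\<^bsub>M\<^esub> \<pi> x = (s \<otimes> f) \<odot>\<^bsub>M\<^esub> u \<and> s \<otimes> f \<noteq> \<zero>"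
    by (rule cyclic_gen_complement[OF fc(3,1,2)]) blast
  note pD = module_homD[OF \<pi>(1)]
  have pu: "\<pi> u = f \<odot>\<^bsub>M\<^esub> u" using \<pi>(3,4) pD(3)[OF fc(1) gen_closed] by simp
  have uni: "uniform_proj \<pi>"
    unfolding uniform_proj_def
  proof (intro conjI ballI impI; (elim conjE)?)
    fix x y assume x: "x \<in> carrier M" "\<pi> x = x" "x \<noteq> \<zero>\<^bsub>M\<^esub>" and y: "y \<in> carrier M" "\<pi> y = y" "y \<noteq> \<zero>\<^bsub>M\<^esub>"
    obtain r a where ra: "r \<in> carrier R" "a \<in> carrier R" "r \<odot>\<^bsub>M\<^esub> x = (a \<otimes> f) \<odot>\<^bsub>M\<^esub> u" "a \<otimes> f \<noteq> \<zero>"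
      using \<pi>(5)[OF x(1)] x(2,3) by auto
    obtain s b where sb: "s \<in> carrier R" "b \<in> carrier R" "s \<odot>\<^bsub>M\<^esub> y = (b \<otimes> f) \<odot>\<^bsub>M\<^esub> u" "b \<otimes> f \<noteq> \<zero>"
      using \<pi>(5)[OF y(1)] y(2,3) by auto
    have c: "a \<otimes> f \<in> carrier R" "b \<otimes> f \<in> carrier R" "(a \<otimes> f) \<otimes> f = a \<otimes> f" "(b \<otimes> f) \<otimes> f = b \<otimes> f"
      using ra sb fc by (simp_all add: R.m_assoc)
    obtain p q where pq: "p \<in> carrier R" "q \<in> carrier R" "p \<otimes> (a \<otimes> f) = q \<otimes> (b \<otimes> f)" "p \<otimes> (a \<otimes> f) \<noteq> \<zero>"
      using f c ra(4) sb(4) unfolding uniform_idem_def by blast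
    have 1: "(p \<otimes> r) \<odot>\<^bsub>M\<^esub> x = (p \<otimes> (a \<otimes> f)) \<odot>\<^bsub>M\<^esub> u"
      using pq(1) ra(1,3) c(1) x(1) gen_closed by (simp add: smult_assoc1)
    have 2: "(q \<otimes> s) \<odot>\<^bsub>M\<^esub> y = (q \<otimes> (b \<otimes> f)) \<odot>\<^bsub>M\<^esub> u"
      using pq(2) sb(1,3) c(2) y(1) gen_closed by (simp add: smult_assoc1)
    have "(p \<otimes> r) \<odot>\<^bsub>M\<^esub> x = (q \<otimes> s) \<odot>\<^bsub>M\<^esub> y" unfolding 1 2 pq(3) ..
    moreover have "(p \<otimes> r) \<odot>\<^bsub>M\<^esub> x \<noteq> \<zero>\<^bsub>M\<^esub>"
      unfolding 1 using gen_faithful[of "p \<otimes> (a \<otimes> f)"] pq(1,4) c(1) by blast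
    ultimately show "\<exists>r\<in>carrier R. \<exists>s\<in>carrier R. r \<odot>\<^bsub>M\<^esub> x = s \<odot>\<^bsub>M\<^esub> y \<and> r \<odot>\<^bsub>M\<^esub> x \<noteq> \<zero>\<^bsub>M\<^esub>"
      using pq(1,2) ra(1) sb(1) by blast
  qed (use \<pi> in auto)
  have "\<pi> u \<in> span" unfolding pu span_def using fc by blast
  then show thesis using that[OF uni pu] uniform_proj_image_span[OF uni] by blast
qed

text \<open>Extend \<open>t \<mapsto> t'\<close> to an endomorphism \<open>h\<close> of the hull and
  project \<open>h (e u)\<close> onto the hull of \<open>R f\<close>. Since that hull lies in
  \<open>span\<close>, the result is \<open>c u\<close> with \<open>c\<close> in the ring.\<close>

lemma uniform_idem_transfer:
  assumes e: "uniform_idem e" and f: "uniform_idem f" and t: "minimal_gen t" "t \<otimes> e = t"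
    and t': "t' \<in> carrier R" "t' \<otimes> f = t'" "left_ann t' = left_ann t"
  shows "\<exists>c\<in>carrier R. e \<otimes> c = c \<and> c \<otimes> f = c \<and> t \<otimes> c = t'"
proof -
  have fc: "f \<in> carrier R" and ec: "e \<in> carrier R" "e \<otimes> e = e"
    using e f by (auto simp: uniform_idem_def idem_def)
  have tc: "t \<in> carrier R" using t by (auto simp: minimal_gen_def)
  obtain \<pi> where \<pi>: "uniform_proj \<pi>" "\<pi> u = f \<odot>\<^bsub>M\<^esub> u" "\<And>x. \<lbrakk>x \<in> carrier M; \<pi> x = x\<rbrakk> \<Longrightarrow> x \<in> span"
    by (rule uniform_idem_hull[OF f]) blast
  note pD = module_homD[OF uniform_projD(1)[OF \<pi>(1)]] and pp = uniform_projD(2)[OF \<pi>(1)]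
  obtain h where h: "h \<in> module_hom R M M" "h (t \<odot>\<^bsub>M\<^esub> u) = t' \<odot>\<^bsub>M\<^esub> u"
    using hom_extends_cyclic[of "t \<odot>\<^bsub>M\<^esub> u" "t' \<odot>\<^bsub>M\<^esub> u"] left_ann_smult[OF t'(3) _ tc t'(1)] tc t'(1) gen_closed
    by auto
  note hD = module_homD[OF h(1)]
  define y where "y = \<pi> (h (e \<odot>\<^bsub>M\<^esub> u))"
  have yc: "y \<in> carrier M" "\<pi> y = y" using ec gen_closed pD(1) hD(1) pp by (auto simp: y_def)
  then obtain c where c: "c \<in> carrier R" "y = c \<odot>\<^bsub>M\<^esub> u" using \<pi>(3) spanE by blast
  have smult_y: "r \<odot>\<^bsub>M\<^esub> y = \<pi> (h ((r \<otimes> e) \<odot>\<^bsub>M\<^esub> u))" if "r \<in> carrier R" for r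
    using that ec gen_closed pD hD by (simp add: y_def smult_assoc1)
  have "e \<otimes> c = c"
  proof (rule gen_cancel)
    have "e \<odot>\<^bsub>M\<^esub> y = y" using smult_y[OF ec(1)] ec by (simp add: y_def)
    then show "(e \<otimes> c) \<odot>\<^bsub>M\<^esub> u = c \<odot>\<^bsub>M\<^esub> u" using c ec gen_closed by (simp add: smult_assoc1)
  qed (use ec c in auto)
  moreover have "c \<otimes> f = c"
  proof (rule gen_cancel)
    show "(c \<otimes> f) \<odot>\<^bsub>M\<^esub> u = c \<odot>\<^bsub>M\<^esub> u"
      using yc(2) c pD(3)[OF c(1) gen_closed] \<pi>(2) fc gen_closed by (simp add: smult_assoc1)
  qed (use fc c in auto)
  moreover have "t \<otimes> c = t'"
  proof (rule gen_cancel)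
    have "t \<odot>\<^bsub>M\<^esub> y = \<pi> (t' \<odot>\<^bsub>M\<^esub> u)" using smult_y[OF tc] t(2) h(2) by simp
    also have "\<dots> = t' \<odot>\<^bsub>M\<^esub> (f \<odot>\<^bsub>M\<^esub> u)" using pD(3)[OF t'(1) gen_closed] \<pi>(2) by simp
    also have "\<dots> = t' \<odot>\<^bsub>M\<^esub> u" using t' fc gen_closed by (simp flip: smult_assoc1)
    finally show "(t \<otimes> c) \<odot>\<^bsub>M\<^esub> u = t' \<odot>\<^bsub>M\<^esub> u" using c tc gen_closed by (simp add: smult_assoc1)
  qed (use tc c t' in auto)
  ultimately show ?thesis using c by blast
qed

text \<open>Adding the projections onto the hulls of the uniform \<open>R e\<close> gives
  \<open>p\<close> with \<open>p u = u\<close> and image in \<open>span\<close>. It is the identity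
  on the essential submodule \<open>span\<close>, hence injective with essential image, hence onto.
  No orthogonality of the projections is involved.\<close>

theorem span_eq_carrier: "span = carrier M"
proof -
  interpret left_dcc_hull R
    by unfold_locales (fact uniform_idem_if_second_copy, fact uniform_idem_transfer)
  obtain F where F: "finite F" "\<And>e. e \<in> F \<Longrightarrow> uniform_idem e" "finsum R (\<lambda>x. x) F = \<one>"
    by (rule one_finsum_uniform_idems) blast
  have "\<exists>p\<in>module_hom R M M. p u = finsum R (\<lambda>x. x) G \<odot>\<^bsub>M\<^esub> u \<and> p ` carrier M \<subseteq> span"
    if "G \<subseteq> F" for G
    using finite_subset[OF that F(1)] that
  proof (induction G)
    case empty
    show ?case
    proof (intro bexI conjI)
      show "(\<lambda>x. \<zero>\<^bsub>M\<^esub>) \<in> module_hom R M M" by (rule module_homI) auto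
    qed (use gen_closed span_closed(3) in auto)
  next
    case (insert e G)
    then obtain p where p: "p \<in> module_hom R M M" "p u = finsum R (\<lambda>x. x) G \<odot>\<^bsub>M\<^esub> u" "p ` carrier M \<subseteq> span"
      by auto
    have eF: "uniform_idem e" using F insert by auto
    have FR: "F \<subseteq> carrier R" using F(2) by (auto simp: uniform_idem_def idem_def)
    obtain \<pi> where \<pi>: "uniform_proj \<pi>" "\<pi> u = e \<odot>\<^bsub>M\<^esub> u" "\<And>x. \<lbrakk>x \<in> carrier M; \<pi> x = x\<rbrakk> \<Longrightarrow> x \<in> span"
      by (rule uniform_idem_hull[OF eF]) blast
    note pD = module_homD[OF uniform_projD(1)[OF \<pi>(1)]] and pp = uniform_projD(2)[OF \<pi>(1)]
    show ?case
    proof (intro bexI conjI)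
      show "(\<lambda>x. \<pi> x \<oplus>\<^bsub>M\<^esub> p x) \<in> module_hom R M M" by (rule endo_add[OF uniform_projD(1)[OF \<pi>(1)] p(1)])
      have "finsum R (\<lambda>x. x) (insert e G) = e \<oplus> finsum R (\<lambda>x. x) G"
        using insert FR by (intro R.finsum_insert) auto
      moreover have "finsum R (\<lambda>x. x) G \<in> carrier R" using insert FR by (intro R.finsum_closed) auto
      moreover have "e \<in> carrier R" using insert FR by blast
      ultimately show "\<pi> u \<oplus>\<^bsub>M\<^esub> p u = finsum R (\<lambda>x. x) (insert e G) \<odot>\<^bsub>M\<^esub> u"
        using \<pi>(2) p(2) gen_closed by (simp add: smult_l_distr)
      show "(\<lambda>x. \<pi> x \<oplus>\<^bsub>M\<^esub> p x) ` carrier M \<subseteq> span"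
        using p(3) \<pi>(3) pp pD(1) span_closed(4) by (auto simp: image_subset_iff)
    qed
  qed
  then obtain p where p: "p \<in> module_hom R M M" "p u = u" "p ` carrier M \<subseteq> span"
    using F(3) gen_closed by (metis order_refl smult_one)
  note pD = module_homD[OF p(1)]
  have p_span: "p x = x" if "x \<in> span" for x
    using that pD(3)[OF _ gen_closed] p(2) by (auto elim!: spanE)
  have "module_automorphism R M p"
  proof (rule automorphism_if_essential_image[OF p(1)])
    fix x assume x: "x \<in> carrier M"
    {
      assume nz: "x \<noteq> \<zero>\<^bsub>M\<^esub>"
      obtain r s where rs: "r \<in> carrier R" "s \<in> carrier R" "r \<odot>\<^bsub>M\<^esub> x = s \<odot>\<^bsub>M\<^esub> u" "r \<odot>\<^bsub>M\<^esub> x \<noteq> \<zero>\<^bsub>M\<^esub>"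
        using gen_essential[OF x nz] by blast
      have "p (r \<odot>\<^bsub>M\<^esub> x) = r \<odot>\<^bsub>M\<^esub> x" using p_span rs unfolding span_def by blast
      then have px: "p x \<noteq> \<zero>\<^bsub>M\<^esub>" using pD(3)[OF rs(1) x] rs by auto
      have "r \<odot>\<^bsub>M\<^esub> x = p (r \<odot>\<^bsub>M\<^esub> x)" using \<open>p (r \<odot>\<^bsub>M\<^esub> x) = r \<odot>\<^bsub>M\<^esub> x\<close> by simp
      then have ess: "\<exists>r\<in>carrier R. \<exists>y\<in>carrier M. r \<odot>\<^bsub>M\<^esub> x = p y \<and> r \<odot>\<^bsub>M\<^esub> x \<noteq> \<zero>\<^bsub>M\<^esub>"
        using rs x by blast
      note px ess
    } note * = this
    show "p x = \<zero>\<^bsub>M\<^esub> \<Longrightarrow> x = \<zero>\<^bsub>M\<^esub>" using *(1) by blast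
    show "x \<noteq> \<zero>\<^bsub>M\<^esub> \<Longrightarrow> \<exists>r\<in>carrier R. \<exists>y\<in>carrier M. r \<odot>\<^bsub>M\<^esub> x = p y \<and> r \<odot>\<^bsub>M\<^esub> x \<noteq> \<zero>\<^bsub>M\<^esub>"
      using *(2) by blast
  qed
  then have "p ` carrier M = carrier M" by (simp add: module_automorphism_def bij_betw_def)
  then show ?thesis using p(3) span_closed(1) by blast
qed

end

section \<open>Right perfect rings\<close>

lemma left_module_image:
  assumes F: "left_module R F" and car: "carrier M = q ` carrier F"
    and zero: "\<zero>\<^bsub>M\<^esub> = q \<zero>\<^bsub>F\<^esub>"
    and add: "\<And>x y. \<lbrakk>x \<in> carrier F; y \<in> carrier F\<rbrakk> \<Longrightarrow> q x \<oplus>\<^bsub>M\<^esub> q y = q (x \<oplus>\<^bsub>F\<^esub> y)"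
    and smult: "\<And>a x. \<lbrakk>a \<in> carrier R; x \<in> carrier F\<rbrakk> \<Longrightarrow> a \<odot>\<^bsub>M\<^esub> q x = q (a \<odot>\<^bsub>F\<^esub> x)"
  shows "left_module R M" "q \<in> module_hom R F M"
proof -
  interpret F: left_module R F by fact
  have "abelian_group M"
  proof (rule abelian_groupI)
    fix x assume "x \<in> carrier M"
    then obtain v where v: "v \<in> carrier F" "x = q v" using car by auto
    then have "q (\<ominus>\<^bsub>F\<^esub> v) \<oplus>\<^bsub>M\<^esub> x = \<zero>\<^bsub>M\<^esub>" using add zero by (simp add: F.M.l_neg)
    then show "\<exists>y\<in>carrier M. y \<oplus>\<^bsub>M\<^esub> x = \<zero>\<^bsub>M\<^esub>" using v car by blast
  qed (use car zero add F.M.a_ac in auto)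
  then show "left_module R M"
    by (intro left_module.intro left_module_axioms.intro F.R.ring_axioms)
      (use car add smult F.smult_l_distr F.smult_r_distr F.smult_assoc1 in auto)
  show "q \<in> module_hom R F M" using car add smult by (intro module_homI) auto
qed

text \<open>An isomorphic copy on the type \<open>'c\<close>: notions with a type argument
  \<open>'u\<close> see only modules with carrier in \<open>'u\<close>, while the constructions
  below live on function types.\<close>

definition transport_module :: "('b \<Rightarrow> 'c) \<Rightarrow> ('a, 'b, 'n) module_scheme \<Rightarrow> ('a, 'c) module" where
  "transport_module j M = \<lparr>carrier = j ` carrier M, monoid.mult = undefined, one = undefined,
     ring.zero = j \<zero>\<^bsub>M\<^esub>,
     add = (\<lambda>x y. j (inv_into (carrier M) j x \<oplus>\<^bsub>M\<^esub> inv_into (carrier M) j y)),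
     smult = (\<lambda>a x. j (a \<odot>\<^bsub>M\<^esub> inv_into (carrier M) j x))\<rparr>"

lemma carrier_transport_module [simp]: "carrier (transport_module j M) = j ` carrier M"
  by (simp add: transport_module_def)

lemma zero_transport_module [simp]: "\<zero>\<^bsub>transport_module j M\<^esub> = j \<zero>\<^bsub>M\<^esub>"
  by (simp add: transport_module_def)

lemma transport_module:
  assumes M: "left_module R M" and j: "inj_on j (carrier M)"
  shows "left_module R (transport_module j M)" "j \<in> module_hom R M (transport_module j M)"
    "inv_into (carrier M) j \<in> module_hom R (transport_module j M) M"
proof -
  interpret M: left_module R M by fact
  have inv: "inv_into (carrier M) j (j x) = x" if "x \<in> carrier M" for x
    using j that by simp
  note I = left_module_image[OF M, of "transport_module j M" j]
  show "left_module R (transport_module j M)"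
    by (rule I(1)) (simp_all add: transport_module_def inv)
  show j_hom: "j \<in> module_hom R M (transport_module j M)"
    by (rule I(2)) (simp_all add: transport_module_def inv)
  show "inv_into (carrier M) j \<in> module_hom R (transport_module j M) M"
    by (rule module_homI) (auto simp: inv simp flip: module_homD(2)[OF j_hom] module_homD(3)[OF j_hom])
qed

lemma projective_lift:
  fixes ja :: "'b \<Rightarrow> 'u" and jb :: "'c \<Rightarrow> 'u"
    and A :: "('a, 'b, 'k) module_scheme" and B :: "('a, 'c, 'l) module_scheme"
  assumes P: "projective_module TYPE('u) R P" and A: "left_module R A" and B: "left_module R B"
    and f: "f \<in> module_hom R A B" "f ` carrier A = carrier B" and g: "g \<in> module_hom R P B"
    and ja: "inj_on ja (carrier A)" and jb: "inj_on jb (carrier B)"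
  obtains h where "h \<in> module_hom R P A" "\<And>x. x \<in> carrier P \<Longrightarrow> f (h x) = g x"
proof -
  note TA = transport_module[OF A ja] and TB = transport_module[OF B jb]
  let ?ia = "inv_into (carrier A) ja"
  let ?f = "\<lambda>x. jb (f (?ia x))"
  have f': "?f \<in> module_hom R (transport_module ja A) (transport_module jb B)"
    by (rule module_hom_comp[OF module_hom_comp[OF TA(3) f(1)] TB(2)])
  have surj: "?f ` carrier (transport_module ja A) = carrier (transport_module jb B)"
    using ja f(2) by (force simp: image_image)
  have g': "(\<lambda>x. jb (g x)) \<in> module_hom R P (transport_module jb B)"
    by (rule module_hom_comp[OF g TB(2)])
  obtain h where h: "h \<in> module_hom R P (transport_module ja A)" "\<forall>x\<in>carrier P. ?f (h x) = jb (g x)"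
    using P TA(1) TB(1) f' surj g' unfolding projective_module_def by meson
  show thesis
  proof (rule that)
    show "(\<lambda>x. ?ia (h x)) \<in> module_hom R P A" by (rule module_hom_comp[OF h(1) TA(3)])
    fix x assume x: "x \<in> carrier P"
    have "?ia (h x) \<in> carrier A" using module_homD(1)[OF TA(3)] module_homD(1)[OF h(1) x] by blast
    then have "f (?ia (h x)) \<in> carrier B" using module_homD(1)[OF f(1)] by blast
    moreover have "g x \<in> carrier B" using module_homD(1)[OF g x] .
    ultimately show "f (?ia (h x)) = g x" using h(2) x jb by (auto dest: inj_onD)
  qed
qed

text \<open>The image of \<open>1 - \<xi>\<close> together with \<open>K\<close> is all of
  \<open>P\<close>, so \<open>1 - \<xi>\<close> is onto and has a right inverse
  \<open>\<rho>\<close>. As \<open>\<rho> = 1 + \<xi> \<rho>\<close>, the same reason makes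
  \<open>\<rho>\<close> onto. So \<open>z = \<rho> y\<close>, and
  \<open>y = (1 - \<xi>) z = 0\<close>.\<close>

lemma superfluous_fixpoint:
  assumes P: "projective_module TYPE('u) R P" and j: "inj_on (j :: 'c \<Rightarrow> 'u) (carrier P)"
    and K: "superfluous_submodule K R P"
    and \<xi>: "\<xi> \<in> module_hom R P P" "\<And>x. x \<in> carrier P \<Longrightarrow> \<xi> x \<in> K"
    and z: "z \<in> carrier P" "\<xi> z = z"
  shows "z = \<zero>\<^bsub>P\<^esub>"
proof -
  have lP: "left_module R P" using P by (simp add: projective_module_def)
  interpret P: left_module R P by fact
  note \<xi>D = module_homD[OF \<xi>(1)]
  have Ks: "submodule K R P" using K by (simp add: superfluous_submodule_def)
  have surj: "f ` carrier P = carrier P"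
    if f: "f \<in> module_hom R P P" and sum: "\<And>y. y \<in> carrier P \<Longrightarrow> \<exists>k\<in>K. \<exists>x\<in>carrier P. y = k \<oplus>\<^bsub>P\<^esub> f x" for f
  proof -
    have "K <+>\<^bsub>P\<^esub> f ` carrier P = carrier P"
      using sum P.submoduleD(2)[OF Ks] module_homD(1)[OF f] by (auto simp: set_add_def')
    then show ?thesis using K submodule_image[OF lP lP f] by (auto simp: superfluous_submodule_def)
  qed
  define D where "D x = x \<ominus>\<^bsub>P\<^esub> \<xi> x" for x
  have D: "D \<in> module_hom R P P" unfolding D_def by (intro module_hom_sub[OF lP] module_hom_id \<xi>)
  have "D ` carrier P = carrier P"
  proof (rule surj[OF D])
    fix y assume y: "y \<in> carrier P"
    then have "y = \<xi> y \<oplus>\<^bsub>P\<^esub> D y" using \<xi>D(1) by (simp add: D_def P.abelian_simps)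
    then show "\<exists>k\<in>K. \<exists>x\<in>carrier P. y = k \<oplus>\<^bsub>P\<^esub> D x" using \<xi>(2) y by blast
  qed
  then obtain \<rho> where \<rho>: "\<rho> \<in> module_hom R P P" "\<And>x. x \<in> carrier P \<Longrightarrow> D (\<rho> x) = x"
    using projective_lift[OF P lP lP D _ module_hom_id j j] by metis
  note \<rho>D = module_homD[OF \<rho>(1)]
  have "\<rho> ` carrier P = carrier P"
  proof (rule surj[OF \<rho>(1)])
    fix y assume y: "y \<in> carrier P"
    then have "y = \<ominus>\<^bsub>P\<^esub> \<xi> (\<rho> y) \<oplus>\<^bsub>P\<^esub> \<rho> y" using \<rho>(2)[OF y] \<rho>D(1) \<xi>D(1) by (simp add: D_def P.abelian_simps)
    moreover have "\<ominus>\<^bsub>P\<^esub> \<xi> (\<rho> y) \<in> K" using P.submoduleD(6)[OF Ks] \<xi>(2) \<rho>D(1) y by blast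
    ultimately show "\<exists>k\<in>K. \<exists>x\<in>carrier P. y = k \<oplus>\<^bsub>P\<^esub> \<rho> x" using y by blast
  qed
  then obtain y where y: "y \<in> carrier P" "z = \<rho> y" using z by blast
  have "D z = \<zero>\<^bsub>P\<^esub>" using z by (simp add: D_def P.module_minus_eq_zero_iff)
  then have "y = \<zero>\<^bsub>P\<^esub>" using \<rho>(2) y by simp
  then show ?thesis using y module_hom_zero[OF lP lP \<rho>(1)] by simp
qed

lemma projective_cover_transport:
  fixes j :: "'b \<Rightarrow> 'u" and M :: "('a, 'b, 'n) module_scheme"
  assumes cov: "\<And>M :: ('a, 'u) module. left_module R M \<Longrightarrow>
      \<exists>(P :: ('a, 'u) module) p. projective_cover TYPE('u) R M P p"
    and M: "left_module R M" and j: "inj_on j (carrier M)"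
  obtains P :: "('a, 'u) module" and p where "projective_cover TYPE('u) R M P p"
proof -
  note T = transport_module[OF M j]
  let ?i = "inv_into (carrier M) j"
  obtain P :: "('a, 'u) module" and p where p: "projective_cover TYPE('u) R (transport_module j M) P p"
    using cov[OF T(1)] by blast
  have pD: "p \<in> module_hom R P (transport_module j M)" "p ` carrier P = j ` carrier M"
    using p by (auto simp: projective_cover_def)
  interpret M: left_module R M by fact
  have ker: "?i (p x) = \<zero>\<^bsub>M\<^esub> \<longleftrightarrow> p x = j \<zero>\<^bsub>M\<^esub>" if x: "x \<in> carrier P" for x
  proof -
    obtain y where "y \<in> carrier M" "p x = j y" using pD(2) x by blast
    then show ?thesis using j by (auto dest: inj_onD)
  qed
  have "projective_cover TYPE('u) R M P (\<lambda>x. ?i (p x))"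
    unfolding projective_cover_def
  proof (intro conjI)
    show "projective_module TYPE('u) R P" using p by (simp add: projective_cover_def)
    show "(\<lambda>x. ?i (p x)) \<in> module_hom R P M" by (rule module_hom_comp[OF pD(1) T(3)])
    have "(\<lambda>x. ?i (p x)) ` carrier P = ?i ` (p ` carrier P)" by (simp add: image_image)
    then show "(\<lambda>x. ?i (p x)) ` carrier P = carrier M" using pD(2) j by simp
    have "{x \<in> carrier P. ?i (p x) = \<zero>\<^bsub>M\<^esub>} = {x \<in> carrier P. p x = j \<zero>\<^bsub>M\<^esub>}" using ker by auto
    then show "superfluous_submodule {x \<in> carrier P. ?i (p x) = \<zero>\<^bsub>M\<^esub>} R P"
      using p by (simp add: projective_cover_def)
  qed
  then show thesis by (rule that)
qed

section \<open>The sequential colimit and its projective cover\<close>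

locale ring_sequence = ring +
  fixes a :: "nat \<Rightarrow> 'a"
  assumes seq_closed [simp, intro]: "a n \<in> carrier R"
begin

definition fin_supp :: "(nat \<Rightarrow> 'a) set" where
  "fin_supp = {v. (\<forall>k. v k \<in> carrier R) \<and> (\<exists>m. \<forall>k\<ge>m. v k = \<zero>)}"

definition free_mod :: "('a, nat \<Rightarrow> 'a) module" where
  "free_mod = \<lparr>carrier = fin_supp, monoid.mult = undefined, one = undefined, ring.zero = (\<lambda>_. \<zero>),
     add = (\<lambda>v w k. v k \<oplus> w k), smult = (\<lambda>r v k. r \<otimes> v k)\<rparr>"

lemma free_mod_simps [simp]:
  "carrier free_mod = fin_supp" "\<zero>\<^bsub>free_mod\<^esub> = (\<lambda>_. \<zero>)"
  "v \<oplus>\<^bsub>free_mod\<^esub> w = (\<lambda>k. v k \<oplus> w k)" "r \<odot>\<^bsub>free_mod\<^esub> v = (\<lambda>k. r \<otimes> v k)"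
  by (simp_all add: free_mod_def)

lemma fin_supp_closed [simp]: "v \<in> fin_supp \<Longrightarrow> v k \<in> carrier R"
  by (simp add: fin_supp_def)

lemma fin_supp_bound: "v \<in> fin_supp \<Longrightarrow> \<exists>m. \<forall>k\<ge>m. v k = \<zero>"
  unfolding fin_supp_def by blast

lemma fin_suppI: "\<lbrakk>\<And>k. v k \<in> carrier R; \<And>k. k \<ge> m \<Longrightarrow> v k = \<zero>\<rbrakk> \<Longrightarrow> v \<in> fin_supp"
  unfolding fin_supp_def by blast

lemma fin_supp_common_bound:
  assumes "v \<in> fin_supp" "w \<in> fin_supp"
  obtains m where "\<And>k. k \<ge> m \<Longrightarrow> v k = \<zero>" "\<And>k. k \<ge> m \<Longrightarrow> w k = \<zero>"
proof -
  obtain m n where "\<forall>k\<ge>m. v k = \<zero>" "\<forall>k\<ge>n. w k = \<zero>"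
    using fin_supp_bound[OF assms(1)] fin_supp_bound[OF assms(2)] by blast
  then show thesis by (intro that[of "max m n"]) auto
qed

lemma fin_supp_add:
  assumes "v \<in> fin_supp" "w \<in> fin_supp"
  shows "(\<lambda>k. v k \<oplus> w k) \<in> fin_supp"
proof -
  obtain m where "\<And>k. k \<ge> m \<Longrightarrow> v k = \<zero>" "\<And>k. k \<ge> m \<Longrightarrow> w k = \<zero>"
    by (rule fin_supp_common_bound[OF assms]) blast
  then show ?thesis using assms by (intro fin_suppI[of _ m]) auto
qed

lemma fin_supp_smult:
  assumes "r \<in> carrier R" "v \<in> fin_supp"
  shows "(\<lambda>k. r \<otimes> v k) \<in> fin_supp"
proof -
  obtain m where "\<And>k. k \<ge> m \<Longrightarrow> v k = \<zero>" by (rule fin_supp_common_bound[OF assms(2,2)]) blast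
  then show ?thesis using assms by (intro fin_suppI[of _ m]) auto
qed

lemma left_module_free_mod: "left_module R free_mod"
proof -
  have "abelian_group free_mod"
  proof (rule abelian_groupI)
    fix v assume "v \<in> carrier free_mod"
    then have v: "v \<in> fin_supp" by simp
    obtain m where "\<And>k. k \<ge> m \<Longrightarrow> v k = \<zero>" by (rule fin_supp_common_bound[OF v v]) blast
    then have "(\<lambda>k. \<ominus> v k) \<in> fin_supp" using v by (intro fin_suppI[of _ m]) auto
    then show "\<exists>y\<in>carrier free_mod. y \<oplus>\<^bsub>free_mod\<^esub> v = \<zero>\<^bsub>free_mod\<^esub>"
      using v by (intro bexI[of _ "\<lambda>k. \<ominus> v k"]) (auto simp: l_neg)
  qed (auto simp: fin_supp_add a_ac intro: fin_suppI[of _ 0])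
  then show ?thesis
    by (intro left_module.intro left_module_axioms.intro ring_axioms)
      (auto simp: fin_supp_smult l_distr r_distr m_assoc)
qed

text \<open>
  The colimit of the maps \<open>R \<rightarrow> R \<rightarrow> \<dots>\<close> given by right multiplication with \<open>a 0\<close>, \<open>a 1\<close>, \<dots> is the quotient
  of the free module by the relation \<open>tail_eq\<close>; \<open>stage n\<close> is the map from the span of the first \<open>n\<close> basis vectors
  to the \<open>n\<close>-th copy of \<open>R\<close>.
\<close>

primrec stage :: "nat \<Rightarrow> (nat \<Rightarrow> 'a) \<Rightarrow> 'a" where
  "stage 0 v = \<zero>"
| "stage (Suc n) v = (stage n v \<oplus> v n) \<otimes> a n"

primrec seq_prod :: "nat \<Rightarrow> 'a" where
  "seq_prod 0 = \<one>"
| "seq_prod (Suc n) = seq_prod n \<otimes> a n"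

definition tail_eq :: "(nat \<Rightarrow> 'a) \<Rightarrow> (nat \<Rightarrow> 'a) \<Rightarrow> bool" where
  "tail_eq v w \<longleftrightarrow> (\<exists>m. \<forall>n\<ge>m. stage n v = stage n w)"

text \<open>One chosen representative per class models the quotient inside the type
  \<open>nat \<Rightarrow> 'a\<close>, rather than on sets of sequences, which keeps the type to be
  embedded into \<open>'u\<close> small.\<close>

definition tail_rep :: "(nat \<Rightarrow> 'a) \<Rightarrow> (nat \<Rightarrow> 'a)" where
  "tail_rep v = (SOME w. w \<in> fin_supp \<and> tail_eq v w)"

definition colimit :: "('a, nat \<Rightarrow> 'a) module" where
  "colimit = \<lparr>carrier = tail_rep ` fin_supp, monoid.mult = undefined, one = undefined,
     ring.zero = tail_rep (\<lambda>_. \<zero>), add = (\<lambda>v w. tail_rep (\<lambda>k. v k \<oplus> w k)),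
     smult = (\<lambda>r v. tail_rep (\<lambda>k. r \<otimes> v k))\<rparr>"

definition basis :: "nat \<Rightarrow> nat \<Rightarrow> 'a" where
  "basis n k = (if k = n then \<one> else \<zero>)"

definition trunc :: "nat \<Rightarrow> (nat \<Rightarrow> 'a) \<Rightarrow> nat \<Rightarrow> 'a" where
  "trunc m v k = (if k < m then v k else \<zero>)"

lemma stage_closed [simp]: "v \<in> fin_supp \<Longrightarrow> stage n v \<in> carrier R"
  by (induction n) auto

lemma seq_prod_closed [simp]: "seq_prod n \<in> carrier R"
  by (induction n) auto

lemma stage_add: "\<lbrakk>v \<in> fin_supp; w \<in> fin_supp\<rbrakk> \<Longrightarrow> stage n (\<lambda>k. v k \<oplus> w k) = stage n v \<oplus> stage n w"
  by (induction n) (auto simp: l_distr a_ac)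

lemma stage_smult: "\<lbrakk>r \<in> carrier R; v \<in> fin_supp\<rbrakk> \<Longrightarrow> stage n (\<lambda>k. r \<otimes> v k) = r \<otimes> stage n v"
  by (induction n) (auto simp: m_assoc simp flip: r_distr)

lemma stage_cong: "(\<And>k. k < n \<Longrightarrow> v k = w k) \<Longrightarrow> stage n v = stage n w"
  by (induction n) auto

lemma stage_eq_tail:
  assumes "stage m v = stage m w" "\<And>k. k \<ge> m \<Longrightarrow> v k = w k" "n \<ge> m"
  shows "stage n v = stage n w"
  using assms(3) by (induction n rule: dec_induct) (use assms in auto)

lemma tail_eqI:
  assumes "stage m v = stage m w" "\<And>k. k \<ge> m \<Longrightarrow> v k = w k"
  shows "tail_eq v w"
  using stage_eq_tail[OF assms] unfolding tail_eq_def by blast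

lemma tail_eq_refl: "tail_eq v v" by (simp add: tail_eq_def)

lemma tail_eq_sym: "tail_eq v w \<Longrightarrow> tail_eq w v" unfolding tail_eq_def by metis

lemma tail_eq_trans:
  assumes "tail_eq u v" "tail_eq v w" shows "tail_eq u w"
proof -
  obtain m n where "\<forall>k\<ge>m. stage k u = stage k v" "\<forall>k\<ge>n. stage k v = stage k w"
    using assms by (auto simp: tail_eq_def)
  then show ?thesis unfolding tail_eq_def by (intro exI[of _ "max m n"]) auto
qed

lemma tail_eq_add:
  assumes "tail_eq v v'" "tail_eq w w'" "v \<in> fin_supp" "v' \<in> fin_supp" "w \<in> fin_supp" "w' \<in> fin_supp"
  shows "tail_eq (\<lambda>k. v k \<oplus> w k) (\<lambda>k. v' k \<oplus> w' k)"
proof -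
  obtain m n where "\<forall>k\<ge>m. stage k v = stage k v'" "\<forall>k\<ge>n. stage k w = stage k w'"
    using assms by (auto simp: tail_eq_def)
  then show ?thesis unfolding tail_eq_def using assms
    by (intro exI[of _ "max m n"]) (auto simp: stage_add)
qed

lemma tail_eq_smult:
  assumes "tail_eq v v'" "v \<in> fin_supp" "v' \<in> fin_supp" "r \<in> carrier R"
  shows "tail_eq (\<lambda>k. r \<otimes> v k) (\<lambda>k. r \<otimes> v' k)"
proof -
  obtain m where "\<forall>k\<ge>m. stage k v = stage k v'" using assms(1) by (auto simp: tail_eq_def)
  then show ?thesis unfolding tail_eq_def using assms(2-)
    by (intro exI[of _ m]) (auto simp: stage_smult)
qed

lemma tail_rep:
  assumes "v \<in> fin_supp"
  shows "tail_rep v \<in> fin_supp" "tail_eq v (tail_rep v)"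
proof -
  have "tail_rep v \<in> fin_supp \<and> tail_eq v (tail_rep v)"
    unfolding tail_rep_def by (rule someI[of _ v]) (use assms tail_eq_refl in auto)
  then show "tail_rep v \<in> fin_supp" "tail_eq v (tail_rep v)" by auto
qed

lemma tail_rep_eq_iff:
  assumes "v \<in> fin_supp" "w \<in> fin_supp"
  shows "tail_rep v = tail_rep w \<longleftrightarrow> tail_eq v w"
proof
  assume "tail_rep v = tail_rep w"
  then show "tail_eq v w" using tail_rep(2)[OF assms(1)] tail_rep(2)[OF assms(2)] tail_eq_sym tail_eq_trans by metis
next
  assume "tail_eq v w"
  then have "tail_eq v = tail_eq w" using tail_eq_sym tail_eq_trans by blast
  then show "tail_rep v = tail_rep w" by (simp add: tail_rep_def)
qed

lemma colimit: "left_module R colimit" "tail_rep \<in> module_hom R free_mod colimit"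
proof -
  have 1: "tail_rep x \<oplus>\<^bsub>colimit\<^esub> tail_rep y = tail_rep (x \<oplus>\<^bsub>free_mod\<^esub> y)"
    if "x \<in> carrier free_mod" "y \<in> carrier free_mod" for x y
    using that tail_eq_add[OF tail_eq_sym[OF tail_rep(2)] tail_eq_sym[OF tail_rep(2)]] tail_rep(1)
    by (simp add: colimit_def tail_rep_eq_iff fin_supp_add)
  have 2: "r \<odot>\<^bsub>colimit\<^esub> tail_rep x = tail_rep (r \<odot>\<^bsub>free_mod\<^esub> x)"
    if "r \<in> carrier R" "x \<in> carrier free_mod" for r x
    using that tail_eq_smult[OF tail_eq_sym[OF tail_rep(2)]] tail_rep(1)
    by (simp add: colimit_def tail_rep_eq_iff fin_supp_smult)
  have 3: "carrier colimit = tail_rep ` carrier free_mod" "\<zero>\<^bsub>colimit\<^esub> = tail_rep \<zero>\<^bsub>free_mod\<^esub>"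
    by (simp_all add: colimit_def)
  show "left_module R colimit" "tail_rep \<in> module_hom R free_mod colimit"
    by (rule left_module_image[where F = free_mod and q = tail_rep, OF left_module_free_mod 3],
        erule (1) 1, erule (1) 2)+
qed

lemma carrier_colimit: "carrier colimit = tail_rep ` fin_supp"
  by (simp add: colimit_def)

lemma basis_fin_supp [simp]: "basis n \<in> fin_supp"
  by (rule fin_suppI[of _ "Suc n"]) (auto simp: basis_def)

lemma trunc_fin_supp [simp]: "v \<in> fin_supp \<Longrightarrow> trunc m v \<in> fin_supp"
  by (rule fin_suppI[of _ m]) (auto simp: trunc_def)

lemma stage_basis_le: "n \<le> m \<Longrightarrow> stage n (basis m) = \<zero>"
  by (induction n) (auto simp: basis_def)

lemma stage_basis_0: "stage (Suc n) (basis 0) = seq_prod (Suc n)"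
  by (induction n) (auto simp: basis_def)

text \<open>Both sides have the value \<open>a 0 ... a n\<close> at stage \<open>Suc n\<close>, the
  first one at which \<open>basis n\<close> contributes.\<close>

lemma tail_eq_basis_0: "tail_eq (basis 0) (\<lambda>k. seq_prod n \<otimes> basis n k)"
proof (rule tail_eqI[of "Suc n"])
  have "stage (Suc n) (\<lambda>k. seq_prod n \<otimes> basis n k) = seq_prod n \<otimes> stage (Suc n) (basis n)"
    by (intro stage_smult) auto
  also have "stage (Suc n) (basis n) = a n" by (simp add: stage_basis_le) (simp add: basis_def)
  finally show "stage (Suc n) (basis 0) = stage (Suc n) (\<lambda>k. seq_prod n \<otimes> basis n k)"
    using stage_basis_0 by simp
qed (auto simp: basis_def)

text \<open>Bass's argument: a projective cover of the colimit, which is flat, is an isomorphism.\<close>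

theorem seq_prod_stabilizes:
  fixes j :: "(nat \<Rightarrow> 'a) \<Rightarrow> 'u"
  assumes cov: "\<And>M :: ('a, 'u) module. left_module R M \<Longrightarrow>
      \<exists>(P :: ('a, 'u) module) p. projective_cover TYPE('u) R M P p"
    and j: "inj j"
  shows "\<exists>m. \<forall>n. \<exists>c\<in>carrier R. seq_prod m = seq_prod n \<otimes> c"
proof -
  note q = colimit(2) note qD = module_homD[OF q, simplified]
  have jo: "inj_on j A" for A using j by (rule inj_on_subset) simp
  obtain P :: "('a, 'u) module" and p where cover: "projective_cover TYPE('u) R colimit P p"
    by (rule projective_cover_transport[OF cov colimit(1) jo])
  have P: "projective_module TYPE('u) R P" and p: "p \<in> module_hom R P colimit"
    and p_surj: "p ` carrier P = tail_rep ` fin_supp"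
    using cover by (auto simp: projective_cover_def carrier_colimit)
  define K where "K = {x \<in> carrier P. p x = \<zero>\<^bsub>colimit\<^esub>}"
  have K: "superfluous_submodule K R P" using cover by (simp add: projective_cover_def K_def)
  have lP: "left_module R P" using P by (simp add: projective_module_def)
  interpret P: left_module R P by fact
  interpret C: left_module R colimit by (rule colimit)
  interpret F: left_module R free_mod by (rule left_module_free_mod)
  note pD = module_homD[OF p]
  have "\<forall>k. \<exists>y\<in>carrier P. p y = tail_rep (basis k)" using p_surj by (metis basis_fin_supp imageE imageI)
  then obtain b where b: "\<And>k. b k \<in> carrier P" "\<And>k. p (b k) = tail_rep (basis k)" by metis
  \<comment> \<open>The partial sum of the terms \<open>v k b k\<close> with \<open>k < m\<close>.
    For finitely supported \<open>v\<close> it is independent of large \<open>m\<close>, and this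
    value defines the lift \<open>\<phi>\<close> of the quotient map to \<open>P\<close>.\<close>
  define part where "part m v = rec_nat \<zero>\<^bsub>P\<^esub> (\<lambda>k x. x \<oplus>\<^bsub>P\<^esub> v k \<odot>\<^bsub>P\<^esub> b k) m" for m v
  have part_simps [simp]: "part 0 v = \<zero>\<^bsub>P\<^esub>" "part (Suc m) v = part m v \<oplus>\<^bsub>P\<^esub> v m \<odot>\<^bsub>P\<^esub> b m" for m v
    by (simp_all add: part_def)
  have part_closed [simp]: "part m v \<in> carrier P" if "v \<in> fin_supp" for m v
    using that b by (induction m) auto
  have part_add: "part m (\<lambda>k. v k \<oplus> w k) = part m v \<oplus>\<^bsub>P\<^esub> part m w" if "v \<in> fin_supp" "w \<in> fin_supp" for m v w
    using that b by (induction m) (auto simp: P.smult_l_distr P.M.a_ac)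
  have part_smult: "part m (\<lambda>k. r \<otimes> v k) = r \<odot>\<^bsub>P\<^esub> part m v" if "v \<in> fin_supp" "r \<in> carrier R" for m v r
    using that b by (induction m) (auto simp: P.smult_assoc1 P.smult_r_distr)
  have part_stable: "part n v = part m v" if "v \<in> fin_supp" "\<And>k. k \<ge> m \<Longrightarrow> v k = \<zero>" "n \<ge> m" for n m v
    using that(3) by (induction n rule: dec_induct) (use that b in auto)
  have p_part: "p (part m v) = tail_rep (trunc m v)" if v: "v \<in> fin_supp" for m v
  proof (induction m)
    case 0
    have "trunc 0 v = (\<lambda>_. \<zero>)" by (simp add: trunc_def fun_eq_iff)
    then show ?case using module_hom_zero[OF lP colimit(1) p] by (simp add: colimit_def)
  next
    case (Suc m)
    have "trunc (Suc m) v = (\<lambda>k. trunc m v k \<oplus> (v m \<otimes> basis m k))"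
      using v by (auto simp: trunc_def basis_def fun_eq_iff less_Suc_eq)
    then have "tail_rep (trunc (Suc m) v) = tail_rep (trunc m v) \<oplus>\<^bsub>colimit\<^esub> v m \<odot>\<^bsub>colimit\<^esub> tail_rep (basis m)"
      using qD(2)[of "trunc m v" "\<lambda>k. v m \<otimes> basis m k"] qD(3)[of "v m" "basis m"] v
      by (simp add: fin_supp_smult)
    then show ?case using Suc pD(2,3) v b by simp
  qed
  define \<phi> where "\<phi> v = part (SOME m. \<forall>k\<ge>m. v k = \<zero>) v" for v
  have \<phi>_part: "\<phi> v = part m v" if v: "v \<in> fin_supp" "\<And>k. k \<ge> m \<Longrightarrow> v k = \<zero>" for v m
  proof -
    let ?n = "SOME m. \<forall>k\<ge>m. v k = \<zero>"
    have n: "\<forall>k\<ge>?n. v k = \<zero>" by (rule someI_ex) (use v in blast)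
    have "part (max m ?n) v = part m v" "part (max m ?n) v = part ?n v"
      by (intro part_stable; use v n in auto)+
    then show ?thesis by (simp add: \<phi>_def)
  qed
  have trunc_id: "trunc m v = v" if "\<And>k. k \<ge> m \<Longrightarrow> v k = \<zero>" for m v
    using that by (auto simp: trunc_def fun_eq_iff)
  have \<phi>: "\<phi> \<in> module_hom R free_mod P"
  proof (rule module_homI)
    fix v assume "v \<in> carrier free_mod"
    then have v: "v \<in> fin_supp" by simp
    show "\<phi> v \<in> carrier P" using v by (simp add: \<phi>_def)
    {
      fix w assume "w \<in> carrier free_mod"
      then have w: "w \<in> fin_supp" by simp
      obtain m where m: "\<And>k. k \<ge> m \<Longrightarrow> v k = \<zero>" "\<And>k. k \<ge> m \<Longrightarrow> w k = \<zero>"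
        by (rule fin_supp_common_bound[OF v w]) blast
      have "\<phi> (\<lambda>k. v k \<oplus> w k) = part m (\<lambda>k. v k \<oplus> w k)"
        by (rule \<phi>_part) (use fin_supp_add v w m in auto)
      then show "\<phi> (v \<oplus>\<^bsub>free_mod\<^esub> w) = \<phi> v \<oplus>\<^bsub>P\<^esub> \<phi> w"
        using \<phi>_part[OF v m(1)] \<phi>_part[OF w m(2)] part_add[OF v w] by simp
    next
      fix r assume r: "r \<in> carrier R"
      obtain m where m: "\<And>k. k \<ge> m \<Longrightarrow> v k = \<zero>" by (rule fin_supp_common_bound[OF v v]) blast
      have "\<phi> (\<lambda>k. r \<otimes> v k) = part m (\<lambda>k. r \<otimes> v k)"
        by (rule \<phi>_part) (use fin_supp_smult v r m in auto)
      then show "\<phi> (r \<odot>\<^bsub>free_mod\<^esub> v) = r \<odot>\<^bsub>P\<^esub> \<phi> v"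
        using \<phi>_part[OF v m(1)] part_smult[OF v r] by simp
    }
  qed
  note \<phi>D = module_homD[OF \<phi>, simplified]
  have p\<phi>: "p (\<phi> v) = tail_rep v" if v: "v \<in> fin_supp" for v
  proof -
    obtain m where m: "\<And>k. k \<ge> m \<Longrightarrow> v k = \<zero>" by (rule fin_supp_common_bound[OF v v]) blast
    show ?thesis using \<phi>_part[OF v m] p_part[OF v, of m] trunc_id[OF m] by simp
  qed
  have "K <+>\<^bsub>P\<^esub> \<phi> ` carrier free_mod = carrier P"
  proof
    show "K <+>\<^bsub>P\<^esub> \<phi> ` carrier free_mod \<subseteq> carrier P" using \<phi>D(1) by (auto simp: set_add_def' K_def)
    show "carrier P \<subseteq> K <+>\<^bsub>P\<^esub> \<phi> ` carrier free_mod"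
    proof
      fix y assume y: "y \<in> carrier P"
      then obtain v where v: "v \<in> fin_supp" "p y = tail_rep v" using p_surj by blast
      have "p (y \<ominus>\<^bsub>P\<^esub> \<phi> v) = \<zero>\<^bsub>colimit\<^esub>"
        using y v p\<phi> \<phi>D(1) pD(1) qD(1) by (simp add: module_hom_diff[OF lP colimit(1) p] C.module_minus_eq_zero_iff)
      then have "y \<ominus>\<^bsub>P\<^esub> \<phi> v \<in> K" using y v \<phi>D(1) by (simp add: K_def)
      moreover have "y = (y \<ominus>\<^bsub>P\<^esub> \<phi> v) \<oplus>\<^bsub>P\<^esub> \<phi> v" using y v \<phi>D(1) by (simp add: P.abelian_simps)
      ultimately show "y \<in> K <+>\<^bsub>P\<^esub> \<phi> ` carrier free_mod" using v unfolding set_add_def' by auto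
    qed
  qed
  then have \<phi>_surj: "\<phi> ` carrier free_mod = carrier P"
    using K submodule_image[OF left_module_free_mod lP \<phi>] by (auto simp: superfluous_submodule_def)
  obtain \<sigma> where \<sigma>: "\<sigma> \<in> module_hom R P free_mod" "\<And>y. y \<in> carrier P \<Longrightarrow> \<phi> (\<sigma> y) = y"
    by (rule projective_lift[OF P left_module_free_mod lP \<phi> \<phi>_surj module_hom_id jo inj_on_id2]) blast
  note \<sigma>D = module_homD[OF \<sigma>(1), simplified]
  have K0: "z = \<zero>\<^bsub>P\<^esub>" if z: "z \<in> K" for z
  proof -
    have zc: "z \<in> carrier P" using z by (simp add: K_def)
    define v where "v = \<sigma> z"
    have v: "v \<in> fin_supp" using \<sigma>D(1)[OF zc] by (simp add: v_def)
    have \<phi>v: "\<phi> v = z" using \<sigma>(2)[OF zc] by (simp add: v_def)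
    have "tail_rep v = tail_rep (\<lambda>_. \<zero>)" using p\<phi>[OF v] \<phi>v z by (simp add: K_def colimit_def)
    moreover have z0: "(\<lambda>_. \<zero>) \<in> fin_supp" by (rule fin_suppI[of _ 0]) auto
    ultimately have "tail_eq v (\<lambda>_. \<zero>)" using tail_rep_eq_iff[OF v] by blast
    then obtain m0 where m0: "\<And>n. n \<ge> m0 \<Longrightarrow> stage n v = stage n (\<lambda>_. \<zero>)" by (auto simp: tail_eq_def)
    obtain m1 where m1: "\<And>k. k \<ge> m1 \<Longrightarrow> v k = \<zero>" by (rule fin_supp_common_bound[OF v v]) blast
    define m where "m = max m0 m1"
    have stage0: "stage n (\<lambda>_. \<zero>) = \<zero>" for n by (induction n) auto
    have sv: "stage m v = \<zero>" using m0 stage0 by (simp add: m_def)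
    have vm: "v k = \<zero>" if "k \<ge> m" for k using m1 that by (simp add: m_def)
    \<comment> \<open>In the colimit the first \<open>m\<close> coordinates of \<open>w\<close> have
      the same class as \<open>stage m w\<close> times \<open>basis m\<close>, so
      \<open>\<theta>\<close> maps into \<open>K\<close>. At \<open>v\<close> the subtracted term
      vanishes and nothing is truncated, hence \<open>\<theta> v = z\<close>. This is the flatness
      of the colimit in elementwise form.\<close>
    define \<theta> where "\<theta> w = \<phi> (trunc m w) \<ominus>\<^bsub>P\<^esub> stage m w \<odot>\<^bsub>P\<^esub> \<phi> (basis m)" for w
    have \<theta>: "\<theta> \<in> module_hom R free_mod P"
      unfolding \<theta>_def
    proof (rule module_hom_sub[OF lP])
      show "(\<lambda>w. \<phi> (trunc m w)) \<in> module_hom R free_mod P"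
      proof (rule module_hom_comp[OF _ \<phi>])
        show "trunc m \<in> module_hom R free_mod free_mod"
        proof (rule module_homI)
          fix v w assume "v \<in> carrier free_mod" "w \<in> carrier free_mod"
          then show "trunc m (v \<oplus>\<^bsub>free_mod\<^esub> w) = trunc m v \<oplus>\<^bsub>free_mod\<^esub> trunc m w"
            by (simp add: trunc_def fun_eq_iff)
        next
          fix r v assume "r \<in> carrier R" "v \<in> carrier free_mod"
          then show "trunc m (r \<odot>\<^bsub>free_mod\<^esub> v) = r \<odot>\<^bsub>free_mod\<^esub> trunc m v"
            by (simp add: trunc_def fun_eq_iff)
        qed simp
      qed
      show "(\<lambda>w. stage m w \<odot>\<^bsub>P\<^esub> \<phi> (basis m)) \<in> module_hom R free_mod P"
        by (rule module_homI) (auto simp: stage_add stage_smult \<phi>D(1) P.smult_l_distr P.smult_assoc1)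
    qed
    have \<theta>K: "\<theta> w \<in> K" if w: "w \<in> fin_supp" for w
    proof -
      have "tail_eq (trunc m w) (\<lambda>k. stage m w \<otimes> basis m k)"
      proof (rule tail_eqI[of "Suc m"])
        have "stage (Suc m) (trunc m w) = stage m w \<otimes> a m"
          using stage_cong[of m "trunc m w" w] w by (simp add: trunc_def)
        moreover have "stage (Suc m) (\<lambda>k. stage m w \<otimes> basis m k) = stage m w \<otimes> stage (Suc m) (basis m)"
          using w by (intro stage_smult) auto
        moreover have "stage (Suc m) (basis m) = a m" by (simp add: stage_basis_le) (simp add: basis_def)
        ultimately show "stage (Suc m) (trunc m w) = stage (Suc m) (\<lambda>k. stage m w \<otimes> basis m k)" by simp
        show "trunc m w k = stage m w \<otimes> basis m k" if "k \<ge> Suc m" for k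
          using that w by (simp add: trunc_def basis_def)
      qed
      moreover have "(\<lambda>k. stage m w \<otimes> basis m k) \<in> fin_supp" using w by (intro fin_supp_smult) auto
      ultimately have "tail_rep (trunc m w) = tail_rep (\<lambda>k. stage m w \<otimes> basis m k)"
        using tail_rep_eq_iff[OF trunc_fin_supp[OF w]] by blast
      then have "tail_rep (trunc m w) = stage m w \<odot>\<^bsub>colimit\<^esub> tail_rep (basis m)"
        using qD(3)[of "stage m w" "basis m"] w by simp
      then have "p (\<theta> w) = \<zero>\<^bsub>colimit\<^esub>"
        using w \<phi>D(1) pD(3) p\<phi> qD(1)
        by (simp add: \<theta>_def module_hom_diff[OF lP colimit(1) p] C.module_minus_eq_zero_iff)
      then show ?thesis using module_homD(1)[OF \<theta>] w by (simp add: K_def)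
    qed
    have "\<theta> v = z"
      using sv \<phi>v \<phi>D(1) zc by (simp add: \<theta>_def trunc_id[OF vm] a_minus_def)
    then have fixp: "\<theta> (\<sigma> z) = z" by (simp add: v_def)
    show ?thesis
      by (rule superfluous_fixpoint[OF P inj_on_id2 K module_hom_comp[OF \<sigma>(1) \<theta>] _ zc fixp])
        (use \<theta>K \<sigma>D(1) in blast)
  qed
  have p_inj: "x = y" if "x \<in> carrier P" "y \<in> carrier P" "p x = p y" for x y
  proof -
    have "p (x \<ominus>\<^bsub>P\<^esub> y) = \<zero>\<^bsub>colimit\<^esub>"
      using that pD(1) by (simp add: module_hom_diff[OF lP colimit(1) p] C.module_minus_eq_zero_iff)
    then have "x \<ominus>\<^bsub>P\<^esub> y = \<zero>\<^bsub>P\<^esub>" using K0 that by (simp add: K_def)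
    then show ?thesis using that P.module_minus_eq_zero_iff by simp
  qed
  \<comment> \<open>The relation holds in the colimit and lifts to \<open>P\<close> because
    \<open>p\<close> is injective.\<close>
  have y0: "\<phi> (basis 0) = seq_prod n \<odot>\<^bsub>P\<^esub> \<phi> (basis n)" for n
  proof -
    have "tail_rep (basis 0) = tail_rep (\<lambda>k. seq_prod n \<otimes> basis n k)"
      using tail_rep_eq_iff tail_eq_basis_0 by (simp add: fin_supp_smult)
    moreover have fs: "(\<lambda>k. seq_prod n \<otimes> basis n k) \<in> fin_supp" by (intro fin_supp_smult) auto
    ultimately have "\<phi> (basis 0) = \<phi> (\<lambda>k. seq_prod n \<otimes> basis n k)"
      by (intro p_inj \<phi>D(1)) (simp_all only: p\<phi> basis_fin_supp)
    then show ?thesis using \<phi>D(3)[of "seq_prod n" "basis n"] by simp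
  qed
  \<comment> \<open>By the lifted relation all coordinates of \<open>v\<close> lie in
    \<open>seq_prod n R\<close> for every \<open>n\<close>, and so does each stage of
    \<open>v\<close>. As \<open>v\<close> represents \<open>basis 0\<close>, a late stage of it is a
    product \<open>seq_prod (Suc m)\<close> with \<open>m\<close> independent of
    \<open>n\<close>.\<close>
  define v where "v = \<sigma> (\<phi> (basis 0))"
  have v: "v \<in> fin_supp" using \<sigma>D(1) \<phi>D(1) by (simp add: v_def)
  have "tail_rep v = tail_rep (basis 0)" using p\<phi>[OF v] \<sigma>(2) \<phi>D(1) p\<phi>[of "basis 0"] by (simp add: v_def)
  then obtain m where m: "\<And>n. n \<ge> m \<Longrightarrow> stage n v = stage n (basis 0)"
    using tail_rep_eq_iff[OF v] by (auto simp: tail_eq_def)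
  have sm: "stage (Suc m) v = seq_prod (Suc m)" using m[of "Suc m"] stage_basis_0 by simp
  have "\<exists>c\<in>carrier R. seq_prod (Suc m) = seq_prod n \<otimes> c" for n
  proof -
    have "v = (\<lambda>k. seq_prod n \<otimes> \<sigma> (\<phi> (basis n)) k)"
      using \<sigma>D(3)[of "seq_prod n" "\<phi> (basis n)"] \<phi>D(1) y0[of n] by (simp add: v_def)
    then have "stage (Suc m) v = seq_prod n \<otimes> stage (Suc m) (\<sigma> (\<phi> (basis n)))"
      using stage_smult[of "seq_prod n" "\<sigma> (\<phi> (basis n))" "Suc m"] \<sigma>D(1) \<phi>D(1) by simp
    moreover have "stage (Suc m) (\<sigma> (\<phi> (basis n))) \<in> carrier R" using \<sigma>D(1) \<phi>D(1) stage_closed by simp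
    ultimately show ?thesis using sm by metis
  qed
  then show ?thesis by blast
qed

end

text \<open>Failure of the minimum condition gives a strictly descending chain with
  \<open>f (Suc n) = a n f n\<close>. In the opposite ring the products of the \<open>a n\<close>
  are the coefficients with which \<open>f n\<close> is a left multiple of \<open>f 0\<close>, so
  their stabilization stops the chain.\<close>

lemma right_perfect_imp_left_dcc:
  fixes R :: "('a, 'm) ring_scheme" and j :: "(nat \<Rightarrow> 'a) \<Rightarrow> 'u"
  assumes perf: "right_perfect TYPE('u) R" and j: "inj j"
  shows "left_dcc R"
proof -
  interpret ring R using perf by (simp add: right_perfect_def)
  show ?thesis
  proof unfold_locales
    fix X assume X: "X \<subseteq> carrier R" "X \<noteq> {}"
    show "\<exists>x\<in>X. \<forall>y\<in>X. (\<exists>r\<in>carrier R. y = r \<otimes>\<^bsub>R\<^esub> x) \<longrightarrow> (\<exists>r\<in>carrier R. r \<otimes>\<^bsub>R\<^esub> y = x)"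
    proof (rule ccontr)
      assume no: "\<not> ?thesis"
      have "\<exists>f. \<forall>n::nat. f n \<in> X \<and> ((\<exists>r\<in>carrier R. f (Suc n) = r \<otimes>\<^bsub>R\<^esub> f n) \<and>
          \<not> (\<exists>r\<in>carrier R. r \<otimes>\<^bsub>R\<^esub> f (Suc n) = f n))"
        by (rule dependent_nat_choice) (use X no in blast)+
      then obtain f where f: "\<And>n::nat. f n \<in> X" "\<And>n. \<exists>r\<in>carrier R. f (Suc n) = r \<otimes>\<^bsub>R\<^esub> f n"
        "\<And>n. \<not> (\<exists>r\<in>carrier R. r \<otimes>\<^bsub>R\<^esub> f (Suc n) = f n)" by blast
      obtain a where a: "\<And>n. a n \<in> carrier R" "\<And>n. f (Suc n) = a n \<otimes>\<^bsub>R\<^esub> f n" using f(2) by metis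
      interpret S: ring_sequence "opposite_ring R" a
        by (intro ring_sequence.intro ring_opposite_ring ring_sequence_axioms.intro) (simp add: a)
      have fR: "f n \<in> carrier R" for n using f(1) X by blast
      have pc: "S.seq_prod n \<in> carrier R" for n using S.seq_prod_closed by simp
      have fp: "f n = S.seq_prod n \<otimes>\<^bsub>R\<^esub> f 0" for n
        by (induction n) (use fR pc a in \<open>simp_all add: m_assoc\<close>)
      have "\<exists>m. \<forall>n. \<exists>c\<in>carrier (opposite_ring R). S.seq_prod m = S.seq_prod n \<otimes>\<^bsub>opposite_ring R\<^esub> c"
        by (rule S.seq_prod_stabilizes[OF _ j]) (use perf in \<open>simp add: right_perfect_def\<close>)
      then obtain m where "\<forall>n. \<exists>c\<in>carrier (opposite_ring R). S.seq_prod m = S.seq_prod n \<otimes>\<^bsub>opposite_ring R\<^esub> c" ..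
      from spec[OF this, of "Suc m"] obtain c
        where "c \<in> carrier R" "S.seq_prod m = c \<otimes>\<^bsub>R\<^esub> S.seq_prod (Suc m)"
        by (auto simp del: S.seq_prod.simps)
      then have "c \<otimes>\<^bsub>R\<^esub> f (Suc m) = f m" using fp fR pc by (metis m_assoc)
      then show False using f(3) \<open>c \<in> carrier R\<close> by blast
    qed
  qed
qed

section \<open>Injective hulls of rings\<close>

text \<open>Characters with values in the circle group, which is divisible and contains roots of
  unity of every order; these facts give extension and separation.\<close>

definition unit_char :: "('a, 'n) ring_scheme \<Rightarrow> ('a \<Rightarrow> complex) \<Rightarrow> bool" where
  "unit_char M \<chi> \<longleftrightarrow> (\<forall>x\<in>carrier M. cmod (\<chi> x) = 1) \<and>
     (\<forall>x\<in>carrier M. \<forall>y\<in>carrier M. \<chi> (x \<oplus>\<^bsub>M\<^esub> y) = \<chi> x * \<chi> y)"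

text \<open>Partial characters are handled as graphs, so that Zorn's lemma applies to inclusion.\<close>

definition char_graph :: "('a, 'n) ring_scheme \<Rightarrow> ('a \<times> complex) set \<Rightarrow> bool" where
  "char_graph M G \<longleftrightarrow> (\<zero>\<^bsub>M\<^esub>, 1) \<in> G \<and> (\<forall>z. (\<zero>\<^bsub>M\<^esub>, z) \<in> G \<longrightarrow> z = 1) \<and>
     (\<forall>x z. (x, z) \<in> G \<longrightarrow> x \<in> carrier M \<and> cmod z = 1 \<and> (\<ominus>\<^bsub>M\<^esub> x, inverse z) \<in> G) \<and>
     (\<forall>x z y w. (x, z) \<in> G \<longrightarrow> (y, w) \<in> G \<longrightarrow> (x \<oplus>\<^bsub>M\<^esub> y, z * w) \<in> G)"

lemma char_graphD:
  assumes "char_graph M G"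
  shows "(\<zero>\<^bsub>M\<^esub>, 1) \<in> G" "(\<zero>\<^bsub>M\<^esub>, z) \<in> G \<Longrightarrow> z = 1" "(x, z) \<in> G \<Longrightarrow> x \<in> carrier M"
    "(x, z) \<in> G \<Longrightarrow> cmod z = 1" "(x, z) \<in> G \<Longrightarrow> (\<ominus>\<^bsub>M\<^esub> x, inverse z) \<in> G"
    "\<lbrakk>(x, z) \<in> G; (y, w) \<in> G\<rbrakk> \<Longrightarrow> (x \<oplus>\<^bsub>M\<^esub> y, z * w) \<in> G"
  using assms unfolding char_graph_def by blast+

text \<open>There are \<open>n \<ge> 2\<close> roots, so one of them differs from
  \<open>1\<close>.\<close>

lemma nontrivial_unit_root:
  assumes "cmod c = 1" "n \<ge> 2"
  obtains w where "cmod w = 1" "w ^ n = c" "w \<noteq> 1"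
proof -
  have "c \<noteq> 0" using assms by auto
  then have "card {z. z ^ n = c} = n" using card_nth_roots assms by simp
  then have "\<not> {z. z ^ n = c} \<subseteq> {1}" using assms card_mono[of "{1::complex}" "{z. z ^ n = c}"] by auto
  then obtain w where w: "w ^ n = c" "w \<noteq> 1" by auto
  have "cmod w ^ n = 1" using w assms by (simp flip: norm_power)
  then have "cmod w = 1" using power_eq_1_iff[of "cmod w" n] assms(2) by auto
  then show thesis using that w by blast
qed

lemma unit_nonzero: "cmod z = 1 \<Longrightarrow> z \<noteq> 0"
  by auto

section \<open>Extension of characters of abelian groups\<close>

context abelian_group
begin

lemma char_graph_int_mult:
  assumes G: "char_graph G H" and x: "(x, z) \<in> H"
  shows "([(k::int)] \<cdot>\<^bsub>G\<^esub> x, z powi k) \<in> H"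
proof -
  note D = char_graphD[OF G]
  have nat: "([(n::nat)] \<cdot>\<^bsub>G\<^esub> x, z ^ n) \<in> H" for n
  proof (induction n)
    case 0
    then show ?case using D(1) by simp
  next
    case (Suc n)
    then show ?case using D(6)[OF Suc x] by (simp add: mult.commute)
  qed
  show ?thesis
  proof (cases "k \<ge> 0")
    case True
    then show ?thesis using nat[of "nat k"] by (simp add: add_pow_int_ge power_int_def)
  next
    case False
    then show ?thesis using D(5)[OF nat[of "nat (- k)"]]
      by (simp add: add_pow_int_lt power_int_def power_inverse)
  qed
qed

text \<open>The value at \<open>x\<close> is constrained only by the multiples of \<open>x\<close>
  already in the domain. The extra demand \<open>w \<noteq> 1\<close> costs nothing and lets the
  step also separate points.\<close>

lemma char_graph_step:
  assumes G: "char_graph G H" and x: "x \<in> carrier G" "x \<notin> Domain H"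
  obtains H' w where "char_graph G H'" "H \<subseteq> H'" "(x, w) \<in> H'" "w \<noteq> 1"
proof -
  note D = char_graphD[OF G]
  have ipow: "[(k::int)] \<cdot>\<^bsub>G\<^esub> x \<in> carrier G" for k using x by simp
  have iadd: "[(i + j::int)] \<cdot>\<^bsub>G\<^esub> x = [i] \<cdot>\<^bsub>G\<^esub> x \<oplus> [j] \<cdot>\<^bsub>G\<^esub> x" for i j
    using add.int_pow_mult[OF x(1)] by simp
  have ineg: "[(- i::int)] \<cdot>\<^bsub>G\<^esub> x = \<ominus> ([i] \<cdot>\<^bsub>G\<^esub> x)" for i
    using add.int_pow_neg[OF x(1)] by simp
  have izero: "[(0::int)] \<cdot>\<^bsub>G\<^esub> x = \<zero>" using x(1) by (simp add: add_pow_int_ge)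
  have imul: "[(i * j::int)] \<cdot>\<^bsub>G\<^esub> x = [j] \<cdot>\<^bsub>G\<^esub> ([i] \<cdot>\<^bsub>G\<^esub> x)" for i j
    using add.int_pow_pow[OF x(1)] by (simp add: mult.commute)
  have one: "[(1::int)] \<cdot>\<^bsub>G\<^esub> x = x" using x by simp
  \<comment> \<open>An ideal of the integers that does not contain \<open>1\<close>: it is zero or
    generated by some \<open>n \<ge> 2\<close>.\<close>
  define I where "I = {k::int. [k] \<cdot>\<^bsub>G\<^esub> x \<in> Domain H}"
  have I_add: "i + j \<in> I" if "i \<in> I" "j \<in> I" for i j
    using that D(6) unfolding I_def Domain_iff mem_Collect_eq iadd by blast
  have I_mult: "i * j \<in> I" if "i \<in> I" for i j
    using that char_graph_int_mult[OF G] unfolding I_def Domain_iff mem_Collect_eq imul by blast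
  have I1: "1 \<notin> I" using x one by (simp add: I_def)
  \<comment> \<open>The last condition is what keeps the extended graph single-valued: a sum
    \<open>y + k x\<close> that vanishes must receive the value \<open>1\<close>.\<close>
  have "\<exists>w. cmod w = 1 \<and> w \<noteq> 1 \<and> (\<forall>y z k. (y, z) \<in> H \<and> y \<oplus> [(k::int)] \<cdot>\<^bsub>G\<^esub> x = \<zero> \<longrightarrow> z * w powi k = 1)"
  proof (cases "I \<subseteq> {0}")
    case True
    \<comment> \<open>No nonzero multiple of \<open>x\<close> is in the domain, so the value at
      \<open>x\<close> is free; \<open>-1\<close> is just some unit complex number other than
      \<open>1\<close>.\<close>
    have "z * (-1) powi k = 1" if yz: "(y, z) \<in> H" "y \<oplus> [(k::int)] \<cdot>\<^bsub>G\<^esub> x = \<zero>" for y z k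
    proof -
      have "[k] \<cdot>\<^bsub>G\<^esub> x = \<ominus> y" using yz D(3) ipow by (metis minus_equality a_comm)
      then have "k \<in> I" using D(5)[OF yz(1)] by (auto simp: I_def)
      then have "k = 0" using True by blast
      then show ?thesis using yz D(2,3) izero by auto
    qed
    then show ?thesis by (intro exI[of _ "-1"]) auto
  next
    case False
    then obtain k where k: "k \<in> I" "k \<noteq> 0" by blast
    have "\<bar>k\<bar> \<in> I" using I_mult[OF k(1), of "sgn k"] by (simp add: abs_sgn)
    then have ex: "\<exists>n::nat. n > 0 \<and> int n \<in> I" using k by (intro exI[of _ "nat \<bar>k\<bar>"]) auto
    define n where "n = (LEAST n::nat. n > 0 \<and> int n \<in> I)"
    have n: "n > 0" "int n \<in> I" using LeastI_ex[OF ex] by (auto simp: n_def)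
    have n_min: "n \<le> m" if "m > 0" "int m \<in> I" for m using that unfolding n_def by (intro Least_le) auto
    have "n \<noteq> 1" using n I1 by auto
    then have n2: "n \<ge> 2" using n by simp
    obtain c where c: "([(int n)] \<cdot>\<^bsub>G\<^esub> x, c) \<in> H" using n by (auto simp: I_def)
    obtain w where w: "cmod w = 1" "w ^ n = c" "w \<noteq> 1"
      by (rule nontrivial_unit_root[OF D(4)[OF c] n2])
    have "z * w powi k = 1" if yz: "(y, z) \<in> H" "y \<oplus> [(k::int)] \<cdot>\<^bsub>G\<^esub> x = \<zero>" for y z k
    proof -
      have "[k] \<cdot>\<^bsub>G\<^esub> x = \<ominus> y" using yz D(3) ipow by (metis minus_equality a_comm)
      then have kI: "k \<in> I" using D(5)[OF yz(1)] by (auto simp: I_def)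
      have "k + int n * (- (k div int n)) \<in> I" by (rule I_add[OF kI I_mult[OF n(2)]])
      then have mI: "k mod int n \<in> I" by (simp add: minus_mult_div_eq_mod)
      have "k mod int n = 0"
      proof (rule ccontr)
        assume "k mod int n \<noteq> 0"
        moreover have "k mod int n \<ge> 0" "k mod int n < int n" using n(1) by simp_all
        ultimately have "nat (k mod int n) > 0" "int (nat (k mod int n)) \<in> I" "nat (k mod int n) < n"
          using mI by (simp_all add: nat_less_iff)
        then show False using n_min[of "nat (k mod int n)"] by simp
      qed
      then obtain l where l: "k = int n * l" by (auto simp: mod_eq_0_iff_dvd)
      have "([k] \<cdot>\<^bsub>G\<^esub> x, c powi l) \<in> H" using char_graph_int_mult[OF G c] by (simp add: l imul)
      then have "z * c powi l = 1" using D(6)[OF yz(1)] D(2) yz(2) by metis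
      moreover have "w powi k = c powi l" by (simp add: l power_int_mult w(2))
      ultimately show ?thesis by simp
    qed
    then show ?thesis using w by blast
  qed
  then obtain w where w: "cmod w = 1" "w \<noteq> 1"
    "\<And>y z k. \<lbrakk>(y, z) \<in> H; y \<oplus> [(k::int)] \<cdot>\<^bsub>G\<^esub> x = \<zero>\<rbrakk> \<Longrightarrow> z * w powi k = 1" by blast
  have w0: "w \<noteq> 0" using w(1) by auto
  define H' where "H' = {(y \<oplus> [(k::int)] \<cdot>\<^bsub>G\<^esub> x, z * w powi k) | y z k. (y, z) \<in> H}"
  have H'I: "(y \<oplus> [(k::int)] \<cdot>\<^bsub>G\<^esub> x, z * w powi k) \<in> H'" if "(y, z) \<in> H" for y z k
    using that by (auto simp: H'_def)
  have sub: "H \<subseteq> H'"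
  proof
    fix p assume p: "p \<in> H"
    obtain y z where yz: "p = (y, z)" by fastforce
    then show "p \<in> H'" using H'I[of y z 0] D(3) p izero by simp
  qed
  have xw: "(x, w) \<in> H'" using H'I[OF D(1), of 1] x one by simp
  have "char_graph G H'"
    unfolding char_graph_def
  proof (intro conjI allI impI)
    show "(\<zero>, 1) \<in> H'" using sub D(1) by blast
    show "z = 1" if z: "(\<zero>, z) \<in> H'" for z
    proof -
      obtain y v k where "(y, v) \<in> H" "\<zero> = y \<oplus> [(k::int)] \<cdot>\<^bsub>G\<^esub> x" "z = v * w powi k"
        using z unfolding H'_def by blast
      then show ?thesis using w(3) by metis
    qed
  next
    fix y z assume "(y, z) \<in> H'"
    then obtain v u k where p: "(v, u) \<in> H" "y = v \<oplus> [(k::int)] \<cdot>\<^bsub>G\<^esub> x" "z = u * w powi k"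
      unfolding H'_def by blast
    show "y \<in> carrier G" using p D(3) ipow by simp
    show "cmod z = 1" using p D(4) w(1) by (simp add: norm_mult norm_power_int)
    have "\<ominus> y = \<ominus> v \<oplus> [(- k)] \<cdot>\<^bsub>G\<^esub> x" using p D(3) ipow by (simp add: ineg minus_add)
    moreover have "inverse z = inverse u * w powi (- k)" using p by (simp add: power_int_minus)
    ultimately show "(\<ominus> y, inverse z) \<in> H'" using H'I[OF D(5)[OF p(1)]] by metis
  next
    fix y z y' z' assume "(y, z) \<in> H'" "(y', z') \<in> H'"
    then obtain v u k v' u' k' where p: "(v, u) \<in> H" "y = v \<oplus> [(k::int)] \<cdot>\<^bsub>G\<^esub> x" "z = u * w powi k"
      and p': "(v', u') \<in> H" "y' = v' \<oplus> [(k'::int)] \<cdot>\<^bsub>G\<^esub> x" "z' = u' * w powi k'"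
      unfolding H'_def by blast
    have "y \<oplus> y' = (v \<oplus> v') \<oplus> [(k + k')] \<cdot>\<^bsub>G\<^esub> x"
      using p p' D(3) ipow by (simp add: iadd a_ac)
    moreover have "z * z' = (u * u') * w powi (k + k')" using p p' w0 by (simp add: power_int_add)
    ultimately show "(y \<oplus> y', z * z') \<in> H'" using H'I[OF D(6)[OF p(1) p'(1)]] by metis
  qed
  then show thesis using that sub xw w by blast
qed

text \<open>A maximal graph has full domain, for otherwise it could be enlarged by one step.\<close>

theorem char_graph_extends:
  assumes G: "char_graph G H"
  obtains \<chi> where "unit_char G \<chi>" "\<And>x z. (x, z) \<in> H \<Longrightarrow> \<chi> x = z"
proof -
  define S where "S = {K. char_graph G K \<and> H \<subseteq> K}"
  have "\<exists>K\<in>S. \<forall>X\<in>S. K \<subseteq> X \<longrightarrow> X = K"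
  proof (rule subset_Zorn_nonempty)
    show "S \<noteq> {}" using G by (auto simp: S_def)
    fix C assume C: "C \<noteq> {}" "subset.chain S C"
    have sub: "char_graph G K" "H \<subseteq> K" if "K \<in> C" for K using C that by (auto simp: S_def subset.chain_def)
    have "char_graph G (\<Union>C)"
      unfolding char_graph_def
    proof (intro conjI allI impI)
      show "(\<zero>, 1) \<in> \<Union>C" using C(1) char_graphD(1)[OF sub(1)] by blast
      show "z = 1" if "(\<zero>, z) \<in> \<Union>C" for z using that char_graphD(2)[OF sub(1)] by blast
      show "x \<in> carrier G" "cmod z = 1" "(\<ominus> x, inverse z) \<in> \<Union>C" if "(x, z) \<in> \<Union>C" for x z
        using that char_graphD(3-5)[OF sub(1)] by blast+
      show "(x \<oplus> y, z * w) \<in> \<Union>C" if xy: "(x, z) \<in> \<Union>C" "(y, w) \<in> \<Union>C" for x z y w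
      proof -
        obtain K L where KL: "K \<in> C" "(x, z) \<in> K" "L \<in> C" "(y, w) \<in> L" using xy by blast
        then have "K \<subseteq> L \<or> L \<subseteq> K" using C(2) by (auto simp: subset.chain_def)
        then show ?thesis using KL char_graphD(6)[OF sub(1)] by blast
      qed
    qed
    then show "\<Union>C \<in> S" using sub C(1) unfolding S_def by blast
  qed
  then obtain K where K: "K \<in> S" and max: "\<And>X. \<lbrakk>X \<in> S; K \<subseteq> X\<rbrakk> \<Longrightarrow> X = K" by blast
  have cK: "char_graph G K" "H \<subseteq> K" using K by (auto simp: S_def)
  note D = char_graphD[OF cK(1)]
  have dom: "x \<in> Domain K" if x: "x \<in> carrier G" for x
  proof (rule ccontr)
    assume nx: "x \<notin> Domain K"
    obtain K' w where K': "char_graph G K'" "K \<subseteq> K'" "(x, w) \<in> K'"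
      by (rule char_graph_step[OF cK(1) x nx])
    then have "K' = K" using max cK by (auto simp: S_def)
    then show False using K' nx by blast
  qed
  have func: "z = w" if "(x, z) \<in> K" "(x, w) \<in> K" for x z w
  proof -
    have "(x \<oplus> \<ominus> x, z * inverse w) \<in> K" by (rule D(6)[OF that(1) D(5)[OF that(2)]])
    then have "z * inverse w = 1" using D(2,3) that by (simp add: r_neg)
    moreover have "w \<noteq> 0" using D(4)[OF that(2)] by auto
    ultimately show ?thesis by (simp add: field_simps)
  qed
  define \<chi> where "\<chi> x = (THE z. (x, z) \<in> K)" for x
  have \<chi>: "\<chi> x = z" if "(x, z) \<in> K" for x z unfolding \<chi>_def using that func by blast
  have \<chi>K: "(x, \<chi> x) \<in> K" if "x \<in> carrier G" for x using dom[OF that] \<chi> by auto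
  have "unit_char G \<chi>"
    unfolding unit_char_def
  proof (intro conjI ballI)
    fix x y assume x: "x \<in> carrier G" and y: "y \<in> carrier G"
    show "cmod (\<chi> x) = 1" by (rule D(4)[OF \<chi>K[OF x]])
    show "\<chi> (x \<oplus> y) = \<chi> x * \<chi> y" by (rule \<chi>[OF D(6)[OF \<chi>K[OF x] \<chi>K[OF y]]])
  qed
  then show thesis using that \<chi> cK by blast
qed

lemma char_separates:
  assumes "x \<in> carrier G" "x \<noteq> \<zero>"
  obtains \<chi> where "unit_char G \<chi>" "\<chi> x \<noteq> 1"
proof -
  have triv: "char_graph G {(\<zero>, 1)}" by (simp add: char_graph_def)
  obtain H' w where H': "char_graph G H'" "(x, w) \<in> H'" "w \<noteq> 1"
    by (rule char_graph_step[OF triv, of x]) (use assms in auto)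
  obtain \<chi> where "unit_char G \<chi>" "\<And>x z. (x, z) \<in> H' \<Longrightarrow> \<chi> x = z"
    by (rule char_graph_extends[OF H'(1)]) blast
  then show thesis using that H' by metis
qed

end

text \<open>A product, indexed by \<open>'i\<close>, of copies of the group of characters of
  \<open>(R, +)\<close>, with the left action \<open>(a f)(s) = f (s a)\<close>. Functions are fixed
  to \<open>1\<close> off the carrier so that equality of functions is equality of
  characters.\<close>

definition char_module :: "('a, 'm) ring_scheme \<Rightarrow> ('a, 'i \<Rightarrow> 'a \<Rightarrow> complex) module" where
  "char_module R = \<lparr>carrier = {f. \<forall>i. unit_char R (f i) \<and> (\<forall>s. s \<notin> carrier R \<longrightarrow> f i s = 1)},
     monoid.mult = undefined, one = undefined, ring.zero = (\<lambda>_ _. 1),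
     add = (\<lambda>f g i s. f i s * g i s),
     smult = (\<lambda>a f i s. if s \<in> carrier R then f i (s \<otimes>\<^bsub>R\<^esub> a) else 1)\<rparr>"

lemma char_module_simps [simp]:
  "f \<in> carrier (char_module R) \<longleftrightarrow> (\<forall>i. unit_char R (f i) \<and> (\<forall>s. s \<notin> carrier R \<longrightarrow> f i s = 1))"
  "\<zero>\<^bsub>char_module R\<^esub> = (\<lambda>_ _. 1)"
  "f \<oplus>\<^bsub>char_module R\<^esub> g = (\<lambda>i s. f i s * g i s)"
  "a \<odot>\<^bsub>char_module R\<^esub> f = (\<lambda>i s. if s \<in> carrier R then f i (s \<otimes>\<^bsub>R\<^esub> a) else 1)"
  by (simp_all add: char_module_def)

section \<open>Injectivity of the character module, and the hull of the ring\<close>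

lemma (in ring) left_module_char_module:
  "left_module R (char_module R :: ('a, 'i \<Rightarrow> 'a \<Rightarrow> complex) module)" (is "left_module R ?C")
proof -
  have "abelian_group ?C"
  proof (rule abelian_groupI)
    fix f assume f: "f \<in> carrier ?C"
    show "\<exists>g\<in>carrier ?C. g \<oplus>\<^bsub>?C\<^esub> f = \<zero>\<^bsub>?C\<^esub>"
    proof (rule bexI)
      have "f i s \<noteq> 0" for i s
        using f by (cases "s \<in> carrier R") (auto simp: unit_char_def intro!: unit_nonzero)
      then show "(\<lambda>i s. inverse (f i s)) \<oplus>\<^bsub>?C\<^esub> f = \<zero>\<^bsub>?C\<^esub>" by simp
      show "(\<lambda>i s. inverse (f i s)) \<in> carrier ?C" using f by (auto simp: unit_char_def norm_inverse)
    qed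
  qed (auto simp: unit_char_def norm_mult mult_ac)
  then show ?thesis
    by (intro left_module.intro left_module_axioms.intro ring_axioms)
      (auto simp: unit_char_def l_distr r_distr m_assoc fun_eq_iff)
qed

text \<open>By adjunction: evaluation at \<open>\<one>\<close> turns a linear map into the module
  into a family of characters of the source group. Each of these extends along
  \<open>f\<close>.\<close>

lemma (in ring) injective_char_module:
  "injective_module TYPE('w) R (char_module R :: ('a, 'i \<Rightarrow> 'a \<Rightarrow> complex) module)"
  (is "injective_module _ R ?C")
  unfolding injective_module_def
proof (intro conjI allI impI; (elim conjE)?)
  show C: "left_module R ?C" by (rule left_module_char_module)
  fix A B :: "('a, 'w) module" and f g
  assume A: "left_module R A" and B: "left_module R B" and f: "f \<in> module_hom R A B"
    and inj: "inj_on f (carrier A)" and g: "g \<in> module_hom R A ?C"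
  interpret A: left_module R A by fact
  interpret B: left_module R B by fact
  note fD = module_homD[OF f] and gD = module_homD[OF g]
  have "\<exists>\<chi>. unit_char B \<chi> \<and> (\<forall>x\<in>carrier A. \<chi> (f x) = g x i \<one>)" for i
  proof -
    let ?H = "{(f x, g x i \<one>) | x. x \<in> carrier A}"
    have "char_graph B ?H"
      unfolding char_graph_def
    proof (intro conjI allI impI)
      have g0: "g \<zero>\<^bsub>A\<^esub> i \<one> = 1" using module_hom_zero[OF A C g] by simp
      have f0: "f \<zero>\<^bsub>A\<^esub> = \<zero>\<^bsub>B\<^esub>" by (rule module_hom_zero[OF A B f])
      show "(\<zero>\<^bsub>B\<^esub>, 1) \<in> ?H" using g0 f0 A.M.zero_closed by force
      fix z assume "(\<zero>\<^bsub>B\<^esub>, z) \<in> ?H"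
      then obtain x where "x \<in> carrier A" "f x = f \<zero>\<^bsub>A\<^esub>" "z = g x i \<one>" using f0 by auto
      then show "z = 1" using inj g0 by (auto dest: inj_onD)
    next
      fix y z assume "(y, z) \<in> ?H"
      then obtain x where x: "x \<in> carrier A" "y = f x" "z = g x i \<one>" by auto
      show "y \<in> carrier B" using x fD by simp
      show cz: "cmod z = 1" using x gD(1)[OF x(1)] by (simp add: unit_char_def)
      have "g (\<ominus>\<^bsub>A\<^esub> x) i \<one> * z = 1"
        using gD(2)[of "\<ominus>\<^bsub>A\<^esub> x" x] x module_hom_zero[OF A C g] by (simp add: A.M.l_neg fun_eq_iff)
      then have "inverse z = g (\<ominus>\<^bsub>A\<^esub> x) i \<one>" using cz by (metis inverse_unique mult.commute)
      moreover have "\<ominus>\<^bsub>B\<^esub> y = f (\<ominus>\<^bsub>A\<^esub> x)" using x module_hom_minus[OF A B f] by simp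
      ultimately show "(\<ominus>\<^bsub>B\<^esub> y, inverse z) \<in> ?H" using x by auto
    next
      fix y z y' z' assume "(y, z) \<in> ?H" "(y', z') \<in> ?H"
      then obtain x x' where x: "x \<in> carrier A" "y = f x" "z = g x i \<one>"
        and x': "x' \<in> carrier A" "y' = f x'" "z' = g x' i \<one>" by auto
      have "y \<oplus>\<^bsub>B\<^esub> y' = f (x \<oplus>\<^bsub>A\<^esub> x')" "z * z' = g (x \<oplus>\<^bsub>A\<^esub> x') i \<one>" using x x' fD gD by auto
      then show "(y \<oplus>\<^bsub>B\<^esub> y', z * z') \<in> ?H" using x x' by blast
    qed
    then obtain \<chi> where "unit_char B \<chi>" "\<And>x z. (x, z) \<in> ?H \<Longrightarrow> \<chi> x = z"
      by (rule B.M.char_graph_extends) blast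
    then show ?thesis by blast
  qed
  then obtain H where H: "\<And>i. unit_char B (H i)" "\<And>i x. x \<in> carrier A \<Longrightarrow> H i (f x) = g x i \<one>" by metis
  \<comment> \<open>The inverse direction of the adjunction, which recovers a linear map from the
    characters \<open>H i\<close>.\<close>
  define h where "h b = (\<lambda>i s. if s \<in> carrier R then H i (s \<odot>\<^bsub>B\<^esub> b) else 1)" for b
  show "\<exists>h\<in>module_hom R B ?C. \<forall>x\<in>carrier A. h (f x) = g x"
  proof (intro bexI ballI)
    fix x assume x: "x \<in> carrier A"
    show "h (f x) = g x"
    proof (intro ext)
      fix i s
      show "h (f x) i s = g x i s"
      proof (cases "s \<in> carrier R")
        case True
        then have "h (f x) i s = H i (f (s \<odot>\<^bsub>A\<^esub> x))" using fD x by (simp add: h_def)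
        also have "\<dots> = g (s \<odot>\<^bsub>A\<^esub> x) i \<one>" using H x True by simp
        also have "\<dots> = g x i s" using gD(3)[OF True x] True by simp
        finally show ?thesis .
      next
        case False
        then show ?thesis using gD(1)[OF x] by (simp add: h_def)
      qed
    qed
  next
    show "h \<in> module_hom R B ?C"
    proof (rule module_homI)
      fix b assume b: "b \<in> carrier B"
      show "h b \<in> carrier ?C" using H(1) b by (auto simp: h_def unit_char_def B.smult_l_distr)
      show "h (b \<oplus>\<^bsub>B\<^esub> b') = h b \<oplus>\<^bsub>?C\<^esub> h b'" if "b' \<in> carrier B" for b'
        using H(1) b that by (auto simp: h_def unit_char_def B.smult_r_distr fun_eq_iff)
      show "h (a \<odot>\<^bsub>B\<^esub> b) = a \<odot>\<^bsub>?C\<^esub> h b" if "a \<in> carrier R" for a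
        using b that by (auto simp: h_def B.smult_assoc1 fun_eq_iff)
    qed
  qed
qed

lemma injective_module_retract:
  assumes E: "injective_module TYPE('w) R E" and N: "left_module R N"
    and \<iota>: "\<iota> \<in> module_hom R N E" and \<rho>: "\<rho> \<in> module_hom R E N"
    and \<rho>\<iota>: "\<And>x. x \<in> carrier N \<Longrightarrow> \<rho> (\<iota> x) = x"
  shows "injective_module TYPE('w) R N"
  unfolding injective_module_def
proof (intro conjI allI impI N; elim conjE)
  fix A B :: "('a, 'w) module" and f g
  assume h: "left_module R A" "left_module R B" "f \<in> module_hom R A B" "inj_on f (carrier A)"
    and g: "g \<in> module_hom R A N"
  have "(\<lambda>x. \<iota> (g x)) \<in> module_hom R A E" by (rule module_hom_comp[OF g \<iota>])
  then obtain k where k: "k \<in> module_hom R B E" "\<forall>x\<in>carrier A. k (f x) = \<iota> (g x)"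
    using E h unfolding injective_module_def by meson
  show "\<exists>h\<in>module_hom R B N. \<forall>x\<in>carrier A. h (f x) = g x"
  proof (rule bexI[OF _ module_hom_comp[OF k(1) \<rho>]])
    show "\<forall>x\<in>carrier A. \<rho> (k (f x)) = g x" using k(2) \<rho>\<iota> module_homD(1)[OF g] by simp
  qed
qed

text \<open>The type argument is the carrier type of \<open>E\<close> itself, so that
  \<open>E\<close> and its submodules may serve as test modules.\<close>

lemma injective_imp_quasi_injective:
  fixes E :: "('a, 'b) module"
  assumes E: "injective_module TYPE('b) R E"
  shows "quasi_injective_module R E"
proof -
  interpret left_module R E using E by (simp add: injective_module_def)
  show ?thesis
  proof unfold_locales
    fix N \<theta> assume N: "submodule N R E" and \<theta>: "\<theta> \<in> module_hom R (E\<lparr>carrier := N\<rparr>) E"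
    have "(\<lambda>x. x) \<in> module_hom R (E\<lparr>carrier := N\<rparr>) E"
      by (rule module_homI) (use submoduleD(2)[OF N] in auto)
    then have "\<exists>f\<in>module_hom R E E. \<forall>x\<in>carrier (E\<lparr>carrier := N\<rparr>). f x = \<theta> x"
      using E left_module_submodule[OF N] left_module_axioms \<theta> inj_on_id2
      unfolding injective_module_def by blast
    then show "\<exists>f\<in>module_hom R E E. \<forall>x\<in>N. f x = \<theta> x" by simp
  qed
qed

lemma injective_module_idempotent_image:
  assumes E: "injective_module TYPE('w) R E" and \<pi>: "\<pi> \<in> module_hom R E E"
    and idem: "\<And>x. x \<in> carrier E \<Longrightarrow> \<pi> (\<pi> x) = \<pi> x"
  shows "injective_module TYPE('w) R (E\<lparr>carrier := \<pi> ` carrier E\<rparr>)"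
proof (rule injective_module_retract[OF E, where \<iota> = "\<lambda>x. x" and \<rho> = \<pi>])
  interpret left_module R E using E by (simp add: injective_module_def)
  note D = module_homD[OF \<pi>]
  have sub: "submodule (\<pi> ` carrier E) R E" by (rule submodule_image[OF left_module_axioms left_module_axioms \<pi>])
  show "left_module R (E\<lparr>carrier := \<pi> ` carrier E\<rparr>)" by (rule left_module_submodule[OF sub])
  show "(\<lambda>x. x) \<in> module_hom R (E\<lparr>carrier := \<pi> ` carrier E\<rparr>) E"
    by (rule module_homI) (use D(1) in auto)
  show "\<pi> \<in> module_hom R E (E\<lparr>carrier := \<pi> ` carrier E\<rparr>)"
    by (rule module_homI) (use D in auto)
qed (use idem in auto)

text \<open>One \<open>E\<close> has to be injective for three types at once: its own carrier type
  for extending partial endomorphisms, that of the invariance hypothesis, and that of the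
  conclusion. It arises by cutting the hull of \<open>R u\<close> out of the character module by an
  idempotent.\<close>

theorem (in ring) exists_injective_hull:
  obtains E :: "('a, 'a \<Rightarrow> 'a \<Rightarrow> complex) module" and u
  where "injective_module TYPE('w1) R E" "injective_module TYPE('w2) R E" "injective_module TYPE('w3) R E"
    "u \<in> carrier E" "\<And>r. \<lbrakk>r \<in> carrier R; r \<odot>\<^bsub>E\<^esub> u = \<zero>\<^bsub>E\<^esub>\<rbrakk> \<Longrightarrow> r = \<zero>"
    "\<And>x. \<lbrakk>x \<in> carrier E; x \<noteq> \<zero>\<^bsub>E\<^esub>\<rbrakk> \<Longrightarrow>
      \<exists>r\<in>carrier R. \<exists>s\<in>carrier R. r \<odot>\<^bsub>E\<^esub> x = s \<odot>\<^bsub>E\<^esub> u \<and> r \<odot>\<^bsub>E\<^esub> x \<noteq> \<zero>\<^bsub>E\<^esub>"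
proof -
  let ?C = "char_module R :: ('a, 'a \<Rightarrow> 'a \<Rightarrow> complex) module"
  interpret C: quasi_injective_module R ?C
    by (rule injective_imp_quasi_injective[OF injective_char_module])
  have "\<exists>\<chi>. unit_char R \<chi> \<and> (i \<in> carrier R \<and> i \<noteq> \<zero> \<longrightarrow> \<chi> i \<noteq> 1)" for i
  proof (cases "i \<in> carrier R \<and> i \<noteq> \<zero>")
    case True
    then show ?thesis using char_separates by metis
  next
    case False
    then show ?thesis by (intro exI[of _ "\<lambda>_. 1"]) (auto simp: unit_char_def)
  qed
  then obtain X where X: "\<And>i. unit_char R (X i)" "\<And>i. \<lbrakk>i \<in> carrier R; i \<noteq> \<zero>\<rbrakk> \<Longrightarrow> X i i \<noteq> 1" by metis
  \<comment> \<open>The product is indexed by the ring elements, with a character nontrivial at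
    \<open>i\<close> in component \<open>i\<close>. If \<open>r u = 0\<close>, component
    \<open>r\<close> evaluated at \<open>\<one>\<close> gives \<open>X r r = 1\<close>, hence
    \<open>r = \<zero>\<close>.\<close>
  define u where "u = (\<lambda>i s. if s \<in> carrier R then X i s else 1)"
  have u: "u \<in> carrier ?C" using X(1) by (auto simp: u_def unit_char_def)
  have faithful: "r = \<zero>" if r: "r \<in> carrier R" "r \<odot>\<^bsub>?C\<^esub> u = \<zero>\<^bsub>?C\<^esub>" for r
  proof (rule ccontr)
    assume "r \<noteq> \<zero>"
    moreover have "X r r = 1" using arg_cong[OF r(2), of "\<lambda>f. f r \<one>"] r(1) by (simp add: u_def)
    ultimately show False using X(2)[OF r(1)] by simp
  qed
  let ?N = "{r \<odot>\<^bsub>?C\<^esub> u | r. r \<in> carrier R}"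
  have N: "submodule ?N R ?C" by (rule C.submodule_cyclic[OF u])
  have Z: "submodule {\<zero>\<^bsub>?C\<^esub>} R ?C" unfolding C.submodule_iff using C.M.zero_closed by auto
  have NZ: "?N \<inter> {\<zero>\<^bsub>?C\<^esub>} = {\<zero>\<^bsub>?C\<^esub>}" using C.submoduleD(3)[OF N] by blast
  obtain \<pi> where \<pi>: "\<pi> \<in> module_hom R ?C ?C" "\<And>x. x \<in> carrier ?C \<Longrightarrow> \<pi> (\<pi> x) = \<pi> x" "\<And>x. x \<in> ?N \<Longrightarrow> \<pi> x = x"
    "\<And>x. \<lbrakk>x \<in> carrier ?C; \<pi> x \<noteq> \<zero>\<^bsub>?C\<^esub>\<rbrakk> \<Longrightarrow> \<exists>r\<in>carrier R. r \<odot>\<^bsub>?C\<^esub> \<pi> x \<in> ?N \<and> r \<odot>\<^bsub>?C\<^esub> \<pi> x \<noteq> \<zero>\<^bsub>?C\<^esub>"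
    by (rule C.hull_idempotent[OF N Z NZ]) blast
  let ?E = "?C\<lparr>carrier := \<pi> ` carrier ?C\<rparr>"
  note inj = injective_module_idempotent_image[OF injective_char_module \<pi>(1,2)]
  have "u \<in> ?N" by (intro CollectI exI[of _ \<one>] conjI C.smult_one[OF u, symmetric] one_closed)
  then have uE: "u \<in> carrier ?E" using \<pi>(3) u by force
  show thesis
  proof (rule that[OF inj inj inj uE])
    show "r = \<zero>" if "r \<in> carrier R" "r \<odot>\<^bsub>?E\<^esub> u = \<zero>\<^bsub>?E\<^esub>" for r
      using faithful that by simp
    fix x assume x: "x \<in> carrier ?E" "x \<noteq> \<zero>\<^bsub>?E\<^esub>"
    then obtain y where y: "y \<in> carrier ?C" "x = \<pi> y" by auto
    then obtain r where "r \<in> carrier R" "r \<odot>\<^bsub>?C\<^esub> x \<in> ?N" "r \<odot>\<^bsub>?C\<^esub> x \<noteq> \<zero>\<^bsub>?C\<^esub>"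
      using \<pi>(4)[OF y(1)] x by auto
    then show "\<exists>r\<in>carrier R. \<exists>s\<in>carrier R. r \<odot>\<^bsub>?E\<^esub> x = s \<odot>\<^bsub>?E\<^esub> u \<and> r \<odot>\<^bsub>?E\<^esub> x \<noteq> \<zero>\<^bsub>?E\<^esub>"
      by auto
  qed
qed

section \<open>Left self-injectivity\<close>

lemma infinite_pairing:
  includes cardinal_syntax
  obtains g :: "(nat + 'a) \<times> (nat + 'a) \<Rightarrow> nat + 'a" where "inj g"
proof -
  have "infinite (UNIV :: (nat + 'a) set)" by (simp add: finite_Plus_UNIV_iff)
  then have "|UNIV \<times> UNIV :: ((nat + 'a) \<times> (nat + 'a)) set| =o |UNIV :: (nat + 'a) set|"
    by (rule card_of_Times_same_infinite)
  then have "|UNIV :: ((nat + 'a) \<times> (nat + 'a)) set| \<le>o |UNIV :: (nat + 'a) set|"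
    by (simp add: ordIso_iff_ordLeq)
  then obtain g :: "(nat + 'a) \<times> (nat + 'a) \<Rightarrow> nat + 'a" where "inj_on g UNIV"
    unfolding card_of_ordLeq[symmetric] by blast
  then show thesis by (rule that)
qed

text \<open>A sequence is coded by its graph, with pairs coded as elements of
  \<open>nat + 'a\<close>.\<close>

lemma inj_seq_embedding:
  obtains j :: "(nat \<Rightarrow> 'a) \<Rightarrow> (nat + 'a) set" where "inj j"
proof -
  obtain g :: "(nat + 'a) \<times> (nat + 'a) \<Rightarrow> nat + 'a" where g: "inj g" by (rule infinite_pairing)
  have "inj (\<lambda>v :: nat \<Rightarrow> 'a. {g (Inl n, Inr (v n)) | n. True})"
  proof (rule injI, rule ext)
    fix v w :: "nat \<Rightarrow> 'a" and n
    assume eq: "{g (Inl n, Inr (v n)) | n. True} = {g (Inl n, Inr (w n)) | n. True}"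
    have "g (Inl n, Inr (v n)) \<in> {g (Inl n, Inr (v n)) | n. True}" by blast
    then obtain k where "g (Inl n, Inr (v n)) = g (Inl k, Inr (w k))" unfolding eq by blast
    then show "v n = w n" using injD[OF g] by blast
  qed
  then show thesis by (rule that)
qed

text \<open>A complex number is coded by the lower rational cuts of its real and imaginary parts;
  the boolean tells the two apart.\<close>

lemma inj_complex_nat_set:
  obtains c :: "complex \<Rightarrow> nat set" where "inj c"
proof -
  define c :: "complex \<Rightarrow> nat set" where
    "c z = {to_nat (b, q) | b q. of_rat q < (if b then Re z else Im z)}" for z
  have mem: "to_nat (b, q) \<in> c z \<longleftrightarrow> of_rat q < (if b then Re z else Im z)" for b q z
    by (auto simp: c_def)
  have real_eqI: "x = y" if "\<And>q. (of_rat q < x) = (of_rat q < y)" for x y :: real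
  proof (rule ccontr)
    assume "x \<noteq> y"
    then consider "x < y" | "y < x" by linarith
    then show False using that of_rat_dense by (metis less_asym)
  qed
  have "inj c"
  proof (rule injI)
    fix z w assume "c z = c w"
    then have *: "of_rat q < (if b then Re z else Im z) \<longleftrightarrow> of_rat q < (if b then Re w else Im w)" for b q
      using mem by metis
    have "Re z = Re w" using *[where b = True] by (intro real_eqI) simp
    moreover have "Im z = Im w" using *[where b = False] by (intro real_eqI) simp
    ultimately show "z = w" by (simp add: complex_eq_iff)
  qed
  then show thesis by (rule that)
qed

lemma inj_char_embedding:
  obtains j :: "('a \<Rightarrow> 'a \<Rightarrow> complex) \<Rightarrow> (nat + 'a) set" where "inj j"
proof -
  obtain g :: "(nat + 'a) \<times> (nat + 'a) \<Rightarrow> nat + 'a" where g: "inj g" by (rule infinite_pairing)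
  obtain c :: "complex \<Rightarrow> nat set" where c: "inj c" by (rule inj_complex_nat_set)
  define j where "j f = {g (g (Inr x, Inr y), Inl n) | x y n. n \<in> c (f x y)}" for f :: "'a \<Rightarrow> 'a \<Rightarrow> complex"
  have mem: "g (g (Inr x, Inr y), Inl n) \<in> j f \<longleftrightarrow> n \<in> c (f x y)" for f x y n
    unfolding j_def by (auto dest!: injD[OF g])
  have "inj j"
  proof (rule injI, intro ext)
    fix f h :: "'a \<Rightarrow> 'a \<Rightarrow> complex" and x y
    assume "j f = j h"
    then have "n \<in> c (f x y) \<longleftrightarrow> n \<in> c (h x y)" for n using mem by metis
    then have "c (f x y) = c (h x y)" by blast
    then show "f x y = h x y" by (rule injD[OF c])
  qed
  then show thesis by (rule that)
qed

text \<open>The invariance hypothesis speaks only of envelopes with carrier in \<open>'u\<close>.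
  The copy of \<open>E\<close> there, with \<open>r \<mapsto> j (r u)\<close>, is one, and
  conjugation by \<open>j\<close> turns \<open>\<phi>\<close> into an automorphism of it. The claim
  is the image of \<open>\<one>\<close> pulled back.\<close>

lemma automorphism_invariant_transport:
  fixes R :: "('a, 'm) ring_scheme" and E :: "('a, 'b) module" and j :: "'b \<Rightarrow> 'u"
  assumes "ring R" and inv: "left_automorphism_invariant TYPE('u) R" and j: "inj j"
    and E: "injective_module TYPE('u) R E" and u: "u \<in> carrier E"
    and faithful: "\<And>r. \<lbrakk>r \<in> carrier R; r \<odot>\<^bsub>E\<^esub> u = \<zero>\<^bsub>E\<^esub>\<rbrakk> \<Longrightarrow> r = \<zero>\<^bsub>R\<^esub>"
    and ess: "\<And>x. \<lbrakk>x \<in> carrier E; x \<noteq> \<zero>\<^bsub>E\<^esub>\<rbrakk> \<Longrightarrow>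
      \<exists>r\<in>carrier R. \<exists>s\<in>carrier R. r \<odot>\<^bsub>E\<^esub> x = s \<odot>\<^bsub>E\<^esub> u \<and> r \<odot>\<^bsub>E\<^esub> x \<noteq> \<zero>\<^bsub>E\<^esub>"
    and \<phi>: "module_automorphism R E \<phi>"
  shows "\<exists>c\<in>carrier R. \<phi> u = c \<odot>\<^bsub>E\<^esub> u"
proof -
  have lE: "left_module R E" using E by (simp add: injective_module_def)
  interpret E: left_module R E by fact
  have lR: "left_module R (regular_module R)" by (rule E.R.left_module_regular_module)
  interpret RR: left_module R "regular_module R" by (rule lR)
  have jo: "inj_on j (carrier E)" using j by (rule inj_on_subset) simp
  let ?T = "transport_module j E" and ?k = "inv_into (carrier E) j"
  note T = transport_module[OF lE jo]
  interpret T: left_module R ?T by (rule T(1))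
  have kj: "?k (j x) = x" if "x \<in> carrier E" for x using jo that by simp
  let ?i = "\<lambda>r. j (r \<odot>\<^bsub>E\<^esub> u)"
  have m: "(\<lambda>r. r \<odot>\<^bsub>E\<^esub> u) \<in> module_hom R (regular_module R) E"
    by (rule module_homI) (use u in \<open>auto simp: E.smult_l_distr E.smult_assoc1\<close>)
  have i: "?i \<in> module_hom R (regular_module R) ?T" by (rule module_hom_comp[OF m T(2)])
  have i_inj: "inj_on ?i (carrier R)"
  proof (rule inj_onI)
    fix r s assume rs: "r \<in> carrier R" "s \<in> carrier R" "?i r = ?i s"
    then have "(r \<ominus>\<^bsub>R\<^esub> s) \<odot>\<^bsub>E\<^esub> u = \<zero>\<^bsub>E\<^esub>"
      using injD[OF j] u by (simp add: E.smult_l_diff E.module_minus_eq_zero_iff)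
    then have "r \<ominus>\<^bsub>R\<^esub> s = \<zero>\<^bsub>R\<^esub>" using faithful rs by simp
    then show "r = s" using rs E.minus_eq_zero_iff by simp
  qed
  have "injective_envelope TYPE('u) R (regular_module R) ?T ?i"
    unfolding injective_envelope_def essential_submodule_def
  proof (intro conjI allI impI; (elim conjE)?)
    show "injective_module TYPE('u) R ?T"
      by (rule injective_module_retract[OF E T(1) T(3) T(2)]) (use kj in auto)
    show "?i \<in> module_hom R (regular_module R) ?T" by (rule i)
    show "inj_on ?i (carrier (regular_module R))" using i_inj by simp
    show "submodule (?i ` carrier (regular_module R)) R ?T" by (rule submodule_image[OF lR T(1) i])
    fix L assume L: "submodule L R ?T" "?i ` carrier (regular_module R) \<inter> L = {\<zero>\<^bsub>?T\<^esub>}"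
    have "y = \<zero>\<^bsub>?T\<^esub>" if y: "y \<in> L" for y
    proof (rule ccontr)
      assume ny: "y \<noteq> \<zero>\<^bsub>?T\<^esub>"
      obtain x where x: "x \<in> carrier E" "y = j x" using T.submoduleD(2)[OF L(1) y] by auto
      then have "x \<noteq> \<zero>\<^bsub>E\<^esub>" using ny by auto
      then obtain r s where rs: "r \<in> carrier R" "s \<in> carrier R" "r \<odot>\<^bsub>E\<^esub> x = s \<odot>\<^bsub>E\<^esub> u" "r \<odot>\<^bsub>E\<^esub> x \<noteq> \<zero>\<^bsub>E\<^esub>"
        using ess x by blast
      have "r \<odot>\<^bsub>?T\<^esub> y = j (r \<odot>\<^bsub>E\<^esub> x)" using module_homD(3)[OF T(2) rs(1) x(1)] x by simp
      moreover have "r \<odot>\<^bsub>?T\<^esub> y \<in> L" by (rule T.submoduleD(5)[OF L(1) rs(1) y])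
      ultimately have "?i s \<in> ?i ` carrier (regular_module R) \<inter> L" using rs by simp
      then have "j (s \<odot>\<^bsub>E\<^esub> u) = j \<zero>\<^bsub>E\<^esub>" using L(2) by auto
      then show False using injD[OF j] rs by metis
    qed
    then show "L = {\<zero>\<^bsub>?T\<^esub>}" using T.submoduleD(3)[OF L(1)] by blast
  qed
  moreover have "module_automorphism R ?T (\<lambda>y. j (\<phi> (?k y)))"
    unfolding module_automorphism_def
  proof
    have \<phi>h: "\<phi> \<in> module_hom R E E" and \<phi>b: "bij_betw \<phi> (carrier E) (carrier E)"
      using \<phi> by (auto simp: module_automorphism_def)
    show "(\<lambda>y. j (\<phi> (?k y))) \<in> module_hom R ?T ?T"
      by (rule module_hom_comp[OF module_hom_comp[OF T(3) \<phi>h] T(2)])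
    have jb: "bij_betw j (carrier E) (carrier ?T)" using jo by (simp add: bij_betw_def)
    have "bij_betw (j \<circ> (\<phi> \<circ> ?k)) (carrier ?T) (carrier ?T)"
      by (rule bij_betw_trans[OF bij_betw_trans[OF bij_betw_inv_into[OF jb] \<phi>b] jb])
    then show "bij_betw (\<lambda>y. j (\<phi> (?k y))) (carrier ?T) (carrier ?T)" by (simp add: comp_def)
  qed
  ultimately have "(\<lambda>y. j (\<phi> (?k y))) ` (?i ` carrier (regular_module R)) \<subseteq> ?i ` carrier (regular_module R)"
    using inv unfolding left_automorphism_invariant_def automorphism_invariant_module_def by blast
  moreover have "?i \<one>\<^bsub>R\<^esub> \<in> ?i ` carrier (regular_module R)" by simp
  ultimately have "j (\<phi> (?k (?i \<one>\<^bsub>R\<^esub>))) \<in> ?i ` carrier R" by (auto simp del: E.smult_one)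
  then have "j (\<phi> u) \<in> ?i ` carrier R" using kj u by simp
  then show ?thesis using injD[OF j] by auto
qed

theorem theorem2p4:
  fixes R :: "('a, 'm) ring_scheme"
  assumes "ring R"
    and "\<exists>emb :: (nat + 'a) set \<Rightarrow> 'u. inj emb"
    and "right_perfect TYPE('u) R"
    and "left_automorphism_invariant TYPE('u) R"
  shows "left_self_injective TYPE('v) R"
proof -
  interpret ring R by fact
  obtain emb :: "(nat + 'a) set \<Rightarrow> 'u" where emb: "inj emb" using assms(2) by blast
  obtain j1 :: "(nat \<Rightarrow> 'a) \<Rightarrow> (nat + 'a) set" where j1: "inj j1" by (rule inj_seq_embedding)
  obtain j2 :: "('a \<Rightarrow> 'a \<Rightarrow> complex) \<Rightarrow> (nat + 'a) set" where j2: "inj j2" by (rule inj_char_embedding)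
  interpret left_dcc R by (rule right_perfect_imp_left_dcc[OF assms(3) inj_compose[OF emb j1]])
  obtain E :: "('a, 'a \<Rightarrow> 'a \<Rightarrow> complex) module" and u where
    E: "injective_module TYPE('a \<Rightarrow> 'a \<Rightarrow> complex) R E" "injective_module TYPE('u) R E"
      "injective_module TYPE('v) R E"
    and u: "u \<in> carrier E"
    and faithful: "\<And>r. \<lbrakk>r \<in> carrier R; r \<odot>\<^bsub>E\<^esub> u = \<zero>\<^bsub>E\<^esub>\<rbrakk> \<Longrightarrow> r = \<zero>\<^bsub>R\<^esub>"
    and ess: "\<And>x. \<lbrakk>x \<in> carrier E; x \<noteq> \<zero>\<^bsub>E\<^esub>\<rbrakk> \<Longrightarrow>
      \<exists>r\<in>carrier R. \<exists>s\<in>carrier R. r \<odot>\<^bsub>E\<^esub> x = s \<odot>\<^bsub>E\<^esub> u \<and> r \<odot>\<^bsub>E\<^esub> x \<noteq> \<zero>\<^bsub>E\<^esub>"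
    by (rule exists_injective_hull) blast
  interpret E: quasi_injective_module R E by (rule injective_imp_quasi_injective[OF E(1)])
  interpret E: essential_generator R E u
  proof unfold_locales
    show "\<exists>c\<in>carrier R. \<phi> u = c \<odot>\<^bsub>E\<^esub> u" if "module_automorphism R E \<phi>" for \<phi>
      by (rule automorphism_invariant_transport[OF assms(1,4) inj_compose[OF emb j2] E(2) u faithful ess that])
  qed (use u faithful ess in blast)+
  let ?i = "\<lambda>r. r \<odot>\<^bsub>E\<^esub> u"
  have i: "?i \<in> module_hom R (regular_module R) E"
    by (rule module_homI) (use u in \<open>auto simp: E.smult_l_distr E.smult_assoc1\<close>)
  have i_inj: "inj_on ?i (carrier R)" by (rule inj_onI) (rule E.gen_cancel)
  \<comment> \<open>The hull is no larger than the ring, so \<open>r \<mapsto> r u\<close> is an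
    isomorphism and injectivity passes from \<open>E\<close> to the regular module, for the type
    \<open>'v\<close> by the third property of \<open>E\<close>.\<close>
  have i_surj: "?i ` carrier R = carrier E" using E.span_eq_carrier unfolding E.span_def by auto
  let ?\<rho> = "inv_into (carrier R) ?i"
  have \<rho>: "?\<rho> (?i r) = r" if "r \<in> carrier R" for r using inv_into_f_f[OF i_inj that] .
  have "?\<rho> \<in> module_hom R E (regular_module R)"
  proof (rule module_homI)
    fix x assume "x \<in> carrier E"
    then obtain r where r: "r \<in> carrier R" "x = ?i r" using i_surj by blast
    then show "?\<rho> x \<in> carrier (regular_module R)" using \<rho> by simp
    show "?\<rho> (x \<oplus>\<^bsub>E\<^esub> y) = ?\<rho> x \<oplus>\<^bsub>regular_module R\<^esub> ?\<rho> y" if y: "y \<in> carrier E" for y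
    proof -
      obtain s where s: "s \<in> carrier R" "y = ?i s" using y i_surj by blast
      have "x \<oplus>\<^bsub>E\<^esub> y = ?i (r \<oplus>\<^bsub>R\<^esub> s)" using r s u by (simp add: E.smult_l_distr)
      then show ?thesis using \<rho>[of "r \<oplus>\<^bsub>R\<^esub> s"] \<rho> r s by simp
    qed
    show "?\<rho> (a \<odot>\<^bsub>E\<^esub> x) = a \<odot>\<^bsub>regular_module R\<^esub> ?\<rho> x" if a: "a \<in> carrier R" for a
    proof -
      have "a \<odot>\<^bsub>E\<^esub> x = ?i (a \<otimes>\<^bsub>R\<^esub> r)" using r a u by (simp add: E.smult_assoc1)
      then show ?thesis using \<rho>[of "a \<otimes>\<^bsub>R\<^esub> r"] \<rho> r a by simp
    qed
  qed
  then have "injective_module TYPE('v) R (regular_module R)"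
    by (rule injective_module_retract[OF E(3) left_module_regular_module i]) (use \<rho> in simp)
  then show ?thesis by (simp add: left_self_injective_def)
qed

end
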